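(* Let $T=\mathbb C/\Lambda$ be a complex torus, let $N\ge1$, and let $\rho:C_N\to\mathrm{Aut}(\mathfrak{sl}_2)$ and $\sigma:C_N\to t(T)$ be injective homomorphisms, where $t(T)$ is the group of translations of $T$. Let $\mathbb T=T\setminus\sigma(C_N)\cdot\{0\}$. Then $$(\mathfrak{sl}_2\otimes_{\mathbb C}\mathcal O_{\mathbb T})^{\rho\otimes\tilde\sigma(C_N)}\cong\mathfrak{sl}_2\otimes_{\mathbb C}\mathcal O_{\mathbb T}^{\tilde\sigma(C_N)}.$$ Moreover, there are a lattice $\Lambda'$ and elements $E,F,H$ of $(\mathfrak{sl}_2\otimes_{\mathbb C}\mathcal O_{\mathbb T})^{\rho\otimes\tilde\sigma(C_N)}$ such that $$(\mathfrak{sl}_2\otimes_{\mathbb C}\mathcal O_{\mathbb T})^{\rho\otimes\tilde\sigma(C_N)}=\mathbb C\langle E,F,H\rangle\otimes_{\mathbb C}\mathbb C[\wp_{\Lambda'},\wp_{\Lambda'}'],$$ with $\mathbb C[\wp_{\Lambda'},\wp_{\Lambda'}']$-linear brackets $[H,E]=2E$, $[H,F]=-2F$ and $[E,F]=H$.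
   Context: $\mathfrak{sl}_2=\mathfrak{sl}_2(\mathbb C)$ and $C_N$ is the cyclic group of order $N$. $\mathcal O_{\mathbb T}$ is the $\mathbb C$-algebra of meromorphic functions on $T$ that are holomorphic on $\mathbb T$, and $\tilde\sigma(\gamma)f=f\circ\sigma(\gamma)^{-1}$. The current algebra $\mathfrak{sl}_2\otimes_{\mathbb C}\mathcal O_{\mathbb T}$ has bracket $[A\otimes f,B\otimes g]=[A,B]\otimes fg$, and $C_N$ acts on it by $\gamma\cdot(A\otimes f)=\rho(\gamma)A\otimes\tilde\sigma(\gamma)f$. A superscript $\rho\otimes\tilde\sigma(C_N)$ (respectively $\tilde\sigma(C_N)$) denotes the subspace of invariants. For a lattice $\Lambda'$, $\wp_{\Lambda'}(z)=z^{-2}+\sum_{0\neq\omega\in\Lambda'}\big((z-\omega)^{-2}-\omega^{-2}\big)$ is the Weierstrass function and $\wp_{\Lambda'}'$ is its derivative. *)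

theory Defs
  imports "HOL-Complex_Analysis.Complex_Analysis"
begin

definition lattice_gens :: "complex \<Rightarrow> complex \<Rightarrow> bool" where
  "lattice_gens w1 w2 \<longleftrightarrow> w1 \<noteq> 0 \<and> Im (w2 / w1) \<noteq> 0"

definition lattice :: "complex \<Rightarrow> complex \<Rightarrow> complex set" where
  "lattice w1 w2 = {of_int m * w1 + of_int n * w2 | m n. True}"

definition wp :: "complex set \<Rightarrow> complex \<Rightarrow> complex" where
  "wp L z = 1 / z^2 + infsum (\<lambda>w. 1 / (z - w)^2 - 1 / w^2) (L - {0})"

definition wp' :: "complex set \<Rightarrow> complex \<Rightarrow> complex" where
  "wp' L z = deriv (wp L) z"

definition wp_poly_alg :: "complex set \<Rightarrow> (complex \<Rightarrow> complex) set" where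
  "wp_poly_alg L = {f. \<exists>(n::nat) (c::nat \<Rightarrow> nat \<Rightarrow> complex).
      f = (\<lambda>z. \<Sum>i\<le>n. \<Sum>j\<le>n. c i j * wp L z ^ i * wp' L z ^ j)}"

definition tr2 :: "complex^2^2 \<Rightarrow> complex" where
  "tr2 A = A$1$1 + A$2$2"

definition sl2 :: "(complex^2^2) set" where
  "sl2 = {A. tr2 A = 0}"

definition br :: "complex^2^2 \<Rightarrow> complex^2^2 \<Rightarrow> complex^2^2" where
  "br A B = A ** B - B ** A"

definition msc :: "complex \<Rightarrow> complex^2^2 \<Rightarrow> complex^2^2" where
  "msc c A = (\<chi> i j. c * A$i$j)"

text \<open>Lie algebra automorphisms of sl2 (only their action on sl2 matters).\<close>
definition sl2_aut :: "(complex^2^2 \<Rightarrow> complex^2^2) \<Rightarrow> bool" where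
  "sl2_aut g \<longleftrightarrow> bij_betw g sl2 sl2
     \<and> (\<forall>A\<in>sl2. \<forall>B\<in>sl2. \<forall>c. g (msc c A + B) = msc c (g A) + g B)
     \<and> (\<forall>A\<in>sl2. \<forall>B\<in>sl2. g (br A B) = br (g A) (g B))"

definition inj_hom_aut :: "nat \<Rightarrow> (nat \<Rightarrow> complex^2^2 \<Rightarrow> complex^2^2) \<Rightarrow> bool" where
  "inj_hom_aut N \<rho> \<longleftrightarrow>
     (\<forall>i<N. sl2_aut (\<rho> i))
   \<and> (\<forall>i<N. \<forall>j<N. \<forall>A\<in>sl2. \<rho> ((i + j) mod N) A = \<rho> i (\<rho> j A))
   \<and> (\<forall>i<N. \<forall>j<N. i \<noteq> j \<longrightarrow> (\<exists>A\<in>sl2. \<rho> i A \<noteq> \<rho> j A))"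

text \<open>sigma : C_N -> t(T), injective homomorphism; sigma i is (a representative of)
  the translation amount, i.e. sigma(i) is the translation [z] |-> [z + sigma i] of T = C/L.\<close>
definition inj_hom_transl :: "nat \<Rightarrow> complex set \<Rightarrow> (nat \<Rightarrow> complex) \<Rightarrow> bool" where
  "inj_hom_transl N L \<sigma> \<longleftrightarrow>
     (\<forall>i<N. \<forall>j<N. \<sigma> ((i + j) mod N) - (\<sigma> i + \<sigma> j) \<in> L)
   \<and> (\<forall>i<N. \<forall>j<N. i \<noteq> j \<longrightarrow> \<sigma> i - \<sigma> j \<notin> L)"

text \<open>Preimage in C of the removed finite set sigma(C_N).{0} of T.\<close>
definition sing_set :: "nat \<Rightarrow> complex set \<Rightarrow> (nat \<Rightarrow> complex) \<Rightarrow> complex set" where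
  "sing_set N L \<sigma> = {\<sigma> i + w | i w. i < N \<and> w \<in> L}"

text \<open>Convention: elements of O_TT are represented as L-periodic meromorphic functions on C,
  holomorphic off S, normalised to take the value 0 on S (values at poles carry no meaning).\<close>
definition O_TT :: "complex set \<Rightarrow> complex set \<Rightarrow> (complex \<Rightarrow> complex) set" where
  "O_TT L S = {f. f meromorphic_on UNIV \<and> f holomorphic_on (- S)
      \<and> (\<forall>z. \<forall>w\<in>L. f (z + w) = f z) \<and> (\<forall>z\<in>S. f z = 0)}"

definition O_TT_inv :: "nat \<Rightarrow> complex set \<Rightarrow> (nat \<Rightarrow> complex) \<Rightarrow> (complex \<Rightarrow> complex) set" where
  "O_TT_inv N L \<sigma> = {f \<in> O_TT L (sing_set N L \<sigma>). \<forall>i<N. \<forall>z. f (z - \<sigma> i) = f z}"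

definition sl2_tensor :: "(complex \<Rightarrow> complex) set \<Rightarrow> (complex \<Rightarrow> complex^2^2) set" where
  "sl2_tensor R = {X. (\<forall>z. X z \<in> sl2) \<and> (\<forall>i j. (\<lambda>z. X z $ i $ j) \<in> R)}"

text \<open>Invariants under gamma.(A (x) f) = rho(gamma) A (x) f o sigma(gamma)^{-1}.\<close>
definition sl2_tensor_inv ::
  "nat \<Rightarrow> complex set \<Rightarrow> (nat \<Rightarrow> complex^2^2 \<Rightarrow> complex^2^2) \<Rightarrow> (nat \<Rightarrow> complex)
     \<Rightarrow> (complex \<Rightarrow> complex^2^2) set" where
  "sl2_tensor_inv N L \<rho> \<sigma> = {X \<in> sl2_tensor (O_TT L (sing_set N L \<sigma>)).
      \<forall>i<N. \<forall>z. \<rho> i (X (z - \<sigma> i)) = X z}"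

definition fbr :: "(complex \<Rightarrow> complex^2^2) \<Rightarrow> (complex \<Rightarrow> complex^2^2) \<Rightarrow> complex \<Rightarrow> complex^2^2" where
  "fbr X Y = (\<lambda>z. br (X z) (Y z))"

definition lie_iso_C ::
  "((complex \<Rightarrow> complex^2^2) \<Rightarrow> (complex \<Rightarrow> complex^2^2)) \<Rightarrow>
   (complex \<Rightarrow> complex^2^2) set \<Rightarrow> (complex \<Rightarrow> complex^2^2) set \<Rightarrow> bool" where
  "lie_iso_C \<Phi> A B \<longleftrightarrow> bij_betw \<Phi> A B
     \<and> (\<forall>X\<in>A. \<forall>Y\<in>A. \<forall>c. \<Phi> (\<lambda>z. msc c (X z) + Y z) = (\<lambda>z. msc c (\<Phi> X z) + \<Phi> Y z))
     \<and> (\<forall>X\<in>A. \<forall>Y\<in>A. \<Phi> (fbr X Y) = fbr (\<Phi> X) (\<Phi> Y))"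

text \<open>Restriction to an open set U (canonical representative: 0 off U).\<close>
definition restr :: "complex set \<Rightarrow> (complex \<Rightarrow> complex^2^2) \<Rightarrow> complex \<Rightarrow> complex^2^2" where
  "restr U X = (\<lambda>z. if z \<in> U then X z else 0)"

end

theory Submission
  imports Defs
begin

text \<open>
  The poles of the functions in question form a lattice \<open>\<Lambda>'\<close> containing \<open>\<Lambda>\<close> with index \<open>N\<close>, and the invariant
  scalar functions are the \<open>\<Lambda>'\<close>-elliptic ones with poles on \<open>\<Lambda>'\<close> only, that is \<open>\<complex>[\<weierp>, \<weierp>']\<close>.
  An automorphism of order \<open>N\<close> is conjugation by some \<open>Q diag(1, x) Q\<^sup>-\<^sup>1\<close>; together with the
  translations it defines a character of \<open>\<Lambda>'\<close>, hence a line bundle \<open>M\<close> on the affine curve obtained from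
  \<open>\<complex>/\<Lambda>'\<close> by removing the origin. Over that curve \<open>O \<oplus> M\<close> is isomorphic to two
  copies of a square root of \<open>M\<close>. Concretely, a quotient of sigma functions gives a section of the
  square root with one simple zero, and a Bezout-type completion yields a matrix of determinant 1 whose rows have
  inverse multipliers. Conjugation by this matrix turns invariants into functions with values in
  \<open>sl\<^sub>2\<close> that are periodic with respect to \<open>\<Lambda>'\<close>.
\<close>

section \<open>Lattices\<close>

text \<open>For N > 1 no diagonal matrix can trivialise the action. A nowhere vanishing section of M
  has zeros and poles on the single orbit of 0 only, hence none at all, so its N-th power is
  constant and the character is trivial, against the injectivity of \<open>\<rho>\<close>. What
  helps is that over an affine curve a rank two bundle is determined by its determinant; comparing
  determinants is what forces a square root of M. The square root is a character of the large
  lattice that takes the values 1 and -1 on the original one. This sign is harmless because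
  conjugation does not see scalars, and so the matrix itself need not be periodic. No residues or
  zeros are counted by contour integrals. Liouville and the impossibility of a single simple pole
  per period cell take their place, and the second fact is used twice: to reduce every elliptic
  function to a polynomial, and to let the sigma quotient have arbitrary multipliers.\<close>

lemma lattice_0 [simp]: "0 \<in> lattice w1 w2"
  unfolding lattice_def by (rule CollectI, rule exI[of _ 0], rule exI[of _ 0]) simp

lemma lattice_gen1 [simp]: "w1 \<in> lattice w1 w2"
  unfolding lattice_def by (rule CollectI, rule exI[of _ 1], rule exI[of _ 0]) simp

lemma lattice_gen2 [simp]: "w2 \<in> lattice w1 w2"
  unfolding lattice_def by (rule CollectI, rule exI[of _ 0], rule exI[of _ 1]) simp

lemma lattice_add:
  assumes "x \<in> lattice w1 w2" "y \<in> lattice w1 w2"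
  shows "x + y \<in> lattice w1 w2"
proof -
  obtain m n m' n' where "x = of_int m * w1 + of_int n * w2" "y = of_int m' * w1 + of_int n' * w2"
    using assms unfolding lattice_def by auto
  then have "x + y = of_int (m + m') * w1 + of_int (n + n') * w2"
    by (simp add: algebra_simps)
  then show ?thesis unfolding lattice_def by blast
qed

lemma lattice_uminus:
  assumes "x \<in> lattice w1 w2"
  shows "- x \<in> lattice w1 w2"
proof -
  obtain m n where "x = of_int m * w1 + of_int n * w2"
    using assms unfolding lattice_def by auto
  then have "- x = of_int (- m) * w1 + of_int (- n) * w2"
    by (simp add: algebra_simps)
  then show ?thesis unfolding lattice_def by blast
qed

lemma lattice_uminus_iff [simp]: "- x \<in> lattice w1 w2 \<longleftrightarrow> x \<in> lattice w1 w2"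
  using lattice_uminus[of x] lattice_uminus[of "- x"] by auto

lemma lattice_diff:
  assumes "x \<in> lattice w1 w2" "y \<in> lattice w1 w2"
  shows "x - y \<in> lattice w1 w2"
  using lattice_add[OF assms(1) lattice_uminus[OF assms(2)]] by simp

lemma lattice_add_right_iff:
  assumes "w \<in> lattice w1 w2"
  shows "z + w \<in> lattice w1 w2 \<longleftrightarrow> z \<in> lattice w1 w2"
  using lattice_add[of z w1 w2 w] lattice_diff[of "z + w" w1 w2 w] assms by auto

lemma lattice_diff_right_iff:
  assumes "w \<in> lattice w1 w2"
  shows "z - w \<in> lattice w1 w2 \<longleftrightarrow> z \<in> lattice w1 w2"
  using lattice_add_right_iff[OF lattice_uminus[OF assms], of z] by simp

lemma lattice_int_mult:
  assumes "x \<in> lattice w1 w2"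
  shows "of_int k * x \<in> lattice w1 w2"
proof -
  obtain m n where "x = of_int m * w1 + of_int n * w2"
    using assms unfolding lattice_def by auto
  then have "of_int k * x = of_int (k * m) * w1 + of_int (k * n) * w2"
    by (simp add: algebra_simps)
  then show ?thesis unfolding lattice_def by blast
qed

text \<open>The exponent is half of the cube in \<open>summable_\<Lambda>\<close>: the double series
  there is dominated by a product of two copies of this one.\<close>

lemma summable_on_int_powr:
  "(\<lambda>m::int. (1 + \<bar>real_of_int m\<bar>) powr (-3/2)) summable_on UNIV"
proof -
  have "summable (\<lambda>n. real n powr (-3/2))"
    by (simp add: summable_real_powr_iff)
  then have "summable (\<lambda>n. real (Suc n) powr (-3/2))"
    by (subst summable_Suc_iff)
  then have nat: "(\<lambda>n::nat. (1 + real n) powr (-3/2)) summable_on UNIV"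
    by (subst summable_on_UNIV_nonneg_real_iff) (auto simp: add.commute)
  have 1: "(\<lambda>m::int. (1 + \<bar>real_of_int m\<bar>) powr (-3/2)) summable_on range int"
    by (subst summable_on_reindex) (use nat in \<open>auto simp: o_def inj_on_def\<close>)
  have 2: "(\<lambda>m::int. (1 + \<bar>real_of_int m\<bar>) powr (-3/2)) summable_on range (\<lambda>n. - int n)"
    by (subst summable_on_reindex) (use nat in \<open>auto simp: o_def inj_on_def\<close>)
  have "(UNIV :: int set) = range int \<union> range (\<lambda>n. - int n)"
    using int_cases2 by blast
  then show ?thesis
    using summable_on_union[OF 1 2] by simp
qed

text \<open>In the end the locale is instantiated at the generators of the large lattice of poles.
  The set \<open>\<Lambda>\<close> defined here is therefore the lattice with a prime of the
  overview, while the period lattice of the torus appears as \<open>L\<close>.\<close>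

locale complex_lattice =
  fixes v1 v2 :: complex
  assumes gens: "lattice_gens v1 v2"
begin

definition \<Lambda> :: "complex set" where "\<Lambda> = lattice v1 v2"

lemma v1_nz [simp]: "v1 \<noteq> 0" and Im_ratio: "Im (v2 / v1) \<noteq> 0"
  using gens by (auto simp: lattice_gens_def)

lemma in_\<Lambda>I [intro]: "of_int m * v1 + of_int n * v2 \<in> \<Lambda>"
  unfolding \<Lambda>_def lattice_def by blast

lemma in_\<Lambda>E: 
  assumes "w \<in> \<Lambda>" obtains m n where "w = of_int m * v1 + of_int n * v2"
  using assms unfolding \<Lambda>_def lattice_def by blast

lemmas \<Lambda>_0 [simp] = lattice_0[of v1 v2, folded \<Lambda>_def]
lemmas \<Lambda>_v1 [simp] = lattice_gen1[of v1 v2, folded \<Lambda>_def]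
lemmas \<Lambda>_v2 [simp] = lattice_gen2[of v2 v1, folded \<Lambda>_def]
lemmas \<Lambda>_add = lattice_add[of _ v1 v2, folded \<Lambda>_def]
lemmas \<Lambda>_uminus_iff [simp] = lattice_uminus_iff[of _ v1 v2, folded \<Lambda>_def]
lemmas \<Lambda>_int_mult = lattice_int_mult[of _ v1 v2, folded \<Lambda>_def]
lemmas \<Lambda>_diff = lattice_diff[of _ v1 v2, folded \<Lambda>_def]
lemmas \<Lambda>_add_iff = lattice_add_right_iff[of _ v1 v2, folded \<Lambda>_def]
lemmas \<Lambda>_diff_iff = lattice_diff_right_iff[of _ v1 v2, folded \<Lambda>_def]

text \<open>After division by \<open>v1\<close> the imaginary part isolates \<open>y\<close>,
  because the ratio of the generators is not real; \<open>x\<close> then follows by the triangle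
  inequality. Discreteness of the lattice and convergence of lattice sums both rest on this.\<close>

lemma coordinates_bound:
  obtains K where "K > 0" "\<And>x y::real. \<bar>x\<bar> + \<bar>y\<bar> \<le> K * norm (of_real x * v1 + of_real y * v2)"
proof -
  define t where "t = v2 / v1"
  define d where "d = \<bar>Im t\<bar>"
  have d: "d > 0" using Im_ratio by (simp add: d_def t_def)
  define K where "K = (1 + (norm t + 1) / d) / norm v1"
  have "K > 0" using d by (auto simp: K_def intro!: divide_pos_pos add_pos_nonneg)
  moreover have "\<bar>x\<bar> + \<bar>y\<bar> \<le> K * norm (of_real x * v1 + of_real y * v2)" for x y :: real
  proof -
    define u where "u = of_real x + of_real y * t"
    have eq: "of_real x * v1 + of_real y * v2 = v1 * u"
      by (simp add: u_def t_def field_simps)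
    have "\<bar>y\<bar> * d = \<bar>Im u\<bar>"
      by (simp add: u_def d_def abs_mult)
    also have "\<dots> \<le> norm u" by (rule abs_Im_le_cmod)
    finally have y: "\<bar>y\<bar> \<le> norm u / d" using d by (simp add: field_simps)
    have "of_real x = u - of_real y * t" by (simp add: u_def)
    then have "\<bar>x\<bar> = norm (u - of_real y * t)"
      by (metis norm_of_real)
    also have "\<dots> \<le> norm u + \<bar>y\<bar> * norm t"
      by (metis norm_mult norm_of_real norm_triangle_ineq4)
    also have "\<dots> \<le> norm u + norm u / d * norm t"
      using y by (intro add_mono mult_right_mono) auto
    finally have "\<bar>x\<bar> + \<bar>y\<bar> \<le> norm u + norm u / d * norm t + norm u / d"
      using y by simp
    also have "\<dots> = K * norm (v1 * u)"
      using d by (simp add: K_def norm_mult field_simps)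
    finally show ?thesis by (simp add: eq)
  qed
  ultimately show ?thesis by (rule that)
qed

lemma coordinates:
  obtains x y :: real where "z = of_real x * v1 + of_real y * v2"
proof -
  define t where "t = v2 / v1"
  define y where "y = Im (z / v1) / Im t"
  define x where "x = Re (z / v1) - y * Re t"
  have "z / v1 = of_real x + of_real y * t"
    using Im_ratio unfolding t_def[symmetric] by (auto simp: complex_eq_iff x_def y_def)
  then have "z = of_real x * v1 + of_real y * v2"
    by (simp add: t_def field_simps)
  then show ?thesis by (rule that)
qed

lemma inj_coordinates: "inj (\<lambda>(m, n). of_int m * v1 + of_int n * v2)"
proof (rule injI, clarify)
  fix m n m' n' :: int
  assume eq: "of_int m * v1 + of_int n * v2 = of_int m' * v1 + of_int n' * v2"
  obtain K where K: "K > 0" "\<And>x y::real. \<bar>x\<bar> + \<bar>y\<bar> \<le> K * norm (of_real x * v1 + of_real y * v2)"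
    by (rule coordinates_bound) auto
  have "of_real (of_int (m - m')) * v1 + of_real (of_int (n - n')) * v2 = (0::complex)"
    using eq by (simp add: algebra_simps)
  with K(2)[of "of_int (m - m')" "of_int (n - n')"] have "\<bar>real_of_int (m - m')\<bar> + \<bar>real_of_int (n - n')\<bar> \<le> 0"
    by simp
  then show "m = m' \<and> n = n'" by linarith
qed

lemma \<Lambda>_image: "\<Lambda> = (\<lambda>(m, n). of_int m * v1 + of_int n * v2) ` (UNIV :: (int \<times> int) set)"
  unfolding \<Lambda>_def lattice_def by auto

lemma countable_\<Lambda>: "countable \<Lambda>"
  unfolding \<Lambda>_image by (intro countable_image) auto

lemma finite_\<Lambda>_cball: "finite {w \<in> \<Lambda>. norm w \<le> R}"
proof -
  obtain K where K: "K > 0" "\<And>x y::real. \<bar>x\<bar> + \<bar>y\<bar> \<le> K * norm (of_real x * v1 + of_real y * v2)"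
    by (rule coordinates_bound) auto
  define b where "b = \<lceil>K * R\<rceil>"
  have "{w \<in> \<Lambda>. norm w \<le> R} \<subseteq> (\<lambda>(m, n). of_int m * v1 + of_int n * v2) ` ({-b..b} \<times> {-b..b})"
  proof safe
    fix w assume w: "w \<in> \<Lambda>" "norm w \<le> R"
    then obtain m n where mn: "w = of_int m * v1 + of_int n * v2" by (auto elim: in_\<Lambda>E)
    have "\<bar>of_int m\<bar> + \<bar>of_int n\<bar> \<le> K * norm w"
      using K(2)[of "of_int m" "of_int n"] by (simp add: mn)
    also have "\<dots> \<le> K * R" using K(1) w by simp
    finally have "\<bar>of_int m\<bar> \<le> K * R" "\<bar>of_int n\<bar> \<le> K * R" by auto
    then have "\<bar>m\<bar> \<le> b" "\<bar>n\<bar> \<le> b" unfolding b_def by linarith+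
    then show "w \<in> (\<lambda>(m, n). of_int m * v1 + of_int n * v2) ` ({-b..b} \<times> {-b..b})"
      unfolding mn by (intro image_eqI[of _ _ "(m, n)"]) auto
  qed
  then show ?thesis by (rule finite_subset) auto
qed

lemma \<Lambda>_not_islimpt: "\<not> z islimpt \<Lambda>"
proof
  assume "z islimpt \<Lambda>"
  then have "infinite (\<Lambda> \<inter> ball z 1)"
    by (metis islimpt_eq_infinite_ball zero_less_one)
  moreover have "\<Lambda> \<inter> ball z 1 \<subseteq> {w \<in> \<Lambda>. norm w \<le> norm z + 1}"
  proof safe
    fix w assume "w \<in> ball z 1"
    then show "norm w \<le> norm z + 1"
      using norm_triangle_sub[of w z] by (simp add: dist_norm norm_minus_commute)
  qed
  ultimately show False using finite_\<Lambda>_cball finite_subset by blast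
qed

lemma closed_\<Lambda>: "closed \<Lambda>"
  using \<Lambda>_not_islimpt by (auto simp: closed_limpt)

lemma open_compl_\<Lambda>: "open (- \<Lambda>)"
  using closed_\<Lambda> by (simp add: open_Compl)

lemma connected_compl_\<Lambda>: "connected (- \<Lambda>)"
  using connected_open_diff_countable[of "UNIV :: complex set" \<Lambda>] countable_\<Lambda>
  by (simp add: Compl_eq_Diff_UNIV connected_UNIV)

lemma eventually_not_in_\<Lambda>: "eventually (\<lambda>w. w \<notin> \<Lambda>) (at z)"
  using \<Lambda>_not_islimpt by (simp add: islimpt_iff_eventually)

lemma \<Lambda>_ball_0:
  obtains e where "e > 0" "ball 0 e \<inter> \<Lambda> = {0}"
proof -
  obtain e where "e > 0" "\<forall>w. w \<noteq> 0 \<and> dist w 0 < e \<longrightarrow> w \<notin> \<Lambda>"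
    using eventually_not_in_\<Lambda>[of 0] unfolding eventually_at by auto
  then show ?thesis by (intro that[of e]) (auto simp: dist_commute)
qed

lemma summable_\<Lambda>: "(\<lambda>w. 1 / norm w ^ 3) summable_on \<Lambda>"
proof -
  obtain K where K: "K > 0" "\<And>x y::real. \<bar>x\<bar> + \<bar>y\<bar> \<le> K * norm (of_real x * v1 + of_real y * v2)"
    by (rule coordinates_bound) auto
  define g where "g = (\<lambda>m::int. (1 + \<bar>real_of_int m\<bar>) powr (-3/2))"
  have g: "g summable_on UNIV" unfolding g_def by (rule summable_on_int_powr)
  have gnn: "g m \<ge> 0" for m by (simp add: g_def)
  have "(\<lambda>(m, n). g m * g n) summable_on UNIV \<times> UNIV"
  proof (rule summable_on_SigmaI)
    show "((\<lambda>n. case (m, n) of (m, n) \<Rightarrow> g m * g n) has_sum (g m * infsum g UNIV)) UNIV" for m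
      using has_sum_cmult_right[OF has_sum_infsum[OF g]] by simp
    show "(\<lambda>m. g m * infsum g UNIV) summable_on UNIV"
      by (intro summable_on_cmult_left g)
  qed (use gnn in auto)
  then have "(\<lambda>p. 8 * K ^ 3 * (case p of (m, n) \<Rightarrow> g m * g n)) summable_on UNIV \<times> UNIV"
    by (intro summable_on_cmult_right)
  then have "(\<lambda>p. 1 / norm (case p of (m, n) \<Rightarrow> of_int m * v1 + of_int n * v2) ^ 3) summable_on UNIV \<times> UNIV"
  proof (rule summable_on_comparison_test; clarify)
    fix m n :: int
    define w where "w = of_int m * v1 + of_int n * v2"
    define s where "s = \<bar>real_of_int m\<bar> + \<bar>real_of_int n\<bar>"
    show "1 / norm w ^ 3 \<le> 8 * K ^ 3 * (g m * g n)"
    proof (cases "m = 0 \<and> n = 0")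
      case True
      \<comment> \<open>Division by zero yields 0, so the origin may stay in the index set.\<close>
      then show ?thesis using gnn K by (simp add: w_def)
    next
      case False
      then have s1: "s \<ge> 1" unfolding s_def by linarith
      have sw: "s \<le> K * norm w" using K(2)[of "of_int m" "of_int n"] by (simp add: s_def w_def)
      then have wpos: "norm w > 0" using s1 K(1) by (smt (verit) mult_nonneg_nonpos)
      \<comment> \<open>Both factors are at most 2s because s is at least 1. Hence q is at most
        (2s)^2, and the power 3/2 turns this into the cube that is needed.\<close>
      define q where "q = (1 + \<bar>real_of_int m\<bar>) * (1 + \<bar>real_of_int n\<bar>)"
      have q: "q > 0" by (auto simp: q_def intro!: mult_pos_pos)
      have "q \<le> (2 * s) * (2 * s)"
        unfolding q_def using s1 by (intro mult_mono) (auto simp: s_def)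
      then have q2: "q \<le> (2 * s) ^ 2" by (simp add: power2_eq_square)
      have gq: "g m * g n = q powr (-3/2)"
        by (simp add: g_def q_def powr_mult)
      have "q powr (3/2) \<le> ((2 * s) ^ 2) powr (3/2)"
        using q q2 by (intro powr_mono2) auto
      also have "((2 * s) ^ 2) = (2 * s) powr 2"
        using s1 by (subst powr_numeral) auto
      also have "((2 * s) powr 2) powr (3/2) = (2 * s) powr 3"
        by (subst powr_powr) simp
      also have "(2 * s) powr 3 = (2 * s) ^ 3"
        using s1 by (subst powr_numeral) auto
      also have "\<dots> \<le> (2 * (K * norm w)) ^ 3"
        using sw s1 by (intro power_mono) auto
      finally have "q powr (3/2) \<le> 8 * K ^ 3 * norm w ^ 3"
        by (simp add: power_mult_distrib)
      then have "1 / norm w ^ 3 \<le> 8 * K ^ 3 / q powr (3/2)"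
        using wpos q by (simp add: field_simps)
      then show ?thesis unfolding gq by (simp add: powr_minus_divide)
    qed
  qed auto
  then show ?thesis
    unfolding \<Lambda>_image by (subst summable_on_reindex[OF inj_coordinates]) (simp add: o_def)
qed

end

section \<open>The Weierstrass function\<close>

text \<open>The difference equals z (2w - z) / (w^2 (z - w)^2). For |w| at least 2R one has |2w - z|
  at most 5/2 |w| and |z - w| at least |w|/2, and 5/2 times 4 gives the constant 10.\<close>

lemma wp_term_bound:
  fixes z w :: complex
  assumes "R > 0" "norm z \<le> R" "2 * R \<le> norm w"
  shows "norm (1 / (z - w)^2 - 1 / w^2) \<le> 10 * R / norm w ^ 3"
proof -
  have w: "norm w > 0" using assms by linarith
  have "norm w \<le> norm z + norm (z - w)"
    by (metis add.commute diff_add_cancel norm_minus_commute norm_triangle_ineq)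
  then have zw: "norm (z - w) \<ge> norm w / 2" using assms by linarith
  then have zw0: "norm (z - w) > 0" using w by linarith
  have "w \<noteq> 0" "z - w \<noteq> 0" using w zw0 by auto
  then have "1 / (z - w)^2 - 1 / w^2 = z * (2 * w - z) / (w^2 * (z - w)^2)"
    by (simp add: diff_frac_eq) (simp add: power2_eq_square algebra_simps)
  then have "norm (1 / (z - w)^2 - 1 / w^2) = norm z * norm (2 * w - z) / (norm w ^ 2 * norm (z - w) ^ 2)"
    by (simp add: norm_mult norm_divide norm_power)
  also have "\<dots> \<le> R * (5 / 2 * norm w) / (norm w ^ 2 * (norm w / 2) ^ 2)"
  proof (intro frac_le mult_mono power_mono)
    have "norm (2 * w - z) \<le> 2 * norm w + norm z"
      by (metis norm_mult norm_numeral norm_triangle_ineq4)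
    then show "norm (2 * w - z) \<le> 5 / 2 * norm w" using assms by linarith
  qed (use assms w zw in auto)
  also have "\<dots> = 10 * R / norm w ^ 3"
    using w by (simp add: field_simps power2_eq_square power3_eq_cube)
  finally show ?thesis .
qed

context complex_lattice
begin

lemma summable_\<Lambda>_subset:
  assumes "A \<subseteq> \<Lambda>"
  shows "(\<lambda>w. c / norm w ^ 3) summable_on A"
  using summable_on_cmult_right[OF summable_on_subset_banach[OF summable_\<Lambda> assms], of c] by simp

lemma wp_summable_far:
  assumes "R > 0" "norm z \<le> R"
  shows "(\<lambda>w. 1 / (z - w)^2 - 1 / w^2) summable_on {w \<in> \<Lambda>. norm w > 2 * R}"
proof (rule abs_summable_summable)
  show "(\<lambda>w. norm (1 / (z - w)^2 - 1 / w^2)) summable_on {w \<in> \<Lambda>. norm w > 2 * R}"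
    by (rule Infinite_Sum.abs_summable_on_comparison_test'[OF summable_\<Lambda>_subset[of _ "10 * R"]])
       (use assms in \<open>auto intro!: wp_term_bound\<close>)
qed

lemma \<Lambda>_split: "\<Lambda> = {w \<in> \<Lambda>. norm w \<le> R} \<union> {w \<in> \<Lambda>. norm w > R}"
  by auto

lemma wp_summable: "(\<lambda>w. 1 / (z - w)^2 - 1 / w^2) summable_on \<Lambda>"
  using wp_summable_far[of "norm z + 1" z] finite_\<Lambda>_cball[of "2 * (norm z + 1)"]
  by (subst \<Lambda>_split[of "2 * (norm z + 1)"], intro summable_on_Un_disjoint) 
     (auto simp: add_nonneg_pos)

text \<open>Since 1/0 = 0, the term at the origin is exactly the 1/z^2 that \<open>wp\<close> splits
  off. Summing over the whole lattice makes it possible to reindex by translations and by the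
  sign.\<close>

lemma wp_eq_infsum: "wp \<Lambda> z = (\<Sum>\<^sub>\<infinity>w\<in>\<Lambda>. 1 / (z - w)^2 - 1 / w^2)"
proof -
  have "(\<Sum>\<^sub>\<infinity>w\<in>{0} \<union> (\<Lambda> - {0}). 1 / (z - w)^2 - 1 / w^2) = wp \<Lambda> z"
    unfolding wp_def
    by (subst infsum_Un_disjoint) (auto intro: summable_on_subset_banach[OF wp_summable])
  also have "{0} \<union> (\<Lambda> - {0}) = \<Lambda>" by auto
  finally show ?thesis by simp
qed

text \<open>All poles inside the disc come from the finitely many terms with |w| at most 2R. The
  other terms converge uniformly by the M-test with the cubic bound.\<close>

lemma wp_near:
  assumes "R > 0"
  obtains h where "h holomorphic_on ball 0 R"
    "\<And>z. z \<in> ball 0 R \<Longrightarrow> wp \<Lambda> z = (\<Sum>w | w \<in> \<Lambda> \<and> norm w \<le> 2 * R. 1 / (z - w)^2 - 1 / w^2) + h z"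
proof -
  define B where "B = {w \<in> \<Lambda>. norm w > 2 * R}"
  define h where "h = (\<lambda>z. \<Sum>\<^sub>\<infinity>w\<in>B. 1 / (z - w)^2 - 1 / w^2)"
  have ul: "uniform_limit (cball 0 R) (\<lambda>X z. \<Sum>w\<in>X. 1 / (z - w)^2 - 1 / w^2) h (finite_subsets_at_top B)"
    unfolding h_def
  proof (rule Weierstrass_m_test_general)
    show "(\<lambda>w. 10 * R / norm w ^ 3) summable_on B"
      unfolding B_def by (rule summable_\<Lambda>_subset) auto
  qed (use assms in \<open>auto simp: B_def intro!: wp_term_bound\<close>)
  have ev: "eventually (\<lambda>X. continuous_on (cball 0 R) (\<lambda>z. \<Sum>w\<in>X. 1 / (z - w)^2 - 1 / w^2)
      \<and> (\<lambda>z. \<Sum>w\<in>X. 1 / (z - w)^2 - 1 / w^2) holomorphic_on ball 0 R) (finite_subsets_at_top B)"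
  proof (rule eventually_finite_subsets_at_top_weakI)
    fix X assume X: "finite X" "X \<subseteq> B"
    have "(\<lambda>z. \<Sum>w\<in>X. 1 / (z - w)^2 - 1 / w^2) holomorphic_on (cball 0 R)"
      using X assms by (intro holomorphic_intros) (auto simp: B_def)
    then show "continuous_on (cball 0 R) (\<lambda>z. \<Sum>w\<in>X. 1 / (z - w)^2 - 1 / w^2)
      \<and> (\<lambda>z. \<Sum>w\<in>X. 1 / (z - w)^2 - 1 / w^2) holomorphic_on ball 0 R"
      using holomorphic_on_subset ball_subset_cball holomorphic_on_imp_continuous_on by blast
  qed
  have "h holomorphic_on ball 0 R"
    by (rule holomorphic_uniform_limit[OF ev ul finite_subsets_at_top_neq_bot])
  moreover have "wp \<Lambda> z = (\<Sum>w | w \<in> \<Lambda> \<and> norm w \<le> 2 * R. 1 / (z - w)^2 - 1 / w^2) + h z"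
    if "z \<in> ball 0 R" for z
    unfolding wp_eq_infsum h_def B_def using assms that finite_\<Lambda>_cball[of "2 * R"]
    by (subst \<Lambda>_split[of "2 * R"], subst infsum_Un_disjoint)
       (auto intro!: wp_summable_far)
  ultimately show ?thesis by (rule that)
qed

lemma wp_holomorphic: "wp \<Lambda> holomorphic_on - \<Lambda>"
proof -
  have "wp \<Lambda> holomorphic_on (ball 0 R - \<Lambda>)" if "R > 0" for R :: real
  proof -
    obtain h where h: "h holomorphic_on ball 0 R"
      "\<And>z. z \<in> ball 0 R \<Longrightarrow> wp \<Lambda> z = (\<Sum>w | w \<in> \<Lambda> \<and> norm w \<le> 2 * R. 1 / (z - w)^2 - 1 / w^2) + h z"
      using wp_near[OF \<open>R > 0\<close>] by blast
    have "(\<lambda>z. (\<Sum>w | w \<in> \<Lambda> \<and> norm w \<le> 2 * R. 1 / (z - w)^2 - 1 / w^2) + h z) holomorphic_on (ball 0 R - \<Lambda>)"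
      by (intro holomorphic_intros holomorphic_on_subset[OF h(1)]) auto
    then show ?thesis
      by (rule holomorphic_transform) (use h(2) in auto)
  qed
  then have "wp \<Lambda> holomorphic_on (\<Union>R\<in>{0<..}. ball 0 R - \<Lambda>)"
    using closed_\<Lambda> by (intro holomorphic_on_UN_open) auto
  also have "(\<Union>R\<in>{0<..}. ball 0 R - \<Lambda>) = - \<Lambda>"
  proof safe
    fix z assume "z \<notin> \<Lambda>"
    then show "z \<in> (\<Union>R\<in>{0<..}. ball 0 R - \<Lambda>)"
      by (intro UN_I[of "norm z + 1"]) (auto simp: add_nonneg_pos)
  qed
  finally show ?thesis .
qed

lemma wp_meromorphic: "wp \<Lambda> meromorphic_on UNIV"
  unfolding meromorphic_on_meromorphic_at[of _ UNIV]
proof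
  fix z0 :: complex
  define R where "R = norm z0 + 1"
  have R: "R > 0" by (simp add: R_def add_nonneg_pos)
  obtain h where h: "h holomorphic_on ball 0 R"
    "\<And>z. z \<in> ball 0 R \<Longrightarrow> wp \<Lambda> z = (\<Sum>w | w \<in> \<Lambda> \<and> norm w \<le> 2 * R. 1 / (z - w)^2 - 1 / w^2) + h z"
    using wp_near[OF R] by blast
  have z0: "z0 \<in> ball 0 R" by (simp add: R_def)
  have "h analytic_on {z0}"
    using h(1) z0 analytic_at open_ball by blast
  then have "(\<lambda>z. (\<Sum>w | w \<in> \<Lambda> \<and> norm w \<le> 2 * R. 1 / (z - w)^2 - 1 / w^2) + h z) meromorphic_on {z0}"
    by (intro meromorphic_intros analytic_on_imp_meromorphic_on[of h])
  moreover have "eventually (\<lambda>z. z \<in> ball 0 R) (at z0)"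
    using z0 by (intro eventually_at_in_open') auto
  then have "eventually (\<lambda>z. wp \<Lambda> z = (\<Sum>w | w \<in> \<Lambda> \<and> norm w \<le> 2 * R. 1 / (z - w)^2 - 1 / w^2) + h z) (at z0)"
    by eventually_elim (use h(2) in auto)
  ultimately show "wp \<Lambda> meromorphic_on {z0}"
    by (subst meromorphic_on_cong) auto
qed

lemma wp_near_0:
  obtains h e where "e > 0" "h holomorphic_on ball 0 e" "ball 0 e \<inter> \<Lambda> = {0}"
    "\<And>z. z \<in> ball 0 e \<Longrightarrow> wp \<Lambda> z = 1 / z^2 + h z"
proof -
  obtain e where e: "e > 0" "ball 0 e \<inter> \<Lambda> = {0}"
    using \<Lambda>_ball_0 by blast
  obtain h where h: "h holomorphic_on ball 0 e"
    "\<And>z. z \<in> ball 0 e \<Longrightarrow> wp \<Lambda> z = (\<Sum>w | w \<in> \<Lambda> \<and> norm w \<le> 2 * e. 1 / (z - w)^2 - 1 / w^2) + h z"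
    using wp_near[OF e(1)] by blast
  define A where "A = {w \<in> \<Lambda>. norm w \<le> 2 * e}"
  have A: "finite A" "0 \<in> A" unfolding A_def using finite_\<Lambda>_cball e by auto
  have zw: "z - w \<noteq> 0" if "z \<in> ball 0 e" "w \<in> A - {0}" for z w
  proof
    assume "z - w = 0"
    then have "z \<in> ball 0 e \<inter> \<Lambda>" "z \<noteq> 0" using that by (simp_all add: A_def)
    then show False unfolding e(2) by simp
  qed
  have "(\<lambda>z. (\<Sum>w\<in>A - {0}. 1 / (z - w)^2 - 1 / w^2) + h z) holomorphic_on ball 0 e"
    by (intro holomorphic_intros h(1)) (use zw in auto)
  moreover have "wp \<Lambda> z = 1 / z^2 + ((\<Sum>w\<in>A - {0}. 1 / (z - w)^2 - 1 / w^2) + h z)"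
    if "z \<in> ball 0 e" for z
    unfolding h(2)[OF that] A_def[symmetric] by (subst sum.remove[OF A]) simp
  ultimately show ?thesis by (rule that[OF e(1) _ e(2)])
qed

lemma wp_minus: "wp \<Lambda> (- z) = wp \<Lambda> z"
proof -
  have im: "uminus ` \<Lambda> = \<Lambda>"
    by (metis \<Lambda>_uminus_iff equation_minus_iff image_eqI subsetI subset_antisym image_subsetI)
  have "wp \<Lambda> (- z) = (\<Sum>\<^sub>\<infinity>w\<in>uminus ` \<Lambda>. 1 / (- z - w)^2 - 1 / w^2)"
    unfolding wp_eq_infsum im ..
  also have "\<dots> = (\<Sum>\<^sub>\<infinity>w\<in>\<Lambda>. 1 / (z - w)^2 - 1 / w^2)"
    by (subst infsum_reindex) (auto simp: o_def power2_commute)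
  finally show ?thesis by (simp add: wp_eq_infsum)
qed

text \<open>The difference \<open>wp \<Lambda> (z + l) - wp \<Lambda> z\<close> is independent of \<open>z\<close> by reindexing;
  evenness at \<open>z = - l / 2\<close> makes it vanish. Since \<open>1 / 0 = 0\<close> all the series involved
  also converge at lattice points.\<close>

lemma wp_periodic:
  assumes l: "l \<in> \<Lambda>"
  shows "wp \<Lambda> (z + l) = wp \<Lambda> z"
proof -
  define C where "C = (\<Sum>\<^sub>\<infinity>w\<in>\<Lambda>. 1 / w^2 - 1 / (w + l)^2)"
  have im: "\<Lambda> = (\<lambda>w. w + l) ` \<Lambda>"
  proof safe
    fix w assume "w \<in> \<Lambda>"
    then show "w \<in> (\<lambda>w. w + l) ` \<Lambda>"
      using \<Lambda>_diff[of w l] l by (intro image_eqI[of _ _ "w - l"]) auto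
  qed (use l \<Lambda>_add in auto)
  have re1: "((\<lambda>w. 1 / (z + l - w)^2 - 1 / w^2) \<circ> (\<lambda>w. w + l)) = (\<lambda>w. 1 / (z - w)^2 - 1 / (w + l)^2)" for z
    by (simp add: o_def)
  have s1: "(\<lambda>w. 1 / (z - w)^2 - 1 / (w + l)^2) summable_on \<Lambda>" for z
    using wp_summable[of "z + l"] by (subst (asm) im, subst (asm) summable_on_reindex) (auto simp: re1)
  have wp1: "wp \<Lambda> (z + l) = (\<Sum>\<^sub>\<infinity>w\<in>\<Lambda>. 1 / (z - w)^2 - 1 / (w + l)^2)" for z
    unfolding wp_eq_infsum by (subst im, subst infsum_reindex) (auto simp: re1)
  have s2: "(\<lambda>w. 1 / w^2 - 1 / (w + l)^2) summable_on \<Lambda>"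
    using s1[of 0] by simp
  have diff: "wp \<Lambda> (z + l) - wp \<Lambda> z = C" for z
    unfolding wp1 unfolding wp_eq_infsum C_def
    using infsum_add[OF wp_summable s2, of z] by simp
  have "C = 0"
    using diff[of "- l / 2"] wp_minus[of "l / 2"] by simp
  with diff[of z] show ?thesis by simp
qed

end

section \<open>Elliptic functions with poles on the lattice\<close>

lemma analytic_divide_by_z:
  assumes "F analytic_on {0}" "F 0 = (0::complex)"
  obtains F1 where "F1 analytic_on {0}" "\<And>z. F z = z * F1 z" "F1 0 = deriv F 0"
proof -
  obtain S where S: "open S" "0 \<in> S" "F holomorphic_on S"
    using assms(1) analytic_at by blast
  define F1 where "F1 = (\<lambda>z. if z = 0 then deriv F 0 else (F z - F 0) / (z - 0))"
  have "F1 holomorphic_on S"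
    unfolding F1_def by (rule pole_lemma) (use S in \<open>auto simp: interior_open\<close>)
  then have "F1 analytic_on {0}" using S analytic_at by blast
  then show ?thesis by (rule that) (use assms(2) in \<open>auto simp: F1_def\<close>)
qed

text \<open>Integrating factor: if Q is a primitive of \<open>q\<close>, then \<open>u\<close> times
  exp(-Q) has derivative zero. This uniqueness is what makes an elliptic function omit a value in
  \<open>elliptic_no_simple_pole\<close>.\<close>

lemma linear_ode_zero:
  assumes S: "open S" "convex S" and u: "u holomorphic_on S" and q: "q holomorphic_on S"
    and ode: "\<And>z. z \<in> S \<Longrightarrow> deriv u z = q z * u z"
    and z0: "z0 \<in> S" "u z0 = 0" and z: "z \<in> S"
  shows "u z = (0::complex)"
proof -
  obtain Q where Q: "\<And>x. x \<in> S \<Longrightarrow> (Q has_field_derivative q x) (at x within S)"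
    using holomorphic_convex_primitive'[OF S(2,1) q] by blast
  have d0: "((\<lambda>x. u x * exp (- Q x)) has_field_derivative 0) (at x within S)" if x: "x \<in> S" for x
  proof -
    have "(u has_field_derivative (q x * u x)) (at x within S)"
      using holomorphic_derivI[OF u S(1) x, of S] ode[OF x] by simp
    then show ?thesis
      by (auto intro!: derivative_eq_intros Q x)
  qed
  obtain c where c: "\<And>x. x \<in> S \<Longrightarrow> u x * exp (- Q x) = c"
    using has_field_derivative_zero_constant[OF S(2) d0] by auto
  then have "c = 0" using z0 by force
  then show ?thesis using c[OF z] by simp
qed

lemma deriv_eqI_ev:
  assumes "(g has_field_derivative D) (at z)" "eventually (\<lambda>w. f w = g w) (nhds z)"
  shows "deriv f z = D"
  using deriv_cong_ev[OF assms(2) refl] DERIV_imp_deriv[OF assms(1)] by simp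

lemma deriv_periodic:
  assumes "open S" "z \<in> S" "\<And>z. z \<in> S \<Longrightarrow> f (z + l) = (f z :: complex)"
  shows "deriv f (z + l) = deriv f z"
proof -
  have "deriv f (z + l) = deriv (\<lambda>x. f (x + l)) z"
    unfolding deriv_def by (simp only: DERIV_shift)
  also have "\<dots> = deriv f z"
    by (rule deriv_cong_ev) (use assms in \<open>auto simp: eventually_nhds\<close>)
  finally show ?thesis .
qed

text \<open>Membership requires one degree bound for both exponents; i + j serves for both, with a
  coefficient array supported at one place.\<close>

lemma wp_poly_alg_monom: "(\<lambda>z. a * wp L z ^ i * wp' L z ^ j) \<in> wp_poly_alg L"
proof -
  have inner: "(\<Sum>j'\<le>i+j. (if i' = i then if j' = j then a else 0 else 0) * wp L z ^ i' * wp' L z ^ j')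
     = (if i' = i then a * wp L z ^ i' * wp' L z ^ j else 0)" for z i'
  proof -
    have "(\<Sum>j'\<le>i+j. (if i' = i then if j' = j then a else 0 else 0) * wp L z ^ i' * wp' L z ^ j')
        = (\<Sum>j'\<le>i+j. if j' = j then if i' = i then a * wp L z ^ i' * wp' L z ^ j' else 0 else 0)"
      by (intro sum.cong) auto
    then show ?thesis by simp
  qed
  have "(\<lambda>z. a * wp L z ^ i * wp' L z ^ j) = (\<lambda>z. \<Sum>i'\<le>i+j. \<Sum>j'\<le>i+j.
      (if i' = i then if j' = j then a else 0 else 0) * wp L z ^ i' * wp' L z ^ j')"
    unfolding inner by simp
  then show ?thesis unfolding wp_poly_alg_def
    by (intro CollectI exI[of _ "i + j"] exI[of _ "\<lambda>i' j'. if i' = i then if j' = j then a else 0 else 0"])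
qed

lemma wp_poly_alg_const: "(\<lambda>z. a) \<in> wp_poly_alg L"
  using wp_poly_alg_monom[of a L 0 0] by simp

lemma wp_poly_alg_add:
  assumes "p \<in> wp_poly_alg L" "q \<in> wp_poly_alg L"
  shows "(\<lambda>z. p z + q z) \<in> wp_poly_alg L"
proof -
  obtain n c where p: "p = (\<lambda>z. \<Sum>i\<le>n. \<Sum>j\<le>n. c i j * wp L z ^ i * wp' L z ^ j)"
    using assms(1) unfolding wp_poly_alg_def by auto
  obtain m d where q: "q = (\<lambda>z. \<Sum>i\<le>m. \<Sum>j\<le>m. d i j * wp L z ^ i * wp' L z ^ j)"
    using assms(2) unfolding wp_poly_alg_def by auto
  \<comment> \<open>Padding with zero coefficients brings both polynomials to the common bound n +
    m.\<close>
  have pad: "(\<Sum>i\<le>n. \<Sum>j\<le>n. c i j * wp L z ^ i * wp' L z ^ j) =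
      (\<Sum>i\<le>n+m. \<Sum>j\<le>n+m. (if i \<le> n \<and> j \<le> n then c i j else 0) * wp L z ^ i * wp' L z ^ j)"
    for n m z and c :: "nat \<Rightarrow> nat \<Rightarrow> complex"
  proof -
    have "(\<Sum>j\<le>n. c i j * wp L z ^ i * wp' L z ^ j) =
      (\<Sum>j\<le>n+m. (if i \<le> n \<and> j \<le> n then c i j else 0) * wp L z ^ i * wp' L z ^ j)" if "i \<le> n" for i
      using that by (intro sum.mono_neutral_cong_left) auto
    then show ?thesis
      by (intro sum.mono_neutral_cong_left) auto
  qed
  have "(\<lambda>z. p z + q z) = (\<lambda>z. \<Sum>i\<le>n+m. \<Sum>j\<le>n+m. ((if i \<le> n \<and> j \<le> n then c i j else 0)
     + (if i \<le> m \<and> j \<le> m then d i j else 0)) * wp L z ^ i * wp' L z ^ j)"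
    unfolding p q pad[where n = n and m = m] pad[where n = m and m = n] add.commute[of m n]
    by (simp add: distrib_right sum.distrib)
  then show ?thesis unfolding wp_poly_alg_def
    by (intro CollectI exI[of _ "n + m"] exI[of _ "\<lambda>i j. (if i \<le> n \<and> j \<le> n then c i j else 0)
     + (if i \<le> m \<and> j \<le> m then d i j else 0)"])
qed

context complex_lattice
begin

text \<open>Periodicity is demanded only off the lattice, where values are meaningful, and the
  singularities are left open. They are controlled by \<open>pole_form\<close> at 0, which suffices
  by periodicity.\<close>

definition elliptic :: "(complex \<Rightarrow> complex) \<Rightarrow> bool" where
  "elliptic f \<longleftrightarrow> f holomorphic_on - \<Lambda> \<and> (\<forall>z l. z \<notin> \<Lambda> \<longrightarrow> l \<in> \<Lambda> \<longrightarrow> f (z + l) = f z)"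

text \<open>The number \<open>n\<close> only bounds the pole order, since \<open>F 0\<close> may
  vanish. \<open>F 0\<close> is the leading coefficient that the inductions on the pole order
  cancel.\<close>

definition pole_form :: "nat \<Rightarrow> (complex \<Rightarrow> complex) \<Rightarrow> (complex \<Rightarrow> complex) \<Rightarrow> bool" where
  "pole_form n F f \<longleftrightarrow> F analytic_on {0} \<and> eventually (\<lambda>z. f z = F z / z ^ n) (at 0)"

lemma elliptic_add: "elliptic f \<Longrightarrow> elliptic g \<Longrightarrow> elliptic (\<lambda>z. f z + g z)"
  and elliptic_mult: "elliptic f \<Longrightarrow> elliptic g \<Longrightarrow> elliptic (\<lambda>z. f z * g z)"
  and elliptic_const: "elliptic (\<lambda>z. c)"
  unfolding elliptic_def by (auto intro!: holomorphic_intros)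

lemma elliptic_power: "elliptic f \<Longrightarrow> elliptic (\<lambda>z. f z ^ n)"
  unfolding elliptic_def by (auto intro!: holomorphic_intros)

lemma elliptic_sum: "(\<And>i. i \<in> I \<Longrightarrow> elliptic (f i)) \<Longrightarrow> elliptic (\<lambda>z. \<Sum>i\<in>I. f i z)"
  unfolding elliptic_def by (auto intro!: holomorphic_intros)

lemma elliptic_deriv:
  assumes "elliptic f" shows "elliptic (deriv f)"
  unfolding elliptic_def
proof (intro conjI allI impI)
  show "deriv f holomorphic_on - \<Lambda>"
    using assms open_compl_\<Lambda> unfolding elliptic_def by (intro holomorphic_deriv) auto
  show "deriv f (z + l) = deriv f z" if "z \<notin> \<Lambda>" "l \<in> \<Lambda>" for z l
    by (rule deriv_periodic[OF open_compl_\<Lambda>]) (use that assms in \<open>auto simp: elliptic_def\<close>)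
qed

lemma elliptic_wp: "elliptic (wp \<Lambda>)"
  unfolding elliptic_def using wp_holomorphic wp_periodic by auto

lemma elliptic_wp': "elliptic (wp' \<Lambda>)"
  using elliptic_deriv[OF elliptic_wp] unfolding wp'_def[abs_def] .

lemma elliptic_wp_poly_alg:
  assumes "p \<in> wp_poly_alg \<Lambda>" shows "elliptic p"
proof -
  obtain n c where p: "p = (\<lambda>z. \<Sum>i\<le>(n::nat). \<Sum>j\<le>n. c i j * wp \<Lambda> z ^ i * wp' \<Lambda> z ^ j)"
    using assms unfolding wp_poly_alg_def by auto
  show ?thesis
    unfolding p by (intro elliptic_sum elliptic_mult elliptic_const elliptic_power elliptic_wp elliptic_wp')
qed

lemma pole_form_add: "pole_form n F f \<Longrightarrow> pole_form n G g \<Longrightarrow> pole_form n (\<lambda>z. F z + G z) (\<lambda>z. f z + g z)"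
  unfolding pole_form_def by (auto intro!: analytic_intros elim: eventually_elim2 simp: add_divide_distrib)

lemma pole_form_mult: "pole_form n F f \<Longrightarrow> pole_form m G g \<Longrightarrow> pole_form (n + m) (\<lambda>z. F z * G z) (\<lambda>z. f z * g z)"
  unfolding pole_form_def by (auto intro!: analytic_intros elim: eventually_elim2 simp: power_add)

lemma pole_form_const: "pole_form 0 (\<lambda>z. c) (\<lambda>z. c)"
  unfolding pole_form_def by (auto intro!: analytic_intros)

lemma pole_form_power: "pole_form n F f \<Longrightarrow> pole_form (n * k) (\<lambda>z. F z ^ k) (\<lambda>z. f z ^ k)"
  unfolding pole_form_def
  by (auto intro!: analytic_intros elim!: eventually_mono simp: power_mult power_divide)

text \<open>Recording the value of \<open>F1\<close> at 0 allows a second reduction, which is how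
  the double pole is removed in \<open>elliptic_no_simple_pole\<close>.\<close>

lemma pole_form_reduce:
  assumes "pole_form (Suc n) F f" "F 0 = 0"
  obtains F1 where "pole_form n F1 f" "F1 0 = deriv F 0" "\<And>z. F z = z * F1 z"
proof -
  obtain F1 where F1: "F1 analytic_on {0}" "\<And>z. F z = z * F1 z" "F1 0 = deriv F 0"
    using analytic_divide_by_z[of F] assms unfolding pole_form_def by blast
  have "eventually (\<lambda>z. f z = F z / z ^ Suc n) (at 0)" "eventually (\<lambda>z::complex. z \<noteq> 0) (at 0)"
    using assms unfolding pole_form_def by (auto simp: eventually_at_filter)
  then have "eventually (\<lambda>z. f z = F1 z / z ^ n) (at 0)"
    by eventually_elim (simp add: F1(2))
  then show ?thesis using F1 that unfolding pole_form_def by blast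
qed

lemma pole_form_ball:
  assumes "pole_form n F f"
  obtains e where "e > 0" "F holomorphic_on ball 0 e" "ball 0 e \<inter> \<Lambda> = {0}"
    "\<And>z. z \<in> ball 0 e \<Longrightarrow> z \<noteq> 0 \<Longrightarrow> f z = F z / z ^ n"
proof -
  obtain e1 where e1: "e1 > 0" "F holomorphic_on ball 0 e1"
    using assms unfolding pole_form_def analytic_on_def by auto
  obtain e2 where e2: "e2 > 0" "\<And>z. z \<noteq> 0 \<Longrightarrow> dist z 0 < e2 \<Longrightarrow> f z = F z / z ^ n"
    using assms unfolding pole_form_def eventually_at by auto
  obtain e3 where e3: "e3 > 0" "ball 0 e3 \<inter> \<Lambda> = {0}"
    using \<Lambda>_ball_0 by blast
  define e where "e = min e1 (min e2 e3)"
  have sub: "ball (0::complex) e \<subseteq> ball 0 e1" "ball (0::complex) e \<subseteq> ball 0 e3" by (auto simp: e_def)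
  show ?thesis
  proof
    show "e > 0" using e1 e2 e3 by (simp add: e_def)
    show "F holomorphic_on ball 0 e" using e1 sub holomorphic_on_subset by blast
    show "ball 0 e \<inter> \<Lambda> = {0}" using e3 sub \<open>e > 0\<close> by auto
    show "f z = F z / z ^ n" if "z \<in> ball 0 e" "z \<noteq> 0" for z
      using e2(2) that by (simp add: e_def)
  qed
qed

lemma compl_\<Lambda>_nonempty: obtains z where "z \<notin> \<Lambda>"
  using eventually_not_in_\<Lambda>[of 0] eventually_happens'[OF at_neq_bot] by blast

text \<open>Filling every lattice point with \<open>F 0\<close> yields an entire function, and all
  its values are already taken on a disc containing a period parallelogram.\<close>

lemma elliptic_Liouville:
  assumes f: "elliptic f" "pole_form 0 F f"
  obtains c where "\<And>z. z \<notin> \<Lambda> \<Longrightarrow> f z = c"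
proof -
  obtain e where e: "e > 0" "F holomorphic_on ball 0 e" "ball 0 e \<inter> \<Lambda> = {0}"
    and eF: "\<And>z. z \<in> ball 0 e \<Longrightarrow> z \<noteq> 0 \<Longrightarrow> f z = F z"
    using pole_form_ball[OF f(2)] by (metis power_0 div_by_1)
  define g where "g = (\<lambda>z. if z \<in> \<Lambda> then F 0 else f z)"
  have per: "g (z + l) = g z" if "l \<in> \<Lambda>" for z l
    using that f(1) by (auto simp: g_def elliptic_def \<Lambda>_add_iff)
  have gF: "g z = F z" if "z \<in> ball 0 e" for z
  proof (cases "z = 0")
    case False
    then have "z \<notin> \<Lambda>" using e(3) that by blast
    then show ?thesis using eF that False by (simp add: g_def)
  qed (simp add: g_def)
  have "g analytic_on {z}" for z
  proof (cases "z \<in> \<Lambda>")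
    case False
    have "g holomorphic_on - \<Lambda>"
      using f(1) by (subst holomorphic_cong[OF refl, of _ _ f]) (auto simp: g_def elliptic_def)
    then show ?thesis using False open_compl_\<Lambda> analytic_at by blast
  next
    case True
    have "(\<lambda>w. F (w - z)) holomorphic_on ball z e"
      using e(2) by (intro holomorphic_on_compose_gen[of "\<lambda>w. w - z" _ F, unfolded o_def])
        (auto intro!: holomorphic_intros simp: dist_norm norm_minus_commute)
    moreover have "F (w - z) = g w" if "w \<in> ball z e" for w
      using gF[of "w - z"] per[OF True, of "w - z"] that by (simp add: dist_norm norm_minus_commute)
    ultimately have "g holomorphic_on ball z e"
      by (rule holomorphic_transform) auto
    then show ?thesis using e(1) analytic_at[of g z] centre_in_ball open_ball by blast
  qed
  then have holo: "g holomorphic_on UNIV"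
    by (meson analytic_on_analytic_at analytic_imp_holomorphic)
  define R where "R = norm v1 + norm v2"
  have "compact (g ` cball 0 R)"
    by (intro compact_continuous_image holomorphic_on_imp_continuous_on holomorphic_on_subset[OF holo]) auto
  moreover have "range g \<subseteq> g ` cball 0 R"
  proof safe
    fix z
    obtain x y :: real where xy: "z = of_real x * v1 + of_real y * v2"
      using coordinates[of z] by blast
    \<comment> \<open>Subtracting the integer parts of the coordinates moves z into the period
      parallelogram, whose points have norm at most |v1| + |v2|.\<close>
    define l where "l = of_int \<lfloor>x\<rfloor> * v1 + of_int \<lfloor>y\<rfloor> * v2"
    have l: "l \<in> \<Lambda>" unfolding l_def by (rule in_\<Lambda>I)
    have "z - l = of_real (frac x) * v1 + of_real (frac y) * v2"
      by (simp add: xy l_def frac_def algebra_simps)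
    also have "norm \<dots> \<le> \<bar>frac x\<bar> * norm v1 + \<bar>frac y\<bar> * norm v2"
      using norm_triangle_ineq[of "of_real (frac x) * v1" "of_real (frac y) * v2"] by (simp add: norm_mult)
    also have "\<dots> \<le> 1 * norm v1 + 1 * norm v2"
      by (intro add_mono mult_right_mono) (auto simp: frac_lt_1 less_imp_le)
    finally have "z - l \<in> cball 0 R" by (simp add: R_def)
    moreover have "g z = g (z - l)" using per[OF l, of "z - l"] by simp
    ultimately show "g z \<in> g ` cball 0 R" by blast
  qed
  ultimately have "bounded (range g)"
    using bounded_subset compact_imp_bounded by blast
  then have "g constant_on UNIV" using Liouville_theorem holo by blast
  then obtain c where c: "\<And>z. g z = c" unfolding constant_on_def by auto
  show ?thesis
  proof (rule that)
    show "f z = c" if "z \<notin> \<Lambda>" for z using c[of z] that by (simp add: g_def)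
  qed
qed

text \<open>If \<open>f\<close> had a simple pole with residue \<open>r\<close>, then \<open>f' + f\<^sup>2 / r + b f\<close> would be pole-free for a suitable
  \<open>b\<close>, hence constant, so that \<open>f' = - (f - k) (f - k') / r\<close>. By uniqueness for this
  differential equation \<open>f\<close> omits the value \<open>k\<close>, and \<open>1 / (f - k)\<close> contradicts Liouville.\<close>

lemma elliptic_no_simple_pole:
  assumes f: "elliptic f" "pole_form 1 F f"
  shows "F 0 = 0"
proof (rule ccontr)
  assume r0: "F 0 \<noteq> 0"
  define r where "r = F 0"
  have r: "r \<noteq> 0" using r0 by (simp add: r_def)
  obtain e where e: "e > 0" "F holomorphic_on ball 0 e" "ball 0 e \<inter> \<Lambda> = {0}"
    and eF: "\<And>z. z \<in> ball 0 e \<Longrightarrow> z \<noteq> 0 \<Longrightarrow> f z = F z / z"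
    using pole_form_ball[OF f(2)] by (metis power_one_right)
  have Fan: "F analytic_on {0}" using f(2) by (simp add: pole_form_def)
  have ev_e: "eventually (\<lambda>z. z \<in> ball 0 e - {0}) (at (0::complex))"
    using e(1) by (intro eventually_at_in_open) auto
  \<comment> \<open>The coefficient of 1/z in f' + f^2/r + b f is 2 F'(0) + b r, and
    \<open>b\<close> is chosen to cancel it. The coefficient of 1/z^2 is -r + r = 0 already.
    \<open>M\<close> is the numerator of \<open>g\<close> over z^2.\<close>
  define b where "b = - 2 * deriv F 0 / r"
  define g where "g = (\<lambda>z. deriv f z + f z ^ 2 * inverse r + b * f z)"
  define M where "M = (\<lambda>z. deriv F z * z - F z + F z ^ 2 * inverse r + b * z * F z)"
  have gell: "elliptic g"
    unfolding g_def using f(1) elliptic_deriv[OF f(1)]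
    by (intro elliptic_add elliptic_mult elliptic_power elliptic_const) auto
  have df: "deriv f z = (deriv F z * z - F z) / z ^ 2" if z: "z \<in> ball 0 e" "z \<noteq> 0" for z
  proof -
    have "(F has_field_derivative deriv F z) (at z)"
      using holomorphic_derivI[OF e(2) open_ball z(1)] by simp
    then have "((\<lambda>z. F z / z) has_field_derivative (deriv F z * z - F z) / z ^ 2) (at z)"
      using z by (auto intro!: derivative_eq_intros simp: power2_eq_square)
    moreover have "eventually (\<lambda>w. w \<in> ball 0 e - {0}) (nhds z)"
      using z by (intro eventually_nhds_in_open) auto
    then have "eventually (\<lambda>w. f w = F w / w) (nhds z)"
      by eventually_elim (use eF in auto)
    ultimately show ?thesis by (rule deriv_eqI_ev)
  qed
  have "pole_form (Suc (Suc 0)) M g"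
    unfolding pole_form_def
  proof
    show "M analytic_on {0}" unfolding M_def by (intro analytic_intros Fan)
    show "eventually (\<lambda>z. g z = M z / z ^ Suc (Suc 0)) (at 0)"
      using ev_e
    proof eventually_elim
      case (elim z)
      then have "z \<in> ball 0 e" "z \<noteq> 0" by auto
      then show ?case
        unfolding g_def M_def df[OF \<open>z \<in> ball 0 e\<close> \<open>z \<noteq> 0\<close>] eF[OF \<open>z \<in> ball 0 e\<close> \<open>z \<noteq> 0\<close>]
        using r by (simp add: field_simps power2_eq_square)
    qed
  qed
  moreover have "M 0 = 0" using r by (simp add: M_def r_def power2_eq_square)
  ultimately obtain M1 where M1: "pole_form (Suc 0) M1 g" "M1 0 = deriv M 0"
    by (rule pole_form_reduce)
  have F': "(F has_field_derivative deriv F 0) (at 0)"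
    using holomorphic_derivI[OF e(2) open_ball] e(1) by simp
  have F'': "(deriv F has_field_derivative deriv (deriv F) 0) (at 0)"
    using holomorphic_derivI[OF holomorphic_deriv[OF e(2) open_ball] open_ball] e(1) by simp
  have "(M has_field_derivative 2 * r * inverse r * deriv F 0 + b * r) (at 0)"
    unfolding M_def by (rule derivative_eq_intros F' F'' refl)+ (simp add: r_def)
  then have "deriv M 0 = 0"
    using r by (simp add: DERIV_imp_deriv b_def)
  then obtain M2 where "pole_form 0 M2 g"
    using pole_form_reduce[OF M1(1)] M1(2) by auto
  then obtain K where K: "\<And>z. z \<notin> \<Lambda> \<Longrightarrow> g z = K"
    using elliptic_Liouville[OF gell] by blast
  \<comment> \<open>\<open>k\<close> is a root of k^2 + b r k = K r, that is, a constant solution of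
    the differential equation f' = K - b f - f^2/r. The other root is - k - b r.\<close>
  define k where "k = r * (csqrt (b^2 + 4 * K / r) - b) / 2"
  have "(2 * k / r + b) ^ 2 = b^2 + 4 * K / r"
    using r by (simp add: k_def)
  then have "4 * r * (k ^ 2 + b * k * r) = 4 * r * (K * r)"
    using r by (simp add: field_simps power2_eq_square)
  then have k: "k ^ 2 + b * k * r = K * r"
    using r by (metis mult_cancel_left mult_eq_0_iff zero_neq_numeral)
  have fholo: "f holomorphic_on - \<Lambda>" using f(1) by (simp add: elliptic_def)
  have ode: "deriv f z = - (f z + k + b * r) / r * (f z - k)" if "z \<notin> \<Lambda>" for z
  proof -
    have "deriv f z * r + f z ^ 2 + b * f z * r = K * r"
      using K[OF that] r by (auto simp: g_def field_simps)
    then have "deriv f z * r = - (f z + k + b * r) * (f z - k)"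
      using k by (simp add: algebra_simps power2_eq_square)
    then show ?thesis using r by (simp add: field_simps)
  qed
  have nk: "f z0 \<noteq> k" if z0: "z0 \<notin> \<Lambda>" for z0
  proof
    assume fz0: "f z0 = k"
    obtain d where d: "d > 0" "ball z0 d \<subseteq> - \<Lambda>"
      using open_compl_\<Lambda> z0 openE by (metis ComplI)
    have hol: "f holomorphic_on ball z0 d" using fholo d holomorphic_on_subset by blast
    have "f z - k = 0" if "z \<in> ball z0 d" for z
    proof (rule linear_ode_zero[of "ball z0 d" "\<lambda>z. f z - k" "\<lambda>z. - (f z + k + b * r) / r" z0])
      fix w assume w: "w \<in> ball z0 d"
      have "f field_differentiable at w" using hol w
        by (meson holomorphic_on_imp_differentiable_at open_ball)
      then have "deriv (\<lambda>z. f z - k) w = deriv f w" by simp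
      then show "deriv (\<lambda>z. f z - k) w = - (f w + k + b * r) / r * (f w - k)"
        using ode[of w] w d by auto
    qed (use that fz0 d r in \<open>auto intro!: holomorphic_intros hol\<close>)
    then have fk: "f z = k" if "z \<notin> \<Lambda>" for z
      using analytic_continuation_open[of "ball z0 d" "- \<Lambda>" f "\<lambda>_. k" z] d that fholo
        open_compl_\<Lambda> connected_compl_\<Lambda> by auto
    \<comment> \<open>If f were constantly k, its numerator would be k z and would vanish at 0,
      contrary to the nonzero residue.\<close>
    have "eventually (\<lambda>z. F z = k * z) (at 0)"
      using ev_e eventually_not_in_\<Lambda>[of 0]
    proof eventually_elim
      case (elim z)
      then have "k = F z / z" using fk[of z] eF[of z] by simp
      then show ?case using elim by simp
    qed
    moreover have "(F \<longlongrightarrow> r) (at 0)"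
      using analytic_at_imp_isCont[OF Fan] by (simp add: isCont_def r_def)
    ultimately have "((\<lambda>z. k * z) \<longlongrightarrow> r) (at 0)"
      by (rule Lim_transform_eventually[rotated])
    moreover have "((\<lambda>z. k * z) \<longlongrightarrow> k * 0) (at 0)"
      by (intro tendsto_intros)
    ultimately show False using r tendsto_unique[OF at_neq_bot] by fastforce
  qed
  define h where "h = (\<lambda>z. 1 / (f z - k))"
  have hell: "elliptic h" unfolding h_def elliptic_def
    using f(1) nk by (auto intro!: holomorphic_intros simp: elliptic_def)
  \<comment> \<open>1/(f - k) is regular at the lattice points with value 0 there, since f has a
    pole. The constant supplied by Liouville is therefore 0, which no reciprocal of a nonzero number
    can be.\<close>
  define Hf where "Hf = (\<lambda>z. z / (F z - k * z))"
  have Han: "Hf analytic_on {0}"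
    unfolding Hf_def by (intro analytic_intros Fan) (use r in \<open>auto simp: r_def\<close>)
  have ev_h: "eventually (\<lambda>z. h z = Hf z) (at 0)"
    using ev_e by eventually_elim (auto simp: h_def Hf_def eF field_simps)
  then have "pole_form 0 Hf h" using Han by (simp add: pole_form_def)
  then obtain c where c: "\<And>z. z \<notin> \<Lambda> \<Longrightarrow> h z = c"
    using elliptic_Liouville[OF hell] by blast
  have "eventually (\<lambda>z. Hf z = c) (at 0)"
    using ev_h eventually_not_in_\<Lambda>[of 0] by eventually_elim (use c in auto)
  moreover have "(Hf \<longlongrightarrow> 0) (at 0)"
    using analytic_at_imp_isCont[OF Han] by (simp add: isCont_def Hf_def)
  ultimately have "((\<lambda>_::complex. c) \<longlongrightarrow> 0) (at (0::complex))"
    by (rule Lim_transform_eventually[rotated])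
  then have "c = 0" using LIM_const_eq by blast
  obtain z where "z \<notin> \<Lambda>" by (rule compl_\<Lambda>_nonempty)
  with c[of z] nk[of z] \<open>c = 0\<close> show False by (simp add: h_def)
qed

lemma pole_form_wp: "\<exists>A. pole_form 2 A (wp \<Lambda>) \<and> A 0 = 1"
  and pole_form_wp': "\<exists>B. pole_form 3 B (wp' \<Lambda>) \<and> B 0 = -2"
proof -
  obtain h e where h: "e > 0" "h holomorphic_on ball 0 e" "ball 0 e \<inter> \<Lambda> = {0}"
    "\<And>z. z \<in> ball 0 e \<Longrightarrow> wp \<Lambda> z = 1 / z^2 + h z"
    using wp_near_0 by metis
  have han: "h analytic_on {0}" using h analytic_at[of h 0] centre_in_ball open_ball by blast
  have ev_e: "eventually (\<lambda>z. z \<in> ball 0 e - {0}) (at (0::complex))"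
    using h(1) by (intro eventually_at_in_open) auto
  have "pole_form 2 (\<lambda>z. 1 + z^2 * h z) (wp \<Lambda>)"
    unfolding pole_form_def
  proof
    show "eventually (\<lambda>z. wp \<Lambda> z = (1 + z^2 * h z) / z ^ 2) (at 0)"
      using ev_e by eventually_elim (auto simp: h(4) field_simps)
  qed (intro analytic_intros han)
  then show "\<exists>A. pole_form 2 A (wp \<Lambda>) \<and> A 0 = 1"
    by fastforce
  have "pole_form 3 (\<lambda>z. - 2 + z^3 * deriv h z) (wp' \<Lambda>)"
    unfolding pole_form_def
  proof
    have "deriv (wp \<Lambda>) z = (- 2 + z^3 * deriv h z) / z ^ 3" if z: "z \<in> ball 0 e" "z \<noteq> 0" for z
    proof -
      have "(h has_field_derivative deriv h z) (at z)"
        using holomorphic_derivI[OF h(2) open_ball z(1)] by simp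
      then have "((\<lambda>z. 1 / z^2 + h z) has_field_derivative (- 2 + z^3 * deriv h z) / z ^ 3) (at z)"
        using z by (auto intro!: derivative_eq_intros simp: field_simps power2_eq_square power3_eq_cube)
      moreover have "eventually (\<lambda>w. w \<in> ball 0 e) (nhds z)"
        using z by (intro eventually_nhds_in_open) auto
      then have "eventually (\<lambda>w. wp \<Lambda> w = 1 / w^2 + h w) (nhds z)"
        by eventually_elim (use h(4) in auto)
      ultimately show ?thesis by (rule deriv_eqI_ev)
    qed
    then show "eventually (\<lambda>z. wp' \<Lambda> z = (- 2 + z^3 * deriv h z) / z ^ 3) (at 0)"
      using ev_e by (auto elim!: eventually_mono simp: wp'_def)
  qed (intro analytic_intros han)
  then show "\<exists>B. pole_form 3 B (wp' \<Lambda>) \<and> B 0 = -2"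
    by fastforce
qed

text \<open>Every order at least 2 is of the form 2i + 3j, so a monomial in \<open>wp\<close> and
  \<open>wp'\<close> cancels the leading term and lowers the order. Order 1, the only gap, is
  excluded by \<open>elliptic_no_simple_pole\<close>.\<close>

lemma elliptic_in_wp_poly_alg:
  assumes "elliptic f" "pole_form n F f"
  shows "\<exists>p\<in>wp_poly_alg \<Lambda>. \<forall>z. z \<notin> \<Lambda> \<longrightarrow> f z = p z"
  using assms
proof (induction n arbitrary: f F)
  case 0
  then obtain c where "\<And>z. z \<notin> \<Lambda> \<Longrightarrow> f z = c"
    using elliptic_Liouville by blast
  then show ?case by (intro bexI[OF _ wp_poly_alg_const[of c]]) auto
next
  case (Suc n)
  show ?case
  proof (cases "n = 0")
    case True
    then have "F 0 = 0" using elliptic_no_simple_pole[of f F] Suc.prems by simp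
    then show ?thesis using pole_form_reduce[OF Suc.prems(2)] Suc.IH Suc.prems by metis
  next
    case False
    obtain i j where ij: "Suc n = 2 * i + 3 * j"
    proof (cases "even (Suc n)")
      case True
      then show ?thesis using that[of "Suc n div 2" 0] by simp
    next
      case odd: False
      \<comment> \<open>Here n is even and at least 2, and one factor \<open>wp'\<close> uses up the
        odd part: n + 1 = 2 ((n - 2)/2) + 3.\<close>
      then show ?thesis using that[of "(n - 2) div 2" 1] False by (auto elim!: evenE)
    qed
    obtain A B where A: "pole_form 2 A (wp \<Lambda>)" "A 0 = 1" and B: "pole_form 3 B (wp' \<Lambda>)" "B 0 = -2"
      using pole_form_wp pole_form_wp' by metis
    \<comment> \<open>The monomial has leading coefficient (-2)^j, the leading coefficients of
      \<open>wp\<close> and \<open>wp'\<close> being 1 and -2.\<close>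
    define a where "a = F 0 / (-2) ^ j"
    have "pole_form (0 + 2 * i + 3 * j) (\<lambda>z. - a * A z ^ i * B z ^ j) (\<lambda>z. - a * wp \<Lambda> z ^ i * wp' \<Lambda> z ^ j)"
      by (intro pole_form_mult pole_form_power A B pole_form_const)
    then have "pole_form (Suc n) (\<lambda>z. F z + - a * A z ^ i * B z ^ j) (\<lambda>z. f z + - a * wp \<Lambda> z ^ i * wp' \<Lambda> z ^ j)"
      using Suc.prems(2) ij by (intro pole_form_add) auto
    moreover have "F 0 + - a * A 0 ^ i * B 0 ^ j = 0"
      by (simp add: A B a_def)
    ultimately obtain F1 where F1: "pole_form n F1 (\<lambda>z. f z + - a * wp \<Lambda> z ^ i * wp' \<Lambda> z ^ j)"
      using pole_form_reduce by blast
    have "elliptic (\<lambda>z. f z + - a * wp \<Lambda> z ^ i * wp' \<Lambda> z ^ j)"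
      by (intro elliptic_add elliptic_mult elliptic_power elliptic_const elliptic_wp elliptic_wp' Suc.prems)
    from Suc.IH[OF this F1] obtain p where p: "p \<in> wp_poly_alg \<Lambda>"
      "\<And>z. z \<notin> \<Lambda> \<Longrightarrow> f z + - a * wp \<Lambda> z ^ i * wp' \<Lambda> z ^ j = p z" by blast
    have "f z = p z + a * wp \<Lambda> z ^ i * wp' \<Lambda> z ^ j" if "z \<notin> \<Lambda>" for z
      using p(2)[OF that] by (simp add: algebra_simps)
    then show ?thesis
      by (intro bexI[OF _ wp_poly_alg_add[OF p(1) wp_poly_alg_monom[of a \<Lambda> i j]]]) auto
  qed
qed

text \<open>The factorisation by \<open>zorder\<close> is available only when the function does not
  vanish identically near 0, hence the case split. A nonnegative order is absorbed into the
  numerator.\<close>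

lemma meromorphic_pole_form:
  assumes "f meromorphic_on {0}"
  obtains n F where "pole_form n F f"
proof (cases "\<exists>\<^sub>F w in at 0. f w \<noteq> 0")
  case False
  then have "pole_form 0 (\<lambda>_. 0) f" by (simp add: pole_form_def frequently_def)
  then show ?thesis by (rule that)
next
  case True
  have "isolated_singularity_at f 0" "not_essential f 0"
    using assms by (simp_all add: meromorphic_at_iff)
  from zorder_exist[OF this True] obtain r where r: "r > 0" "zor_poly f 0 holomorphic_on cball 0 r"
    "\<And>w. w \<in> cball 0 r - {0} \<Longrightarrow> f w = zor_poly f 0 w * w powi zorder f 0" by auto
  define G where "G = zor_poly f 0"
  have Gan: "G analytic_on {0}"
    unfolding G_def analytic_on_def using r ball_subset_cball holomorphic_on_subset by blast
  have ev: "eventually (\<lambda>z. z \<in> ball 0 r - {0}) (at (0::complex))"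
    using r(1) by (intro eventually_at_in_open) auto
  show ?thesis
  proof (cases "zorder f 0 \<ge> 0")
    case True
    have "pole_form 0 (\<lambda>z. G z * z ^ nat (zorder f 0)) f"
      unfolding pole_form_def
    proof
      show "eventually (\<lambda>z. f z = G z * z ^ nat (zorder f 0) / z ^ 0) (at 0)"
        using ev by eventually_elim (use r(3) True in \<open>auto simp: G_def power_int_def\<close>)
    qed (intro analytic_intros Gan)
    then show ?thesis by (rule that)
  next
    case False
    have "pole_form (nat (- zorder f 0)) G f"
      unfolding pole_form_def
    proof
      show "eventually (\<lambda>z. f z = G z / z ^ nat (- zorder f 0)) (at 0)"
        using ev by eventually_elim (use r(3) False in \<open>auto simp: G_def power_int_def field_simps\<close>)
    qed (rule Gan)
    then show ?thesis by (rule that)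
  qed
qed

end

section \<open>The sigma function and quasi-periodic functions\<close>

text \<open>Writing v = w k splits the logarithmic derivative into 1/w and k'/k, the latter regular.
  After one more derivative the singular part is -1/w^2, the negative of that of
  \<open>wp\<close>.\<close>

lemma deriv_log_deriv_simple_zero:
  assumes e: "open B" "k holomorphic_on B" "\<And>w. w \<in> B \<Longrightarrow> k w \<noteq> 0"
    and v: "\<And>w. w \<in> B \<Longrightarrow> v w = w * k w" and w: "w \<in> B" "w \<noteq> (0::complex)"
  shows "deriv v w / v w = 1 / w + deriv k w / k w"
    and "deriv (\<lambda>w. deriv v w / v w) w = - 1 / w ^ 2 + deriv (\<lambda>w. deriv k w / k w) w"
proof -
  have dv: "deriv v w / v w = 1 / w + deriv k w / k w" if w: "w \<in> B" "w \<noteq> 0" for w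
  proof -
    have "(k has_field_derivative deriv k w) (at w)"
      using holomorphic_derivI[OF e(2,1) w(1)] .
    then have "((\<lambda>w. w * k w) has_field_derivative k w + w * deriv k w) (at w)"
      by (auto intro!: derivative_eq_intros)
    moreover have "eventually (\<lambda>w. v w = w * k w) (nhds w)"
      using eventually_nhds_in_open[OF e(1) w(1)] by eventually_elim (rule v)
    ultimately have "deriv v w = k w + w * deriv k w" by (rule deriv_eqI_ev)
    then show ?thesis using w e(3)[OF w(1)] v[OF w(1)] by (simp add: field_simps)
  qed
  then show "deriv v w / v w = 1 / w + deriv k w / k w" using w by blast
  have "(\<lambda>w. deriv k w / k w) holomorphic_on B"
    using e by (intro holomorphic_intros holomorphic_deriv) auto
  then have "((\<lambda>w. deriv k w / k w) has_field_derivative deriv (\<lambda>w. deriv k w / k w) w) (at w)"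
    using holomorphic_derivI e(1) w(1) by blast
  then have "((\<lambda>w. 1 / w + deriv k w / k w) has_field_derivative
      - 1 / w ^ 2 + deriv (\<lambda>w. deriv k w / k w) w) (at w)"
    by (rule DERIV_add[rotated]) (use w(2) in \<open>auto intro!: derivative_eq_intros simp: power2_eq_square\<close>)
  moreover have "eventually (\<lambda>w. w \<in> B - {0}) (nhds w)"
    using w e(1) by (intro eventually_nhds_in_open) auto
  then have "eventually (\<lambda>w. deriv v w / v w = 1 / w + deriv k w / k w) (nhds w)"
    by eventually_elim (use dv in auto)
  ultimately show "deriv (\<lambda>w. deriv v w / v w) w = - 1 / w ^ 2 + deriv (\<lambda>w. deriv k w / k w) w"
    by (rule deriv_eqI_ev)
qed

lemma deriv_shift: "deriv f (l + w) = deriv (\<lambda>w. f (l + w)) (w::complex)"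
proof -
  have "deriv f (w + l) = deriv (\<lambda>x. f (x + l)) w"
    unfolding deriv_def by (simp only: DERIV_shift)
  then show ?thesis by (simp add: add.commute)
qed

lemma simple_zero_factor:
  assumes g: "g holomorphic_on UNIV" "g l = 0" "deriv g l \<noteq> (0::complex)"
  obtains k e where "e > 0" "k holomorphic_on ball 0 e" "\<And>w. w \<in> ball 0 e \<Longrightarrow> k w \<noteq> 0"
    "\<And>w. g (l + w) = w * k w"
proof -
  have "(\<lambda>w. g (l + w)) holomorphic_on UNIV"
    by (rule holomorphic_on_compose_gen[of "\<lambda>w. l + w" _ g UNIV, unfolded o_def])
       (auto intro!: holomorphic_intros g)
  then have "(\<lambda>w. g (l + w)) analytic_on {0}"
    using analytic_at by blast
  then obtain k where k: "k analytic_on {0}" "\<And>w. g (l + w) = w * k w" "k 0 = deriv (\<lambda>w. g (l + w)) 0"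
    using analytic_divide_by_z[of "\<lambda>w. g (l + w)"] g(2) by auto
  have k0: "k 0 \<noteq> 0" using k(3) g(3) deriv_shift[of g l 0] by simp
  have "eventually (\<lambda>w. k w \<noteq> 0) (nhds 0)"
    using analytic_at_imp_isCont[OF k(1)] k0 by (simp add: continuous_within tendsto_imp_eventually_ne eventually_nhds_conv_at)
  then obtain e1 where e1: "e1 > 0" "\<And>w. w \<in> ball 0 e1 \<Longrightarrow> k w \<noteq> 0"
    unfolding eventually_nhds_metric by (auto simp: dist_commute)
  obtain e2 where e2: "e2 > 0" "k holomorphic_on ball 0 e2"
    using k(1) unfolding analytic_on_def by auto
  have "ball (0::complex) (min e1 e2) \<subseteq> ball 0 e2" by auto
  then have "k holomorphic_on ball 0 (min e1 e2)" using e2 holomorphic_on_subset by blast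
  then show ?thesis
    using that[of "min e1 e2" k] e1 e2 k(2) by auto
qed

lemma holomorphic_on_shift:
  assumes "f holomorphic_on S" "(\<lambda>z. z + l) ` T \<subseteq> S"
  shows "(\<lambda>z. f (z + l)) holomorphic_on T"
  by (rule holomorphic_on_compose_gen[of "\<lambda>z. z + l" _ f, unfolded o_def])
     (use assms in \<open>auto intro!: holomorphic_intros\<close>)

context complex_lattice
begin

lemma infinite_\<Lambda>: "infinite \<Lambda>"
proof -
  have "infinite (UNIV :: (int \<times> int) set)" by (simp add: finite_prod)
  then show ?thesis
    unfolding \<Lambda>_image using inj_coordinates finite_image_iff by blast
qed

text \<open>A Weierstrass product over the nonzero lattice points has the right zeros; they are
  simple because the enumeration is injective. The canonical factors require nonzero points, so the
  origin enters by the extra factor z.\<close>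

lemma entire_simple_zeros_\<Lambda>:
  obtains g where "g holomorphic_on UNIV" "\<And>z. g z = 0 \<longleftrightarrow> z \<in> \<Lambda>" "\<And>l. l \<in> \<Lambda> \<Longrightarrow> deriv g l \<noteq> 0"
proof -
  define a where "a = from_nat_into (\<Lambda> - {0})"
  have bij: "bij_betw a UNIV (\<Lambda> - {0})"
    unfolding a_def using countable_\<Lambda> infinite_\<Lambda> by (intro bij_betw_from_nat_into) auto
  have inj: "inj a" and ran: "range a = \<Lambda> - {0}"
    using bij by (auto simp: bij_betw_def)
  interpret W: weierstrass_product' a
  proof
    show "a n \<noteq> 0" for n using ran by (metis Diff_iff insertI1 rangeI)
    show "filterlim a at_infinity at_top"
      unfolding filterlim_at_infinity_conv_norm_at_top filterlim_at_top
    proof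
      fix R :: real
      have "finite (a -` {w \<in> \<Lambda>. norm w \<le> R})"
        by (intro finite_vimageI finite_\<Lambda>_cball inj)
      then have "finite {n. \<not> norm (a n) \<ge> R}"
        by (rule rev_finite_subset) (use ran in auto)
      then show "eventually (\<lambda>n. R \<le> norm (a n)) sequentially"
        unfolding cofinite_eq_sequentially[symmetric] eventually_cofinite .
    qed
    show "finite (a -` {z})" for z by (intro finite_vimageI inj) auto
  qed
  have dW: "deriv W.f l \<noteq> 0" if l: "l \<in> \<Lambda> - {0}" for l
  proof -
    have l0: "W.f l = 0" using W.zero[of l] l ran by simp
    obtain n where n: "a n = l" using l ran by (metis rangeE)
    have "a -` {l} = {n}" using n inj by (auto simp: inj_eq)
    then have ord: "zorder W.f l = 1" using W.zorder[of l] by simp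
    have iso: "isolated_singularity_at W.f l" "not_essential W.f l"
      using W.analytic isolated_singularity_at_analytic not_essential_analytic by blast+
    have "eventually (\<lambda>w. W.f w \<noteq> 0) (at l)"
      using W.isolated_zero[of l] l ran by (simp add: isolated_zero_def)
    then have "\<exists>\<^sub>F w in at l. W.f w \<noteq> 0"
      by (intro eventually_frequently) auto
    from zorder_exist[OF iso this] obtain r where r: "r > 0" "zor_poly W.f l holomorphic_on cball l r"
      "\<And>w. w \<in> cball l r - {l} \<Longrightarrow> W.f w = zor_poly W.f l w * (w - l)" and nz: "zor_poly W.f l l \<noteq> 0"
      unfolding ord by auto
    define G where "G = zor_poly W.f l"
    have "G holomorphic_on ball l r" using r(2) holomorphic_on_subset ball_subset_cball unfolding G_def by blast
    then have "(G has_field_derivative deriv G l) (at l)"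
      using holomorphic_derivI[OF _ open_ball] r(1) by simp
    then have "((\<lambda>w. G w * (w - l)) has_field_derivative G l) (at l)"
      by (auto intro!: derivative_eq_intros)
    moreover have "eventually (\<lambda>w. w \<in> ball l r) (nhds l)"
      using r(1) by (intro eventually_nhds_in_open) auto
    then have "eventually (\<lambda>w. W.f w = G w * (w - l)) (nhds l)"
    proof eventually_elim
      case (elim w)
      then show ?case using r(3)[of w] l0 by (cases "w = l") (auto simp: G_def)
    qed
    ultimately have "deriv W.f l = G l" by (rule deriv_eqI_ev)
    then show ?thesis using nz by (simp add: G_def)
  qed
  have W': "(W.f has_field_derivative deriv W.f z) (at z)" for z
    using holomorphic_derivI[OF W.holomorphic[of UNIV]] by simp
  have d: "deriv (\<lambda>z. z * W.f z) z = W.f z + z * deriv W.f z" for z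
    by (rule DERIV_imp_deriv) (auto intro!: derivative_eq_intros W')
  show ?thesis
  proof (rule that[of "\<lambda>z. z * W.f z"])
    show "(\<lambda>z. z * W.f z) holomorphic_on UNIV" by (intro holomorphic_intros W.holomorphic)
    show "z * W.f z = 0 \<longleftrightarrow> z \<in> \<Lambda>" for z using W.zero[of z] ran by auto
    show "deriv (\<lambda>z. z * W.f z) l \<noteq> 0" if "l \<in> \<Lambda>" for l
    proof (cases "l = 0")
      case True
      then show ?thesis using W.zero[of 0] ran by (simp add: d)
    next
      case False
      then have "W.f l = 0" using W.zero[of l] ran that by simp
      then show ?thesis using dW[of l] False that by (simp add: d)
    qed
  qed
qed

text \<open>Any entire g with simple zeros on the lattice can be corrected. In (g'/g)' +
  \<open>wp\<close> the double poles cancel, so this function extends to an entire one; with H a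
  twofold primitive of the extension, g exp(-H) has the desired second logarithmic
  derivative.\<close>

lemma Weierstrass_sigma:
  obtains s where "s holomorphic_on UNIV" "\<And>z. s z = 0 \<longleftrightarrow> z \<in> \<Lambda>" "\<And>l. l \<in> \<Lambda> \<Longrightarrow> deriv s l \<noteq> 0"
    "\<And>z. z \<notin> \<Lambda> \<Longrightarrow> ((\<lambda>z. deriv s z / s z) has_field_derivative - wp \<Lambda> z) (at z)"
proof -
  obtain g where g: "g holomorphic_on UNIV" "\<And>z. g z = 0 \<longleftrightarrow> z \<in> \<Lambda>" "\<And>l. l \<in> \<Lambda> \<Longrightarrow> deriv g l \<noteq> 0"
    using entire_simple_zeros_\<Lambda> by blast
  have g': "deriv g holomorphic_on UNIV" using g(1) by (intro holomorphic_deriv) auto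
  define u where "u = (\<lambda>z. deriv g z / g z)"
  have u: "u holomorphic_on - \<Lambda>"
    unfolding u_def using g by (intro holomorphic_intros holomorphic_on_subset[OF g(1)] holomorphic_on_subset[OF g']) auto
  define d where "d = (\<lambda>z. deriv u z + wp \<Lambda> z)"
  have d: "d holomorphic_on - \<Lambda>"
    unfolding d_def by (intro holomorphic_intros holomorphic_deriv u open_compl_\<Lambda> wp_holomorphic)
  have rem: "remove_sings d analytic_on {z}" for z
  proof (cases "z \<in> \<Lambda>")
    case False
    have "d analytic_on {z}" using d False open_compl_\<Lambda> analytic_at by blast
    then show ?thesis by (rule remove_sings_analytic_on)
  next
    case True
    obtain k e where k: "e > 0" "k holomorphic_on ball 0 e" "\<And>w. w \<in> ball 0 e \<Longrightarrow> k w \<noteq> 0"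
      "\<And>w. g (z + w) = w * k w"
      using simple_zero_factor[OF g(1), of z] g True by metis
    obtain h e' where h: "e' > 0" "h holomorphic_on ball 0 e'" "ball 0 e' \<inter> \<Lambda> = {0}"
      "\<And>w. w \<in> ball 0 e' \<Longrightarrow> wp \<Lambda> w = 1 / w^2 + h w"
      using wp_near_0 by metis
    define D where "D = (\<lambda>w. deriv (\<lambda>w. deriv k w / k w) w + h w)"
    define r where "r = min e e'"
    have r: "r > 0" "ball (0::complex) r \<subseteq> ball 0 e" "ball (0::complex) r \<subseteq> ball 0 e'" using k h by (auto simp: r_def)
    have "D holomorphic_on ball 0 r"
      unfolding D_def using k(3) r
      by (intro holomorphic_intros holomorphic_deriv holomorphic_on_subset[OF k(2)] holomorphic_on_subset[OF h(2)]) auto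
    then have Dl: "(\<lambda>w. D (w - z)) holomorphic_on ball z r"
      by (intro holomorphic_on_compose_gen[of "\<lambda>w. w - z" _ D, unfolded o_def])
         (auto intro!: holomorphic_intros simp: dist_norm norm_minus_commute)
    have dD: "d w = D (w - z)" if w: "w \<in> ball z r - {z}" for w
    proof -
      define x where "x = w - z"
      have x: "x \<in> ball 0 e" "x \<in> ball 0 e'" "x \<noteq> 0" "w = z + x"
        using w r by (auto simp: x_def dist_norm norm_minus_commute)
      have "deriv u w = deriv (\<lambda>w. u (z + w)) x"
        unfolding x(4) by (rule deriv_shift)
      also have "(\<lambda>w. u (z + w)) = (\<lambda>w. deriv (\<lambda>w. g (z + w)) w / g (z + w))"
        by (simp add: u_def deriv_shift)
      also have "deriv \<dots> x = - 1 / x ^ 2 + deriv (\<lambda>w. deriv k w / k w) x"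
        by (rule deriv_log_deriv_simple_zero(2)[OF open_ball k(2)]) (use k x in auto)
      finally show ?thesis
        using wp_periodic[OF True, of x] h(4)[OF x(2)] x by (simp add: d_def D_def add.commute)
    qed
    have "eventually (\<lambda>w. w \<in> ball z r - {z}) (at z)"
      using r(1) by (intro eventually_at_in_open) auto
    then have ev: "eventually (\<lambda>w. d w = D (w - z)) (at z)"
      by eventually_elim (rule dD)
    have an: "(\<lambda>w. D (w - z)) analytic_on {z}"
      using Dl r(1) analytic_at[of _ z] centre_in_ball open_ball by blast
    show ?thesis
    proof (rule remove_sings_analytic_at)
      show "isolated_singularity_at d z"
        using isolated_singularity_at_cong[OF ev refl] isolated_singularity_at_analytic[OF an] by blast
      have "((\<lambda>w. D (w - z)) \<longlongrightarrow> D (z - z)) (at z)"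
        using analytic_at_imp_isCont[OF an] by (simp add: isCont_def)
      then show "(d \<longlongrightarrow> D (z - z)) (at z)"
        using filterlim_cong[OF refl refl ev] by blast
    qed
  qed
  have E: "remove_sings d holomorphic_on UNIV"
    using rem analytic_on_analytic_at analytic_imp_holomorphic by blast
  obtain H1 where H1: "\<And>z. (H1 has_field_derivative remove_sings d z) (at z)"
    using holomorphic_convex_primitive'[OF convex_UNIV open_UNIV E] by auto
  have H1h: "H1 holomorphic_on UNIV" using H1 by (auto simp: holomorphic_on_open)
  obtain H where H: "\<And>z. (H has_field_derivative H1 z) (at z)"
    using holomorphic_convex_primitive'[OF convex_UNIV open_UNIV H1h] by auto
  have Hh: "H holomorphic_on UNIV" using H by (auto simp: holomorphic_on_open)
  define s where "s = (\<lambda>z. g z * exp (- H z))"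
  have gd: "(g has_field_derivative deriv g z) (at z)" for z
    using holomorphic_derivI[OF g(1)] by simp
  have ds: "deriv s z = (deriv g z - g z * H1 z) * exp (- H z)" for z
    unfolding s_def by (rule DERIV_imp_deriv)
      (auto intro!: derivative_eq_intros H gd simp: algebra_simps)
  show ?thesis
  proof (rule that[of s])
    show "s holomorphic_on UNIV" unfolding s_def by (intro holomorphic_intros g Hh)
    show "s z = 0 \<longleftrightarrow> z \<in> \<Lambda>" for z by (simp add: s_def g)
    show "deriv s l \<noteq> 0" if "l \<in> \<Lambda>" for l using g(2)[of l] g(3)[OF that] that by (simp add: ds)
    show "((\<lambda>z. deriv s z / s z) has_field_derivative - wp \<Lambda> z) (at z)" if z: "z \<notin> \<Lambda>" for z
    proof (rule has_field_derivative_transform_within_open[OF _ open_compl_\<Lambda>])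
      have "d analytic_on {z}" using d z open_compl_\<Lambda> analytic_at by blast
      then have "remove_sings d z = d z" by simp
      moreover have "(u has_field_derivative deriv u z) (at z)"
        using holomorphic_derivI[OF u open_compl_\<Lambda>] z by simp
      ultimately show "((\<lambda>z. u z - H1 z) has_field_derivative - wp \<Lambda> z) (at z)"
        using H1[of z] by (auto intro!: derivative_eq_intros simp: d_def)
      show "u w - H1 w = deriv s w / s w" if "w \<in> - \<Lambda>" for w
        using that g(2)[of w] unfolding ds by (simp add: s_def u_def field_simps)
    qed (use z in auto)
  qed
qed

text \<open>Multipliers are written as exponentials so that integer powers, including negative ones,
  become integer multiples of the exponents.\<close>

lemma quasi_periodic:
  assumes "\<And>z. z \<notin> \<Lambda> \<Longrightarrow> f (z + v1) = exp k1 * f z" "\<And>z. z \<notin> \<Lambda> \<Longrightarrow> f (z + v2) = exp k2 * (f z :: complex)"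
    and z: "z \<notin> \<Lambda>"
  shows "f (z + (of_int m * v1 + of_int n * v2)) = exp (of_int m * k1 + of_int n * k2) * f z"
proof -
  have step: "f (z + of_int n * v) = exp (of_int n * k) * f z"
    if v: "v \<in> \<Lambda>" and per: "\<And>z. z \<notin> \<Lambda> \<Longrightarrow> f (z + v) = exp k * f z" and z: "z \<notin> \<Lambda>" for v k z and n :: int
  proof (induction n rule: int_induct[where k = 0])
    case base
    then show ?case by simp
  next
    case (step1 i)
    have "f (z + of_int (i + 1) * v) = f (z + of_int i * v + v)" by (simp add: algebra_simps)
    also have "\<dots> = exp k * f (z + of_int i * v)"
      using per[of "z + of_int i * v"] z \<Lambda>_int_mult[OF v] by (simp add: \<Lambda>_add_iff)
    also have "\<dots> = exp (of_int (i + 1) * k) * f z"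
      using step1 by (simp add: algebra_simps exp_add)
    finally show ?case .
  next
    case (step2 i)
    have "exp k * f (z + of_int (i - 1) * v) = f (z + of_int (i - 1) * v + v)"
      using per[of "z + of_int (i - 1) * v"] z \<Lambda>_int_mult[OF v, of "i - 1"] by (simp add: \<Lambda>_add_iff)
    also have "\<dots> = exp (of_int i * k) * f z"
      using step2 by (simp add: algebra_simps)
    also have "\<dots> = exp k * (exp (of_int (i - 1) * k) * f z)"
      by (simp add: algebra_simps flip: exp_add)
    finally show ?case by simp
  qed
  have "z + of_int m * v1 \<notin> \<Lambda>"
    using z in_\<Lambda>I[of m 0] by (simp add: \<Lambda>_add_iff)
  then have "f (z + of_int m * v1 + of_int n * v2) = exp (of_int n * k2) * f (z + of_int m * v1)"
    using step[of v2 k2] assms(2) \<Lambda>_v2 by blast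
  also have "\<dots> = exp (of_int n * k2) * (exp (of_int m * k1) * f z)"
    using step[of v1 k1 z m] assms(1) z by simp
  finally show ?thesis by (simp add: exp_add algebra_simps)
qed

lemma elliptic_generatorsI:
  assumes "f holomorphic_on - \<Lambda>"
    "\<And>z. z \<notin> \<Lambda> \<Longrightarrow> f (z + v1) = f z" "\<And>z. z \<notin> \<Lambda> \<Longrightarrow> f (z + v2) = f z"
  shows "elliptic f"
  unfolding elliptic_def
proof (intro conjI allI impI)
  fix z l assume z: "z \<notin> \<Lambda>" and "l \<in> \<Lambda>"
  then obtain m n where "l = of_int m * v1 + of_int n * v2" by (auto elim: in_\<Lambda>E)
  then show "f (z + l) = f z"
    using quasi_periodic[of f 0 0 z m n] assms z by simp
qed (rule assms(1))

text \<open>Since \<open>wp\<close> is periodic, the increment of its negative primitive s'/s has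
  derivative zero on the connected complement of the lattice. This makes s(z + l) exp(-h z) / s(z)
  constant in turn, and the constant is nonzero, so it has a logarithm \<open>b\<close>.\<close>

lemma sigma_quasi_periodic:
  assumes s: "s holomorphic_on UNIV" "\<And>z. s z = 0 \<longleftrightarrow> z \<in> \<Lambda>"
    and dz: "\<And>z. z \<notin> \<Lambda> \<Longrightarrow> ((\<lambda>z. deriv s z / s z) has_field_derivative - wp \<Lambda> z) (at z)"
    and l: "l \<in> \<Lambda>"
  obtains h b where "\<And>z. z \<notin> \<Lambda> \<Longrightarrow> deriv s (z + l) / s (z + l) = deriv s z / s z + h"
    "\<And>z. s (z + l) = exp (h * z + b) * s z"
proof -
  define Z where "Z = (\<lambda>z. deriv s z / s z)"
  have "(\<lambda>z. Z (z + l) - Z z) constant_on - \<Lambda>"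
  proof (rule has_field_derivative_0_imp_constant_on[OF _ connected_compl_\<Lambda> open_compl_\<Lambda>])
    fix z assume "z \<in> - \<Lambda>"
    then have z: "z \<notin> \<Lambda>" "z + l \<notin> \<Lambda>" using l by (auto simp: \<Lambda>_add_iff)
    have "((\<lambda>z. Z (z + l)) has_field_derivative - wp \<Lambda> z) (at z)"
      using dz[OF z(2)] wp_periodic[OF l, of z] unfolding Z_def DERIV_shift by simp
    then show "((\<lambda>z. Z (z + l) - Z z) has_field_derivative 0) (at z)"
      using DERIV_diff[OF _ dz[OF z(1)]] unfolding Z_def by fastforce
  qed
  then obtain h where h: "\<And>z. z \<notin> \<Lambda> \<Longrightarrow> Z (z + l) - Z z = h" by (auto simp: constant_on_def)
  have s': "(s has_field_derivative deriv s z) (at z)" for z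
    using holomorphic_derivI[OF s(1)] by simp
  have sl': "((\<lambda>z. s (z + l)) has_field_derivative deriv s (z + l)) (at z)" for z
    using s'[of "z + l"] unfolding DERIV_shift .
  have "(\<lambda>z. s (z + l) * exp (- h * z) / s z) constant_on - \<Lambda>"
  proof (rule has_field_derivative_0_imp_constant_on[OF _ connected_compl_\<Lambda> open_compl_\<Lambda>])
    fix z assume "z \<in> - \<Lambda>"
    then have z: "s z \<noteq> 0" "s (z + l) \<noteq> 0" "z \<notin> \<Lambda>" using l s(2) by (auto simp: \<Lambda>_add_iff)
    have "deriv s (z + l) / s (z + l) - deriv s z / s z = h" using h[OF z(3)] by (simp add: Z_def)
    then have eq: "deriv s (z + l) * s z - deriv s z * s (z + l) = h * (s z * s (z + l))"
      using z by (simp add: field_simps)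
    have "((\<lambda>z. s (z + l) * exp (- h * z) / s z) has_field_derivative
       ((deriv s (z + l) * exp (- h * z) + exp (- h * z) * (- h) * s (z + l)) * s z
         - s (z + l) * exp (- h * z) * deriv s z) / (s z * s z)) (at z)"
      using z by (auto intro!: derivative_eq_intros s' sl')
    also have "(deriv s (z + l) * exp (- h * z) + exp (- h * z) * (- h) * s (z + l)) * s z
         - s (z + l) * exp (- h * z) * deriv s z =
         exp (- h * z) * ((deriv s (z + l) * s z - deriv s z * s (z + l)) - h * (s z * s (z + l)))"
      by (simp add: algebra_simps)
    finally show "((\<lambda>z. s (z + l) * exp (- h * z) / s z) has_field_derivative 0) (at z)"
      unfolding eq by simp
  qed
  then obtain c where c: "\<And>z. z \<notin> \<Lambda> \<Longrightarrow> s (z + l) * exp (- h * z) / s z = c" by (auto simp: constant_on_def)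
  obtain z0 where z0: "z0 \<notin> \<Lambda>" by (rule compl_\<Lambda>_nonempty)
  have "s z0 \<noteq> 0" "s (z0 + l) \<noteq> 0" using z0 s(2) l by (simp_all add: \<Lambda>_add_iff)
  then have "c \<noteq> 0" unfolding c[OF z0, symmetric] by simp
  then obtain b where b: "c = exp b" by (metis exp_Ln)
  have "s (z + l) = exp (h * z + b) * s z" for z
  proof (cases "z \<in> \<Lambda>")
    case True
    then have "s z = 0" "s (z + l) = 0" using s(2) l by (simp_all add: \<Lambda>_add)
    then show ?thesis by simp
  next
    case False
    then have "s (z + l) = exp b * exp (h * z) * s z"
      using c[OF False] s(2)[of z] unfolding b by (simp add: field_simps exp_minus)
    then show ?thesis by (simp add: exp_add)
  qed
  moreover have "deriv s (z + l) / s (z + l) = deriv s z / s z + h" if "z \<notin> \<Lambda>" for z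
    using h[OF that] by (simp add: Z_def algebra_simps)
  ultimately show ?thesis using that by blast
qed

text \<open>The function is \<open>e\<^sup>c\<^sup>z s(z - a) / s(z)\<close> with \<open>s\<close> the sigma function. The multipliers can be prescribed because the
  determinant of Legendre's relation does not vanish: otherwise \<open>\<zeta>(z) - c z\<close> would be elliptic
  with a single simple pole.\<close>

lemma quasi_periodic_simple_zeros:
  obtains f a where "f holomorphic_on - \<Lambda>" "f meromorphic_on UNIV"
    "\<And>z. z \<notin> \<Lambda> \<Longrightarrow> f (z + v1) = exp k1 * f z" "\<And>z. z \<notin> \<Lambda> \<Longrightarrow> f (z + v2) = exp k2 * f z"
    "\<And>z. z \<notin> \<Lambda> \<Longrightarrow> f z = 0 \<longleftrightarrow> z - a \<in> \<Lambda>" "\<And>z. z \<notin> \<Lambda> \<Longrightarrow> f z = 0 \<Longrightarrow> deriv f z \<noteq> 0"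
proof -
  obtain s where s: "s holomorphic_on UNIV" "\<And>z. s z = 0 \<longleftrightarrow> z \<in> \<Lambda>" "\<And>l. l \<in> \<Lambda> \<Longrightarrow> deriv s l \<noteq> 0"
    and dz: "\<And>z. z \<notin> \<Lambda> \<Longrightarrow> ((\<lambda>z. deriv s z / s z) has_field_derivative - wp \<Lambda> z) (at z)"
    using Weierstrass_sigma by blast
  obtain h1 b1 where h1: "\<And>z. z \<notin> \<Lambda> \<Longrightarrow> deriv s (z + v1) / s (z + v1) = deriv s z / s z + h1"
    "\<And>z. s (z + v1) = exp (h1 * z + b1) * s z"
    using sigma_quasi_periodic[OF s(1,2) dz \<Lambda>_v1] by blast
  obtain h2 b2 where h2: "\<And>z. z \<notin> \<Lambda> \<Longrightarrow> deriv s (z + v2) / s (z + v2) = deriv s z / s z + h2"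
    "\<And>z. s (z + v2) = exp (h2 * z + b2) * s z"
    using sigma_quasi_periodic[OF s(1,2) dz \<Lambda>_v2] by blast
  define D where "D = h1 * v2 - h2 * v1"
  have D: "D \<noteq> 0"
  proof
    assume "D = 0"
    \<comment> \<open>With D = 0 the increments of s'/s are c times the periods, so subtracting c z
      makes the function periodic.\<close>
    define c where "c = h1 / v1"
    have c: "h1 = c * v1" "h2 = c * v2" using \<open>D = 0\<close> by (simp_all add: c_def D_def field_simps)
    define f where "f = (\<lambda>z. deriv s z / s z - c * z)"
    have "elliptic f"
    proof (rule elliptic_generatorsI)
      show "f holomorphic_on - \<Lambda>"
        unfolding f_def using s(2)
        by (intro holomorphic_intros holomorphic_on_subset[OF s(1)]
            holomorphic_on_subset[OF holomorphic_deriv[OF s(1) open_UNIV]]) auto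
    qed (use h1(1) h2(1) c in \<open>auto simp: f_def algebra_simps\<close>)
    moreover obtain k e where k: "e > 0" "k holomorphic_on ball 0 e" "\<And>w. w \<in> ball 0 e \<Longrightarrow> k w \<noteq> 0"
      "\<And>w. s (0 + w) = w * k w"
      using simple_zero_factor[OF s(1), of 0] s by (metis \<Lambda>_0)
    have "pole_form 1 (\<lambda>w. 1 + w * (deriv k w / k w) - c * w ^ 2) f"
      unfolding pole_form_def
    proof
      have "k analytic_on {0}" using k analytic_at[of k 0] centre_in_ball open_ball by blast
      then show "(\<lambda>w. 1 + w * (deriv k w / k w) - c * w ^ 2) analytic_on {0}"
        using k by (intro analytic_intros) auto
      have "eventually (\<lambda>w. w \<in> ball 0 e - {0}) (at (0::complex))"
        using k(1) by (intro eventually_at_in_open) auto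
      then show "eventually (\<lambda>z. f z = (1 + z * (deriv k z / k z) - c * z ^ 2) / z ^ 1) (at 0)"
      proof eventually_elim
        case (elim w)
        then have "deriv s w / s w = 1 / w + deriv k w / k w"
          using deriv_log_deriv_simple_zero(1)[OF open_ball k(2,3), of s w] k(4) by simp
        then show ?case using elim by (simp add: f_def add_divide_distrib diff_divide_distrib power2_eq_square)
      qed
    qed
    ultimately show False using elliptic_no_simple_pole by fastforce
  qed
  \<comment> \<open>Cramer's rule for the equations c v1 - a h1 = k1 and c v2 - a h2 = k2, whose
    determinant is D.\<close>
  define a where "a = (v1 * k2 - v2 * k1) / D"
  define c where "c = (h1 * k2 - h2 * k1) / D"
  have k1: "c * v1 - a * h1 = k1"
  proof -
    have "(c * v1 - a * h1) * D = k1 * D" using D by (simp add: a_def c_def field_simps) (simp add: D_def algebra_simps)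
    then show ?thesis using D by simp
  qed
  have k2: "c * v2 - a * h2 = k2"
  proof -
    have "(c * v2 - a * h2) * D = k2 * D" using D by (simp add: a_def c_def field_simps) (simp add: D_def algebra_simps)
    then show ?thesis using D by simp
  qed
  define f where "f = (\<lambda>z. exp (c * z) * s (z - a) / s z)"
  have sa: "(\<lambda>z. s (z - a)) holomorphic_on T" for T
    using holomorphic_on_shift[of s UNIV "- a" T] s(1) by simp
  \<comment> \<open>In the quotient s(z - a) / s(z) the factors exp(h z + b) cancel except for the
    exp(- a h) left by the shift.\<close>
  have per: "f (z + v) = exp k * f z" if "\<And>z. s (z + v) = exp (h * z + b) * s z" "c * v - a * h = k" for v h b k z
  proof -
    have "s (z + v - a) = exp (h * z + b) * exp (- a * h) * s (z - a)"
      using that(1)[of "z - a"] by (simp add: algebra_simps flip: exp_add)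
    then have "f (z + v) = exp (h * z + b) * (exp (c * (z + v)) * exp (- a * h) * s (z - a)) / (exp (h * z + b) * s z)"
      unfolding f_def that(1) by (simp add: mult_ac)
    also have "\<dots> = exp (c * (z + v)) * exp (- a * h) * s (z - a) / s z"
      by (subst mult_divide_mult_cancel_left) simp_all
    also have "exp (c * (z + v)) * exp (- a * h) = exp k * exp (c * z)"
      unfolding that(2)[symmetric] by (simp add: algebra_simps flip: exp_add)
    finally show ?thesis unfolding f_def by simp
  qed
  show ?thesis
  proof (rule that[of f a])
    show "f holomorphic_on - \<Lambda>"
      unfolding f_def using s(2) by (intro holomorphic_intros sa holomorphic_on_subset[OF s(1)]) auto
    have "s meromorphic_on UNIV" "(\<lambda>z. s (z - a)) meromorphic_on UNIV"
      using s(1) sa by (auto intro!: analytic_on_imp_meromorphic_on simp: analytic_on_open)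
    then show "f meromorphic_on UNIV"
      unfolding f_def by (auto intro!: meromorphic_intros analytic_on_imp_meromorphic_on[of "\<lambda>z. exp (c * z)"] analytic_intros)
    show "f (z + v1) = exp k1 * f z" "f (z + v2) = exp k2 * f z" for z
      by (rule per[OF h1(2) k1], rule per[OF h2(2) k2])
    show f0: "f z = 0 \<longleftrightarrow> z - a \<in> \<Lambda>" if "z \<notin> \<Lambda>" for z
      using that s(2) by (auto simp: f_def)
    show "deriv f z \<noteq> 0" if z: "z \<notin> \<Lambda>" "f z = 0" for z
    proof -
      have sz: "s z \<noteq> 0" "s (z - a) = 0" "deriv s (z - a) \<noteq> 0"
        using z f0[OF z(1)] s(2,3) by auto
      have s': "(s has_field_derivative deriv s z) (at z)" for z
        using holomorphic_derivI[OF s(1)] by simp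
      have sa': "((\<lambda>z. s (z - a)) has_field_derivative deriv s (z - a)) (at z)"
        using s'[of "z + (- a)"] unfolding DERIV_shift by simp
      have "(f has_field_derivative exp (c * z) * deriv s (z - a) / s z) (at z)"
        unfolding f_def using sz by (auto intro!: derivative_eq_intros s' sa')
      then have "deriv f z = exp (c * z) * deriv s (z - a) / s z" by (rule DERIV_imp_deriv)
      then show ?thesis using sz by simp
    qed
  qed
qed

end

section \<open>Unimodular matrices with quasi-periodic entries\<close>

lemma open_nonzero_preimage:
  fixes g :: "complex \<Rightarrow> complex"
  assumes "open S" "continuous_on S g"
  shows "open {w \<in> S. g w \<noteq> 0}"
proof -
  have "open (S \<inter> g -` (- {0}))"
    using assms by (intro continuous_open_preimage) auto
  also have "S \<inter> g -` (- {0}) = {w \<in> S. g w \<noteq> 0}" by auto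
  finally show ?thesis .
qed

text \<open>Near a common zero both functions are divided by the linear factor. The new denominator
  is nonzero there, and the quotient takes the value given by l'Hopital's rule.\<close>

lemma holomorphic_quotient_simple_zeros:
  assumes S: "open S" and f: "f holomorphic_on S" and g: "g holomorphic_on S"
    and simple: "\<And>z. z \<in> S \<Longrightarrow> g z = 0 \<Longrightarrow> f z = 0 \<and> deriv g z \<noteq> (0::complex)"
  shows "(\<lambda>z. if g z = 0 then deriv f z / deriv g z else f z / g z) holomorphic_on S" (is "?q holomorphic_on S")
proof -
  have "?q analytic_on {z}" if z: "z \<in> S" for z
  proof (cases "g z = 0")
    case False
    have "continuous_on S g" using g by (rule holomorphic_on_imp_continuous_on)
    then have op: "open {w \<in> S. g w \<noteq> 0}"
      by (rule open_nonzero_preimage[OF S])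
    have "(\<lambda>w. f w / g w) holomorphic_on {w \<in> S. g w \<noteq> 0}"
      by (intro holomorphic_intros holomorphic_on_subset[OF f] holomorphic_on_subset[OF g]) auto
    then have "?q holomorphic_on {w \<in> S. g w \<noteq> 0}"
      by (rule holomorphic_transform) auto
    then show ?thesis using op z False analytic_at by blast
  next
    case True
    define F where "F = (\<lambda>w. if w = z then deriv f z else (f w - f z) / (w - z))"
    define G where "G = (\<lambda>w. if w = z then deriv g z else (g w - g z) / (w - z))"
    have FG: "F holomorphic_on S" "G holomorphic_on S"
      unfolding F_def G_def using z S by (auto intro!: pole_lemma f g simp: interior_open)
    have fz: "f z = 0" "deriv g z \<noteq> 0" using simple z True by auto
    have fF: "f w = (w - z) * F w" and gG: "g w = (w - z) * G w" for w
      using fz True by (auto simp: F_def G_def)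
    have Gz: "G z \<noteq> 0" using fz by (simp add: G_def)
    have "continuous_on S G" using FG(2) by (rule holomorphic_on_imp_continuous_on)
    then have op: "open {w \<in> S. G w \<noteq> 0}"
      by (rule open_nonzero_preimage[OF S])
    have "(\<lambda>w. F w / G w) holomorphic_on {w \<in> S. G w \<noteq> 0}"
      by (intro holomorphic_intros holomorphic_on_subset[OF FG(1)] holomorphic_on_subset[OF FG(2)]) auto
    moreover have "F w / G w = ?q w" if "w \<in> {w \<in> S. G w \<noteq> 0}" for w
    proof (cases "w = z")
      case True
      then show ?thesis using \<open>g z = 0\<close> by (simp add: F_def G_def)
    next
      case False
      then have "g w \<noteq> 0" using gG[of w] that by simp
      then show ?thesis using fF[of w] gG[of w] False by simp
    qed
    ultimately have "?q holomorphic_on {w \<in> S. G w \<noteq> 0}"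
      by (rule holomorphic_transform)
    then show ?thesis using op z Gz analytic_at by blast
  qed
  then have "?q analytic_on S" by (subst analytic_on_analytic_at) blast
  then show ?thesis by (rule analytic_imp_holomorphic)
qed

context complex_lattice
begin

text \<open>Sections, over the complement of the lattice, of the line bundle with factor of
  automorphy \<open>m\<close>, meromorphic at the lattice points.\<close>

definition quasi_per :: "(complex \<Rightarrow> complex) \<Rightarrow> (complex \<Rightarrow> complex) \<Rightarrow> bool" where
  "quasi_per m f \<longleftrightarrow> f holomorphic_on - \<Lambda> \<and> f meromorphic_on UNIV \<and>
     (\<forall>z l. z \<notin> \<Lambda> \<longrightarrow> l \<in> \<Lambda> \<longrightarrow> f (z + l) = m l * f z)"

lemma quasi_per_deriv:
  assumes f: "quasi_per m f"
  shows "quasi_per m (deriv f)"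
  unfolding quasi_per_def
proof (intro conjI allI impI)
  have holo: "f holomorphic_on - \<Lambda>" using f by (simp add: quasi_per_def)
  then show "deriv f holomorphic_on - \<Lambda>" using open_compl_\<Lambda> by (rule holomorphic_deriv)
  show "deriv f meromorphic_on UNIV"
    using f by (intro meromorphic_intros) (auto simp: quasi_per_def)
  fix z l assume z: "z \<notin> \<Lambda>" and l: "l \<in> \<Lambda>"
  have "deriv f (z + l) = deriv (\<lambda>w. f (w + l)) z"
    unfolding deriv_def by (simp only: DERIV_shift)
  also have "\<dots> = deriv (\<lambda>w. m l * f w) z"
  proof (rule deriv_cong_ev)
    have "eventually (\<lambda>w. w \<in> - \<Lambda>) (nhds z)"
      using z open_compl_\<Lambda> by (intro eventually_nhds_in_open) auto
    then show "eventually (\<lambda>w. f (w + l) = m l * f w) (nhds z)"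
      by eventually_elim (use f l in \<open>auto simp: quasi_per_def\<close>)
  qed simp
  also have "\<dots> = m l * deriv f z"
    using holo z open_compl_\<Lambda> by (intro deriv_cmult) (auto simp: holomorphic_on_imp_differentiable_at)
  finally show "deriv f (z + l) = m l * deriv f z" .
qed

text \<open>Reflection exchanges a bundle with its dual, so sections with inverse multipliers come
  for free from the one sigma quotient.\<close>

lemma quasi_per_reflect:
  assumes f: "quasi_per m f" and m: "\<And>l. l \<in> \<Lambda> \<Longrightarrow> m (- l) = inverse (m l)"
  shows "quasi_per (\<lambda>l. inverse (m l)) (\<lambda>z. f (- z))"
  unfolding quasi_per_def
proof (intro conjI allI impI)
  show "(\<lambda>z. f (- z)) holomorphic_on - \<Lambda>"
    by (rule holomorphic_on_compose_gen[of uminus _ f "- \<Lambda>", unfolded o_def])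
       (use f in \<open>auto intro!: holomorphic_intros simp: quasi_per_def\<close>)
  show "(\<lambda>z. f (- z)) meromorphic_on UNIV"
    by (rule meromorphic_on_compose[of f UNIV]) (use f in \<open>auto intro!: analytic_intros simp: quasi_per_def\<close>)
  show "f (- (z + l)) = inverse (m l) * f (- z)" if "z \<notin> \<Lambda>" "l \<in> \<Lambda>" for z l
  proof -
    have "f (- z + - l) = m (- l) * f (- z)"
      using f that unfolding quasi_per_def by (metis \<Lambda>_uminus_iff)
    then show ?thesis using m[OF that(2)] by simp
  qed
qed

lemma quasi_per_cmult: "quasi_per m f \<Longrightarrow> quasi_per m (\<lambda>z. c * f z)"
  unfolding quasi_per_def by (auto intro!: holomorphic_intros meromorphic_intros)

lemma quasi_per_zero: "quasi_per m (\<lambda>z. 0)"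
  unfolding quasi_per_def by (auto intro!: holomorphic_intros meromorphic_intros)

text \<open>With \<open>f\<close> having simple zeros on the single orbit of \<open>a\<close>, any \<open>p\<close>, \<open>s\<close> of the right type with
  \<open>p a * s a = 1\<close> complete to a unimodular matrix by setting \<open>q = (p s - 1) / f\<close> and \<open>r = f\<close>.\<close>

lemma unimodular_quasi_periodic:
  fixes k1 k2 :: complex
  obtains m p q r s where
    "\<And>i j. m (of_int i * v1 + of_int j * v2) = exp (of_int i * k1 + of_int j * k2)"
    "quasi_per (\<lambda>l. inverse (m l)) p" "quasi_per (\<lambda>l. inverse (m l)) q"
    "quasi_per m r" "quasi_per m s" "\<And>z. z \<notin> \<Lambda> \<Longrightarrow> p z * s z - q z * r z = 1"
proof -
  \<comment> \<open>Inverting the injective coordinate map turns the character into a function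
    \<open>m\<close> of the lattice point; its values off the lattice carry no meaning.\<close>
  define c where "c = inv (\<lambda>(i::int, j::int). of_int i * v1 + of_int j * v2)"
  define m where "m = (\<lambda>l. exp (of_int (fst (c l)) * k1 + of_int (snd (c l)) * k2))"
  have cl: "c (of_int i * v1 + of_int j * v2) = (i, j)" for i j
    unfolding c_def using inv_f_f[OF inj_coordinates, of "(i, j)"] by simp
  have m: "m (of_int i * v1 + of_int j * v2) = exp (of_int i * k1 + of_int j * k2)" for i j
    by (simp add: m_def cl)
  have mneg: "m (- l) = inverse (m l)" if l\<Lambda>: "l \<in> \<Lambda>" for l
  proof -
    obtain i j where l: "l = of_int i * v1 + of_int j * v2" using l\<Lambda> by (rule in_\<Lambda>E)
    have "- l = of_int (- i) * v1 + of_int (- j) * v2" by (simp add: l)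
    then have "m (- l) = exp (of_int (- i) * k1 + of_int (- j) * k2)" by (simp only: m)
    also have "\<dots> = inverse (m l)" unfolding l m by (simp flip: exp_minus)
    finally show ?thesis .
  qed
  have mnz: "m l \<noteq> 0" for l by (simp add: m_def)
  obtain f a where f: "f holomorphic_on - \<Lambda>" "f meromorphic_on UNIV"
    "\<And>z. z \<notin> \<Lambda> \<Longrightarrow> f (z + v1) = exp k1 * f z" "\<And>z. z \<notin> \<Lambda> \<Longrightarrow> f (z + v2) = exp k2 * f z"
    "\<And>z. z \<notin> \<Lambda> \<Longrightarrow> f z = 0 \<longleftrightarrow> z - a \<in> \<Lambda>" "\<And>z. z \<notin> \<Lambda> \<Longrightarrow> f z = 0 \<Longrightarrow> deriv f z \<noteq> 0"
    using quasi_periodic_simple_zeros[of k1 k2] by blast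
  have qf: "quasi_per m f"
    unfolding quasi_per_def
  proof (intro conjI allI impI f)
    fix z l assume z: "z \<notin> \<Lambda>" and "l \<in> \<Lambda>"
    then obtain i j where l: "l = of_int i * v1 + of_int j * v2" by (auto elim: in_\<Lambda>E)
    show "f (z + l) = m l * f z" unfolding l m by (rule quasi_periodic) (use f z in auto)
  qed
  show ?thesis
  proof (cases "a \<in> \<Lambda>")
    case True
    \<comment> \<open>If a is a lattice point, all zeros are hidden in the lattice and diag(1/f, f)
      is already the required matrix.\<close>
    then have nz: "f z \<noteq> 0" if "z \<notin> \<Lambda>" for z
      using f(5)[OF that] that by (simp add: \<Lambda>_diff_iff)
    have "quasi_per (\<lambda>l. inverse (m l)) (\<lambda>z. 1 / f z)"
      using qf nz unfolding quasi_per_def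
      by (auto intro!: holomorphic_intros meromorphic_intros simp: field_simps)
    then show ?thesis
      using that[of m "\<lambda>z. 1 / f z" "\<lambda>_. 0" "\<lambda>_. 0" f] m qf quasi_per_zero nz by auto
  next
    case False
    have fa: "f a = 0" "deriv f a \<noteq> 0" using f(5,6)[OF False] by auto
    define g where "g = (\<lambda>z. f (- z))"
    have qg: "quasi_per (\<lambda>l. inverse (m l)) g"
      unfolding g_def using qf mneg by (rule quasi_per_reflect)
    \<comment> \<open>The reflected function vanishes at a exactly when 2a is a lattice point. The
      zero is then simple, so its derivative, which has the same multipliers, is nonzero at
      a.\<close>
    define p0 where "p0 = (if f (- a) = 0 then deriv g else g)"
    have qp0: "quasi_per (\<lambda>l. inverse (m l)) p0"
      unfolding p0_def using qg quasi_per_deriv[OF qg] by simp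
    have p0a: "p0 a \<noteq> 0"
    proof (cases "f (- a) = 0")
      case True
      have na: "- a \<notin> \<Lambda>" using False by simp
      have "(f has_field_derivative deriv f (- a)) (at (- a))"
        using holomorphic_derivI[OF f(1) open_compl_\<Lambda>] na by blast
      then have "(g has_field_derivative deriv f (- a) * (- 1)) (at a)"
        unfolding g_def by (rule DERIV_chain2) (auto intro!: derivative_eq_intros)
      then have "deriv g a = - deriv f (- a)" by (simp add: DERIV_imp_deriv)
      then show ?thesis using True f(6)[OF na True] by (simp add: p0_def)
    next
      case False
      then show ?thesis by (simp add: p0_def g_def)
    qed
    define p where "p = (\<lambda>z. (1 / (p0 a * deriv f a)) * p0 z)"
    define n where "n = (\<lambda>z. p z * deriv f z - 1)"
    have qp: "quasi_per (\<lambda>l. inverse (m l)) p" unfolding p_def by (rule quasi_per_cmult[OF qp0])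
    have qs: "quasi_per m (deriv f)" using qf by (rule quasi_per_deriv)
    have qn: "quasi_per (\<lambda>_. 1) n"
      using qp qs mnz unfolding quasi_per_def n_def
      by (auto intro!: holomorphic_intros meromorphic_intros)
    have na: "n a = 0" using p0a fa by (simp add: n_def p_def)
    \<comment> \<open>The multipliers of \<open>p\<close> and of the derivative of f cancel in
      \<open>n\<close>, so its zero at a spreads over the whole orbit of a, that is, over all zeros
      of f.\<close>
    have n0: "n z = 0" if "z \<notin> \<Lambda>" "f z = 0" for z
    proof -
      have "z - a \<in> \<Lambda>" using f(5) that by simp
      then have "n (a + (z - a)) = n a" using qn False unfolding quasi_per_def by (metis mult_1)
      then show ?thesis using na by simp
    qed
    define q where "q = (\<lambda>z. if f z = 0 then deriv n z / deriv f z else n z / f z)"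
    have "quasi_per (\<lambda>l. inverse (m l)) q"
      unfolding quasi_per_def
    proof (intro conjI allI impI)
      show "q holomorphic_on - \<Lambda>"
        unfolding q_def by (rule holomorphic_quotient_simple_zeros[OF open_compl_\<Lambda>])
          (use qn f n0 in \<open>auto simp: quasi_per_def\<close>)
      have "(\<lambda>z. n z / f z) meromorphic_on UNIV"
        using qn f(2) by (auto intro!: meromorphic_intros simp: quasi_per_def)
      moreover have "eventually (\<lambda>w. n w / f w = q w) (at z)" for z
      proof -
        have "eventually (\<lambda>w. w - a \<notin> \<Lambda>) (at z)"
          using eventually_not_in_\<Lambda>[of "z - a"] by (simp add: at_to_0[of z] at_to_0[of "z - a"] eventually_filtermap algebra_simps)
        then show ?thesis using eventually_not_in_\<Lambda>[of z]
          by eventually_elim (use f(5) in \<open>auto simp: q_def\<close>)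
      qed
      ultimately show "q meromorphic_on UNIV"
        by (subst (asm) meromorphic_on_cong) auto
      fix z l assume z: "z \<notin> \<Lambda>" and l: "l \<in> \<Lambda>"
      have "f (z + l) = m l * f z" "deriv f (z + l) = m l * deriv f z"
        "n (z + l) = n z" "deriv n (z + l) = deriv n z"
        using qf qs qn quasi_per_deriv[OF qn] z l unfolding quasi_per_def by auto
      then show "q (z + l) = inverse (m l) * q z"
        using mnz[of l] by (simp add: q_def field_simps)
    qed
    moreover have "p z * deriv f z - q z * f z = 1" if "z \<notin> \<Lambda>" for z
      using n0[OF that] by (cases "f z = 0") (auto simp: q_def n_def)
    ultimately show ?thesis
      using that[of m p q f "deriv f"] m qp qs qf by blast
  qed
qed

end

section \<open>Automorphisms of finite order\<close>

definition m2 :: "complex \<Rightarrow> complex \<Rightarrow> complex \<Rightarrow> complex \<Rightarrow> complex^2^2" where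
  "m2 a b c d = (\<chi> i j. if i = 1 then (if j = 1 then a else b) else (if j = 1 then c else d))"

lemma m2_nth [simp]:
  "m2 a b c d $ 1 $ 1 = a" "m2 a b c d $ 1 $ 2 = b" "m2 a b c d $ 2 $ 1 = c" "m2 a b c d $ 2 $ 2 = d"
  by (simp_all add: m2_def)

lemma m2_eta: "A = m2 (A$1$1) (A$1$2) (A$2$1) (A$2$2)"
  by (simp add: vec_eq_iff forall_2)

lemma m2_eq_iff [simp]: "m2 a b c d = m2 a' b' c' d' \<longleftrightarrow> a = a' \<and> b = b' \<and> c = c' \<and> d = d'"
  by (auto simp: vec_eq_iff forall_2)

lemma m2_mult [simp]:
  "m2 a b c d ** m2 e f g h = m2 (a * e + b * g) (a * f + b * h) (c * e + d * g) (c * f + d * h)"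
  by (simp add: vec_eq_iff forall_2 matrix_matrix_mult_def sum_2)

lemma m2_add [simp]: "m2 a b c d + m2 e f g h = m2 (a + e) (b + f) (c + g) (d + h)"
  and m2_diff [simp]: "m2 a b c d - m2 e f g h = m2 (a - e) (b - f) (c - g) (d - h)"
  and msc_m2 [simp]: "msc x (m2 a b c d) = m2 (x * a) (x * b) (x * c) (x * d)"
  and tr2_m2 [simp]: "tr2 (m2 a b c d) = a + d"
  by (simp_all add: vec_eq_iff forall_2 msc_def tr2_def)

lemma m2_1: "mat 1 = m2 1 0 0 1"
  and m2_0: "0 = m2 0 0 0 0"
  by (simp_all add: vec_eq_iff forall_2 mat_def)

lemma m2_cases: obtains a b c d where "A = m2 a b c d"
  using m2_eta by blast

lemma sl2_m2 [simp]: "m2 a b c d \<in> sl2 \<longleftrightarrow> d = - a"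
  by (auto simp: sl2_def eq_neg_iff_add_eq_0 add.commute)

lemma sl2_cases:
  assumes "A \<in> sl2" obtains a b c where "A = m2 a b c (- a)"
  using assms m2_cases[of A] by (metis sl2_m2)

lemma br_m2 [simp]: "br (m2 a b c d) (m2 e f g h) =
   m2 (b * g - f * c) (a * f + b * h - (e * b + f * d)) (c * e + d * g - (g * a + h * c)) (c * f - g * b)"
  by (simp add: br_def algebra_simps)

lemma m2_inverse:
  assumes "a * d - b * c \<noteq> 0"
  obtains B where "m2 a b c d ** B = mat 1" "B ** m2 a b c d = mat 1"
proof -
  define D where "D = a * d - b * c"
  have D: "D \<noteq> 0" using assms by (simp add: D_def)
  have "a * (d / D) + b * (- c / D) = 1" "c * (- b / D) + d * (a / D) = 1"
    using D by (simp_all add: field_simps) (simp_all add: D_def algebra_simps)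
  then show ?thesis
    by (intro that[of "m2 (d / D) (- b / D) (- c / D) (a / D)"])
       (auto simp: m2_1 algebra_simps)
qed

lemma msc_matrix_mult: "msc c A ** B = msc c (A ** B)" "A ** msc c B = msc c (A ** B)"
  by (cases A rule: m2_cases; cases B rule: m2_cases; simp add: algebra_simps)+

lemma matrix_add_distribs:
  "(A + B) ** C = A ** C + B ** (C :: complex^2^2)" "A ** (B + C) = A ** B + A ** (C :: complex^2^2)"
  by (cases A rule: m2_cases; cases B rule: m2_cases; cases C rule: m2_cases; simp add: algebra_simps)+

lemma msc_add: "msc c (A + B) = msc c A + msc c B"
  and msc_add_left: "msc (c + d) A = msc c A + msc d A"
  and msc_msc: "msc c (msc d A) = msc (c * d) A"
  and msc_0 [simp]: "msc c 0 = 0"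
  and msc_0_left [simp]: "msc 0 A = 0"
  and msc_1 [simp]: "msc 1 A = A"
  by (simp_all add: vec_eq_iff msc_def algebra_simps)

lemma msc_eq_0_iff [simp]: "msc c A = 0 \<longleftrightarrow> c = 0 \<or> A = 0"
  by (auto simp: vec_eq_iff msc_def)

lemma msc_cancel: "c \<noteq> 0 \<Longrightarrow> msc c A = msc c B \<Longrightarrow> A = B"
  by (simp add: vec_eq_iff msc_def)

lemma tr2_mult_commute: "tr2 (A ** B) = tr2 (B ** A)"
  by (cases A rule: m2_cases; cases B rule: m2_cases) (simp add: algebra_simps)

lemma sl2_conj:
  assumes "Qi ** Q = mat 1" "A \<in> sl2"
  shows "Q ** A ** Qi \<in> sl2"
proof -
  have "tr2 (Q ** A ** Qi) = tr2 (Qi ** Q ** A)"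
    by (subst tr2_mult_commute) (simp add: matrix_mul_assoc)
  then show ?thesis using assms by (simp add: sl2_def)
qed

text \<open>Representation theory of sl2 in dimension two: the columns of \<open>P\<close> are a
  highest weight vector (u, v) of H and its image (f, g) under F. In this basis the three matrices
  take their standard form.\<close>

lemma sl2_triple_intertwiner:
  assumes HE: "br (m2 a b c (-a)) (m2 p q r (-p)) = msc 2 (m2 p q r (-p))"
    and HF: "br (m2 a b c (-a)) (m2 x y z (-x)) = msc (-2) (m2 x y z (-x))"
    and EF: "br (m2 p q r (-p)) (m2 x y z (-x)) = m2 a b c (-a)"
    and E: "m2 p q r (-p) \<noteq> 0"
  obtains P Pi where "P ** Pi = mat 1" "Pi ** P = mat 1"
    "m2 a b c (-a) ** P = P ** m2 1 0 0 (-1)" "m2 p q r (-p) ** P = P ** m2 0 1 0 0"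
    "m2 x y z (-x) ** P = P ** m2 0 0 1 0"
proof -
  have he: "b * r - q * c = 2 * p" "a * q - b * p = q" "c * p - a * r = r"
    using HE unfolding br_m2 msc_m2 m2_eq_iff by algebra+
  have hf: "b * z - y * c = -2 * x" "a * y - b * x = - y" "c * x - a * z = - z"
    using HF unfolding br_m2 msc_m2 m2_eq_iff by algebra+
  have ef': "q * z - y * r = a" "p * y + q * - x - (x * q + y * - p) = b" "r * x + - p * z - (z * p + - x * r) = c"
    using EF unfolding br_m2 m2_eq_iff by blast+
  have ef: "q * z - y * r = a" "2 * (p * y - q * x) = b" "2 * (r * x - p * z) = c"
    unfolding ef'(2)[symmetric] ef'(3)[symmetric] by (rule ef'(1)) (simp_all add: algebra_simps)
  have "p \<noteq> 0 \<or> q \<noteq> 0 \<or> r \<noteq> 0" using E by (auto simp: m2_0)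
  \<comment> \<open>The adjoint map of H has eigenvalues 0 and plus or minus 2 sqrt(a^2 + b c). The
    eigenvalue 2 on the nonzero E therefore forces a^2 + b c = 1.\<close>
  moreover have "(a^2 + b * c - 1) * p = 0" "(a^2 + b * c - 1) * q = 0" "(a^2 + b * c - 1) * r = 0"
    using he by algebra+
  ultimately have H2: "a^2 + b * c = 1" by auto
  \<comment> \<open>Because H^2 = 1, every nonzero column of 1 + H is an eigenvector for 1. The
    first column is (1 + a, c); if it vanishes, the second is (b, 2).\<close>
  obtain u v where uv: "u \<noteq> 0 \<or> v \<noteq> 0" "a * u + b * v = u" "c * u - a * v = v"
  proof (cases "1 + a = 0 \<and> c = 0")
    case True
    then have "a = -1" by (simp add: eq_neg_iff_add_eq_0 add.commute)
    then show ?thesis using that[of b 2] True by simp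
  next
    case False
    have "a * (1 + a) + b * c = 1 + a" "c * (1 + a) - a * c = c" using H2 by (algebra, simp add: algebra_simps)
    then show ?thesis using that[of "1 + a" c] False by blast
  qed
  \<comment> \<open>E applied to (u, v) would be an eigenvector of H for 3, impossible with H^2 = 1
    unless it is zero.\<close>
  have Eu: "p * u + q * v = 0" "r * u - p * v = 0"
    using he H2 uv(2,3) by algebra+
  define f g where fg: "f = x * u + y * v" "g = z * u - x * v"
  have Hf: "a * f + b * g = - f" "c * f - a * g = - g"
    using hf uv(2,3) unfolding fg by algebra+
  have "p * f + q * g = (x * (p * u + q * v) + y * (r * u - p * v)) + ((q * z - y * r) * u + (2 * (p * y - q * x)) * v)"
    unfolding fg by (simp add: algebra_simps)
  then have Ef1: "p * f + q * g = u" unfolding ef Eu using uv by simp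
  have "r * f - p * g = (z * (p * u + q * v) - x * (r * u - p * v)) + ((2 * (r * x - p * z)) * u - (q * z - y * r) * v)"
    unfolding fg by (simp add: algebra_simps)
  then have Ef2: "r * f - p * g = v" unfolding ef Eu using uv by simp
  note Ef = Ef1 Ef2
  have Ff: "x * f + y * g = 0" "z * f - x * g = 0"
    using hf H2 Hf fg by algebra+
  \<comment> \<open>E kills (u, v) but sends (f, g) to (u, v), so the two vectors cannot be
    proportional.\<close>
  have "u * g - f * v \<noteq> 0"
  proof
    assume "u * g - f * v = 0"
    then have "u * u = 0" "v * v = 0" using Ef Eu by algebra+
    then show False using uv(1) by simp
  qed
  then obtain Pi where "m2 u f v g ** Pi = mat 1" "Pi ** m2 u f v g = mat 1"
    by (rule m2_inverse)
  then show ?thesis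
    by (rule that) (simp_all add: uv(2,3) Eu Hf Ef Ff fg[symmetric])
qed

text \<open>A nonzero discriminant gives two distinct eigenvalues. The columns of Q are the
  eigenvectors (b, x - a) and (b, y - a), or, if b = 0, (a - d, c) and (0, 1).\<close>

lemma diagonalise_m2:
  assumes d: "a * d - b * c \<noteq> 0" and nil: "(a - d)^2 + 4 * b * c \<noteq> 0"
  obtains Q Qi x y where "Q ** Qi = mat 1" "Qi ** Q = mat 1" "x \<noteq> 0" "y \<noteq> 0"
    "m2 a b c d ** Q = Q ** m2 x 0 0 y"
proof (cases "b = 0")
  case True
  then have ad: "a - d \<noteq> 0" "a \<noteq> 0" "d \<noteq> 0" using assms by auto
  then have "(a - d) * 1 - 0 * c \<noteq> 0" by simp
  then obtain Qi where Q: "m2 (a - d) 0 c 1 ** Qi = mat 1" "Qi ** m2 (a - d) 0 c 1 = mat 1"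
    by (rule m2_inverse)
  then show ?thesis
    by (rule that[OF _ _ ad(2,3)]) (simp add: True algebra_simps)
next
  case False
  define s where "s = csqrt ((a - d)^2 + 4 * b * c)"
  have s: "s ^ 2 = (a - d)^2 + 4 * b * c" "s \<noteq> 0" using nil by (simp_all add: s_def)
  define x y where xy: "x = (a + d + s) / 2" "y = (a + d - s) / 2"
  have xy2: "2 * x = a + d + s" "2 * y = a + d - s" by (simp_all add: xy)
  have "4 * (x * y) = 4 * (a * d - b * c)" using s(1) xy2 by algebra
  then have nz: "x \<noteq> 0" "y \<noteq> 0" using d by auto
  have "b * (y - a) - b * (x - a) = - b * s" unfolding xy by (simp add: field_simps)
  then have "b * (y - a) - b * (x - a) \<noteq> 0" using False s by simp
  then obtain Qi where Q: "m2 b b (x - a) (y - a) ** Qi = mat 1" "Qi ** m2 b b (x - a) (y - a) = mat 1"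
    by (rule m2_inverse)
  have "4 * (c * b + d * (x - a)) = 4 * ((x - a) * x)" "4 * (c * b + d * (y - a)) = 4 * ((y - a) * y)"
    using s(1) xy2 by algebra+
  then have "c * b + d * (x - a) = (x - a) * x" "c * b + d * (y - a) = (y - a) * y" by algebra+
  then show ?thesis
    by (intro that[OF Q nz]) (simp add: algebra_simps)
qed

text \<open>The image of the standard triple satisfies the same bracket relations, and injectivity
  keeps the image of e nonzero. The intertwiner of the two triples then implements \<open>g\<close>
  on all of sl2 by linearity.\<close>

lemma sl2_aut_conj:
  assumes g: "sl2_aut g"
  obtains P Pi where "P ** Pi = mat 1" "Pi ** P = mat 1" "\<And>A. A \<in> sl2 \<Longrightarrow> g A ** P = P ** A"
proof -
  have bij: "bij_betw g sl2 sl2"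
    and lin: "\<And>A B c. A \<in> sl2 \<Longrightarrow> B \<in> sl2 \<Longrightarrow> g (msc c A + B) = msc c (g A) + g B"
    and lie: "\<And>A B. A \<in> sl2 \<Longrightarrow> B \<in> sl2 \<Longrightarrow> g (br A B) = br (g A) (g B)"
    using g unfolding sl2_aut_def by auto
  have cl: "g A \<in> sl2" if "A \<in> sl2" for A using bij that by (rule bij_betw_apply)
  have z: "0 \<in> sl2" by (simp add: m2_0)
  have g0: "g 0 = 0"
  proof -
    have "msc 1 (0::complex^2^2) + 0 = 0" by (simp add: m2_0)
    then have "g 0 = msc 1 (g 0) + g 0" using lin[OF z z, of 1] by simp
    also have "msc 1 (g 0) = g 0" by (cases "g 0" rule: m2_cases) simp
    finally show ?thesis by simp
  qed
  have scal: "g (msc c A) = msc c (g A)" if "A \<in> sl2" for c A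
    using lin[OF that z, of c] g0 by simp
  let ?h = "m2 1 0 0 (-1)" and ?e = "m2 0 1 0 0" and ?f = "m2 0 0 1 0"
  have mem: "?h \<in> sl2" "?e \<in> sl2" "?f \<in> sl2" by simp_all
  obtain a b c where H: "g ?h = m2 a b c (-a)" using cl[OF mem(1)] by (rule sl2_cases)
  obtain p q r where E: "g ?e = m2 p q r (-p)" using cl[OF mem(2)] by (rule sl2_cases)
  obtain x y w where F: "g ?f = m2 x y w (-x)" using cl[OF mem(3)] by (rule sl2_cases)
  have "g ?e \<noteq> 0"
  proof
    assume "g ?e = 0"
    then have "?e = 0" using bij mem(2) z g0 by (metis bij_betw_inv_into_left)
    then show False by (simp add: m2_0)
  qed
  moreover have "br (g ?h) (g ?e) = msc 2 (g ?e)"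
    using lie[OF mem(1,2)] scal[OF mem(2), of 2] by simp
  moreover have "br (g ?h) (g ?f) = msc (-2) (g ?f)"
    using lie[OF mem(1,3)] scal[OF mem(3), of "-2"] by simp
  moreover have "br (g ?e) (g ?f) = g ?h"
    using lie[OF mem(2,3)] by simp
  ultimately obtain P Pi where P: "P ** Pi = mat 1" "Pi ** P = mat 1"
    "g ?h ** P = P ** ?h" "g ?e ** P = P ** ?e" "g ?f ** P = P ** ?f"
    unfolding H E F using sl2_triple_intertwiner[of a b c p q r x y w] by metis
  have "g A ** P = P ** A" if A: "A \<in> sl2" for A
  proof -
    obtain \<alpha> \<beta> \<gamma> where A': "A = m2 \<alpha> \<beta> \<gamma> (-\<alpha>)" using A by (rule sl2_cases)
    have A'': "A = msc \<alpha> ?h + (msc \<beta> ?e + msc \<gamma> ?f)" by (simp add: A')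
    have "g A = msc \<alpha> (g ?h) + (msc \<beta> (g ?e) + msc \<gamma> (g ?f))"
      unfolding A'' by (subst lin, simp, simp, subst lin, simp, simp, subst scal, simp_all)
    then show ?thesis
      by (simp only: A'' matrix_add_distribs msc_matrix_mult P)
  qed
  then show ?thesis using that P by blast
qed

text \<open>A finite-order automorphism is conjugation by a matrix that cannot be a nontrivial Jordan block:
  otherwise some \<open>A\<close> would satisfy \<open>g A = A + k n\<close> with \<open>n \<noteq> 0\<close> fixed by \<open>g\<close> and \<open>k \<noteq> 0\<close>.\<close>

lemma sl2_aut_finite_order:
  assumes g: "sl2_aut g" and N: "N \<ge> 1" "\<And>A. A \<in> sl2 \<Longrightarrow> (g ^^ N) A = A"
  obtains Q Qi x where "Q ** Qi = mat 1" "Qi ** Q = mat 1" "x \<noteq> 0"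
    "\<And>a b c. g (Q ** m2 a b c (-a) ** Qi) = Q ** m2 a (b / x) (x * c) (-a) ** Qi"
proof -
  obtain P Pi where P: "P ** Pi = mat 1" "Pi ** P = mat 1" "\<And>A. A \<in> sl2 \<Longrightarrow> g A ** P = P ** A"
    using sl2_aut_conj[OF g] by blast
  have gP: "g A = P ** A ** Pi" if "A \<in> sl2" for A
    using P(3)[OF that] P(1) by (metis matrix_mul_assoc matrix_mul_rid)
  obtain a b c d where Pm: "P = m2 a b c d" by (rule m2_cases)
  obtain a' b' c' d' where Pim: "Pi = m2 a' b' c' d'" by (rule m2_cases)
  have "(a * d - b * c) * (a' * d' - b' * c') = 1"
    using P(1) unfolding Pm Pim m2_1 m2_mult m2_eq_iff by algebra
  then have det: "a * d - b * c \<noteq> 0" by auto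
  have "\<exists>Q Qi x y. Q ** Qi = mat 1 \<and> Qi ** Q = mat 1 \<and> x \<noteq> 0 \<and> y \<noteq> 0 \<and> P ** Q = Q ** m2 x 0 0 y"
  proof (cases "(a - d)^2 + 4 * b * c = 0")
    case False
    then show ?thesis using diagonalise_m2[OF det] unfolding Pm by metis
  next
    case True
    show ?thesis
    proof (cases "b = 0 \<and> c = 0")
      case bc: True
      then have "a = d" using True by simp
      then show ?thesis using bc det
        by (intro exI[of _ "m2 1 0 0 1"] exI[of _ a] exI[of _ d]) (auto simp: Pm m2_1)
    next
      case bc: False
      \<comment> \<open>Twice the traceless part of \<open>P\<close>. Its square is zero because the
        discriminant of \<open>P\<close> vanishes.\<close>
      define n where "n = m2 (a - d) (2 * b) (2 * c) (- (a - d))"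
      have n: "n \<in> sl2" "n \<noteq> 0" using bc by (auto simp: n_def m2_0)
      define t where "t = a + d"
      have nn: "n ** n = 0" using True by (simp add: n_def m2_0 algebra_simps power2_eq_square)
      have tn: "msc 2 P = msc t (mat 1) + n" by (simp add: Pm n_def t_def m2_1)
      have t0: "t \<noteq> 0"
      proof
        assume "t = 0"
        then have "4 * (a * d - b * c) = 0" using True unfolding t_def by algebra
        then show False using det by simp
      qed
      obtain A l where A: "A \<in> sl2" "l \<noteq> 0" "n ** A - A ** n = msc l n"
      proof (cases "b = 0")
        case b0: True
        then have "a = d" using True by simp
        then show ?thesis using that[of "m2 1 0 0 (-1)" 2] b0 by (simp add: n_def)
      next
        case False
        \<comment> \<open>The vector (2b, d - a) spans the kernel and the image of n. This
          \<open>k\<close> makes it an eigenvector of the matrix below for 1; as the other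
          eigenvalue is -1, the commutator is -2 n.\<close>
        define k where "k = - (a - d) / b"
        have kb: "k * b = - (a - d)" using False by (simp add: k_def)
        have "b * ((a - d) * k) = b * (4 * c)"
          using kb True by algebra
        then have ck: "(a - d) * k = 4 * c" using False by simp
        have "n ** m2 1 0 k (-1) - m2 1 0 k (-1) ** n = msc (-2) n"
          unfolding n_def m2_mult m2_diff msc_m2 m2_eq_iff 
        proof (intro conjI)
          show "(a - d) * 1 + 2 * b * k - (1 * (a - d) + 0 * (2 * c)) = - 2 * (a - d)" using kb by algebra
          show "2 * c * 1 + - (a - d) * k - (k * (a - d) + - 1 * (2 * c)) = - 2 * (2 * c)" using ck by algebra
          show "2 * c * 0 + - (a - d) * - 1 - (k * (2 * b) + - 1 * - (a - d)) = - 2 * - (a - d)" using kb by algebra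
        qed simp
        then show ?thesis using that[of "m2 1 0 k (-1)" "-2"] by simp
      qed
      have fix_n: "g n = n"
      proof -
        have "msc 2 (P ** n) = msc 2 P ** n" by (simp only: msc_matrix_mult)
        also have "\<dots> = n ** msc 2 P" unfolding tn by (simp add: matrix_add_distribs msc_matrix_mult)
        also have "\<dots> = msc 2 (n ** P)" by (simp only: msc_matrix_mult)
        finally have "P ** n = n ** P" by (rule msc_cancel[rotated]) simp
        then show ?thesis using gP[OF n(1)] P(1) by (metis matrix_mul_assoc matrix_mul_rid)
      qed
      \<comment> \<open>From 2P = t + n, n^2 = 0 and the commutator relation, conjugation by
        \<open>P\<close> adds l/t times n to A.\<close>
      define k where "k = l / t"
      have k: "k \<noteq> 0" "t * k = l" using A(2) t0 by (simp_all add: k_def)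
      have gA: "g A = A + msc k n"
      proof -
        have nA: "n ** A = A ** n + msc l n" using A(3) by (simp add: algebra_simps)
        have "msc 2 (P ** A) = (msc t (mat 1) + n) ** A" by (simp only: msc_matrix_mult flip: tn)
        also have "\<dots> = msc t A + (A ** n + msc l n)"
          by (simp add: matrix_add_distribs msc_matrix_mult nA)
        also have "\<dots> = (A + msc k n) ** (msc t (mat 1) + n)"
          using nn k by (simp add: matrix_add_distribs msc_matrix_mult msc_add msc_msc add_ac)
        also have "\<dots> = msc 2 ((A + msc k n) ** P)" by (simp only: msc_matrix_mult flip: tn)
        finally have "P ** A = (A + msc k n) ** P" by (rule msc_cancel[rotated]) simp
        then have "P ** A ** Pi = A + msc k n"
          using P(1) by (metis matrix_mul_assoc matrix_mul_rid)
        then show ?thesis using gP[OF A(1)] by simp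
      qed
      have iter: "(g ^^ j) A = A + msc (of_nat j * k) n" for j
      proof (induction j)
        case 0
        then show ?case by simp
      next
        case (Suc j)
        have "(g ^^ Suc j) A = g (msc (of_nat j * k) n + A)" using Suc by (simp add: add.commute)
        also have "\<dots> = msc (of_nat j * k) (g n) + g A"
          using g n(1) A(1) unfolding sl2_aut_def by blast
        also have "\<dots> = A + msc (of_nat (Suc j) * k) n"
          unfolding fix_n gA by (simp add: distrib_right msc_add_left add_ac)
        finally show ?case .
      qed
      have "msc (of_nat N * k) n = 0" using iter[of N] N(2)[OF A(1)] by simp
      then show ?thesis using n(2) k N(1) by simp
    qed
  qed
  then obtain Q Qi x y where Q: "Q ** Qi = mat 1" "Qi ** Q = mat 1" "x \<noteq> 0" "y \<noteq> 0" "P ** Q = Q ** m2 x 0 0 y"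
    by blast
  \<comment> \<open>Conjugation by diag(x, y) depends only on the ratio of the eigenvalues; y/x is
    the number called \<open>x\<close> in the conclusion.\<close>
  have "g (Q ** m2 \<alpha> \<beta> \<gamma> (-\<alpha>) ** Qi) = Q ** m2 \<alpha> (\<beta> / (y / x)) ((y / x) * \<gamma>) (-\<alpha>) ** Qi" for \<alpha> \<beta> \<gamma>
  proof -
    define A where "A = m2 \<alpha> \<beta> \<gamma> (-\<alpha>)"
    have tr: "Q ** A ** Qi \<in> sl2" by (rule sl2_conj[OF Q(2)]) (simp add: A_def)
    have "g (Q ** A ** Qi) ** (Q ** m2 x 0 0 y) = P ** (Q ** A ** Qi) ** Q"
      using P(3)[OF tr] Q(5) by (metis matrix_mul_assoc)
    also have "\<dots> = P ** Q ** A"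
      using Q(2) by (metis matrix_mul_assoc matrix_mul_rid)
    also have "\<dots> = Q ** (m2 x 0 0 y ** A)"
      using Q(5) by (simp add: matrix_mul_assoc)
    finally have 1: "g (Q ** A ** Qi) ** (Q ** m2 x 0 0 y) = Q ** (m2 x 0 0 y ** A)" .
    have "(Q ** m2 x 0 0 y) ** (m2 (1/x) 0 0 (1/y) ** Qi) = Q ** (m2 x 0 0 y ** m2 (1/x) 0 0 (1/y)) ** Qi"
      by (simp only: matrix_mul_assoc)
    also have "\<dots> = mat 1" using Q by (simp add: m2_1[symmetric])
    finally have 2: "(Q ** m2 x 0 0 y) ** (m2 (1/x) 0 0 (1/y) ** Qi) = mat 1" .
    have "g (Q ** A ** Qi) = g (Q ** A ** Qi) ** ((Q ** m2 x 0 0 y) ** (m2 (1/x) 0 0 (1/y) ** Qi))"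
      unfolding 2 by simp
    also have "\<dots> = Q ** (m2 x 0 0 y ** A) ** (m2 (1/x) 0 0 (1/y) ** Qi)"
      by (subst matrix_mul_assoc) (simp only: 1)
    also have "\<dots> = Q ** (m2 x 0 0 y ** A ** m2 (1/x) 0 0 (1/y)) ** Qi"
      by (simp only: matrix_mul_assoc)
    also have "m2 x 0 0 y ** A ** m2 (1/x) 0 0 (1/y) = m2 \<alpha> (\<beta> / (y / x)) ((y / x) * \<gamma>) (-\<alpha>)"
      using Q(3,4) by (simp add: A_def)
    finally show ?thesis by (simp add: A_def)
  qed
  then show ?thesis using that[OF Q(1,2), of "y / x"] Q(3,4) by simp
qed

text \<open>The homomorphism law makes \<open>\<rho> 0\<close> idempotent, and it is injective on
  sl2.\<close>

lemma inj_hom_aut_0: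
  assumes \<rho>: "inj_hom_aut N \<rho>" and N: "N \<ge> 1" and A: "A \<in> sl2"
  shows "\<rho> 0 A = A"
proof -
  have bij: "bij_betw (\<rho> 0) sl2 sl2" using \<rho> N unfolding inj_hom_aut_def sl2_aut_def by auto
  have "\<rho> ((0 + 0) mod N) A = \<rho> 0 (\<rho> 0 A)"
    using \<rho> N A unfolding inj_hom_aut_def by (metis less_eq_Suc_le One_nat_def)
  then have "\<rho> 0 (\<rho> 0 A) = \<rho> 0 A" by simp
  then show ?thesis using bij A by (metis bij_betw_apply bij_betw_inv_into_left)
qed

text \<open>The eigenvalue is handed on through a logarithm \<open>t\<close> because a square root
  of the resulting character is needed later; it is obtained by halving \<open>t\<close>.\<close>

lemma cyclic_action_diagonal:
  assumes "inj_hom_aut N \<rho>" and N: "N \<ge> 1"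
  obtains Q Qi t where "Q ** Qi = mat 1" "Qi ** Q = mat 1" "exp (of_nat N * t) = (1::complex)"
    "\<And>i a b c. i < N \<Longrightarrow> \<rho> i (Q ** m2 a b c (-a) ** Qi) =
       Q ** m2 a (b / exp (of_nat i * t)) (exp (of_nat i * t) * c) (-a) ** Qi"
proof -
  have aut: "sl2_aut (\<rho> i)" if "i < N" for i
    using assms(1) that unfolding inj_hom_aut_def by blast
  have hom: "\<rho> ((i + j) mod N) A = \<rho> i (\<rho> j A)" if "i < N" "j < N" "A \<in> sl2" for i j A
    using assms(1) that unfolding inj_hom_aut_def by blast
  have cl: "\<rho> i A \<in> sl2" if "i < N" "A \<in> sl2" for i A
    using aut[OF that(1)] that(2) unfolding sl2_aut_def by (meson bij_betw_apply)
  note id = inj_hom_aut_0[OF assms]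
  \<comment> \<open>For N = 1 the index \<open>1 mod N\<close> is 0, so the trivial group is covered
    as well.\<close>
  define g where "g = \<rho> (1 mod N)"
  have g: "sl2_aut g" unfolding g_def using N by (intro aut) auto
  have iter: "(g ^^ i) A = \<rho> i A" if "A \<in> sl2" "i < N" for A i
    using that(2)
  proof (induction i)
    case 0
    then show ?case using id that by simp
  next
    case (Suc i)
    then have "\<rho> ((1 mod N + i) mod N) A = g (\<rho> i A)"
      unfolding g_def using that by (intro hom) auto
    then show ?case using Suc by simp
  qed
  have order: "(g ^^ N) A = A" if "A \<in> sl2" for A
  proof -
    have "(g ^^ N) A = g ((g ^^ (N - 1)) A)"
      using N by (cases N) auto
    also have "\<dots> = \<rho> ((1 mod N + (N - 1)) mod N) A"
      using iter[OF that, of "N - 1"] N that hom[of "1 mod N" "N - 1" A] by (simp add: g_def)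
    also have "(1 mod N + (N - 1)) mod N = 0" using N by (simp add: mod_add_left_eq)
    finally show ?thesis using id that by simp
  qed
  obtain Q Qi x where Q: "Q ** Qi = mat 1" "Qi ** Q = mat 1" "x \<noteq> 0"
    "\<And>a b c. g (Q ** m2 a b c (-a) ** Qi) = Q ** m2 a (b / x) (x * c) (-a) ** Qi"
    using sl2_aut_finite_order[OF g N order] by metis
  have it: "(g ^^ i) (Q ** m2 a b c (-a) ** Qi) = Q ** m2 a (b / x ^ i) (x ^ i * c) (-a) ** Qi" for i a b c
    by (induction i) (simp_all add: Q(4) mult_ac)
  have mem: "Q ** m2 a b c (-a) ** Qi \<in> sl2" for a b c
    by (rule sl2_conj[OF Q(2)]) simp
  \<comment> \<open>Testing the N-th iterate on the lower nilpotent matrix shows that x is an N-th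
    root of unity.\<close>
  have "Q ** m2 0 0 (x ^ N) 0 ** Qi = Q ** m2 0 0 1 0 ** Qi"
    using it[of N 0 0 1] order[OF mem, of 0 0 1] by simp
  then have "Qi ** (Q ** m2 0 0 (x ^ N) 0 ** Qi) ** Q = Qi ** (Q ** m2 0 0 1 0 ** Qi) ** Q" by simp
  moreover have "Qi ** (Q ** A ** Qi) ** Q = A" for A
    using Q(2) by (metis matrix_mul_assoc matrix_mul_lid matrix_mul_rid)
  ultimately have "x ^ N = 1" by (metis m2_eq_iff)
  have xt: "exp (of_nat i * Ln x) = x ^ i" for i
    using Q(3) by (simp add: exp_of_nat_mult)
  show ?thesis
  proof (rule that[OF Q(1,2), of "Ln x"])
    show "exp (of_nat N * Ln x) = 1" using xt \<open>x ^ N = 1\<close> by simp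
    show "\<rho> i (Q ** m2 a b c (-a) ** Qi) =
       Q ** m2 a (b / exp (of_nat i * Ln x)) (exp (of_nat i * Ln x) * c) (-a) ** Qi" if "i < N" for i a b c
      using iter[OF mem that] it[of i] by (simp add: xt)
  qed
qed

section \<open>The lattice generated by the translations\<close>

text \<open>The generators come from the Hermite normal form of the coordinates with respect to
  \<open>w1 / N\<close>, \<open>w2 / N\<close>.\<close>

lemma superlattice_gens:
  assumes w: "lattice_gens w1 w2" and N: "N \<ge> (1::nat)"
    and S: "lattice w1 w2 \<subseteq> S" "\<And>x y. x \<in> S \<Longrightarrow> y \<in> S \<Longrightarrow> x - y \<in> S"
      "\<And>x. x \<in> S \<Longrightarrow> of_nat N * x \<in> lattice w1 w2"
  obtains v1 v2 where "lattice_gens v1 v2" "S = lattice v1 v2"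
proof -
  have S0: "0 \<in> S" using S(1) by auto
  have neg: "- x \<in> S" if "x \<in> S" for x using S(2)[OF S0 that] by simp
  have add: "x + y \<in> S" if "x \<in> S" "y \<in> S" for x y
    using S(2)[OF that(1) neg[OF that(2)]] by simp
  have nmul: "of_nat k * x \<in> S" if "x \<in> S" for k x
    by (induction k) (auto simp: S0 algebra_simps intro!: add that)
  have imul: "of_int k * x \<in> S" if "x \<in> S" for k x
  proof (cases k)
    case (nonneg n)
    then show ?thesis using nmul[OF that, of n] by simp
  next
    case (neg n)
    then have "of_int k = (- of_nat (Suc n) :: complex)" by simp
    then have "of_int k * x = - (of_nat (Suc n) * x)" by (simp only: mult_minus_left)
    then show ?thesis using \<open>\<And>x. x \<in> S \<Longrightarrow> - x \<in> S\<close>[OF nmul[OF that, of "Suc n"]] by metis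
  qed
  define u where "u = (\<lambda>(m::int) (n::int). (of_int m * w1 + of_int n * w2) / of_nat N)"
  have N0: "(of_nat N :: complex) \<noteq> 0" using N by simp
  have u_diff: "u m n - of_int k * u m' n' = u (m - k * m') (n - k * n')" for m n k m' n'
    using N0 by (simp add: u_def field_simps)
  have uN: "u (int N) 0 \<in> S" "u 0 (int N) \<in> S"
    using S(1) N0 by (auto simp: u_def)
  have Sx: "\<exists>m n. x = u m n" if x: "x \<in> S" for x
  proof -
    obtain m n where "of_nat N * x = of_int m * w1 + of_int n * w2"
      using S(3)[OF x] unfolding lattice_def by auto
    then have "x = u m n" using N0 by (simp add: u_def field_simps)
    then show ?thesis by blast
  qed
  \<comment> \<open>\<open>d\<close> will be the least positive \<open>w2\<close>-coordinate
    occurring in S, in units of w2/N, and \<open>e\<close> the least positive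
    \<open>w1\<close>-coordinate among points with vanishing \<open>w2\<close>-coordinate. Division
    with remainder by \<open>d\<close>, then by \<open>e\<close>, reaches every point.\<close>
  define P where "P = (\<lambda>d::nat. d > 0 \<and> (\<exists>m. u m (int d) \<in> S))"
  have "P N" using uN N by (auto simp: P_def)
  define d where "d = (LEAST d. P d)"
  have d: "P d" "\<And>k. P k \<Longrightarrow> d \<le> k" unfolding d_def using \<open>P N\<close> by (auto intro: LeastI Least_le)
  obtain m0 where m0: "d > 0" "u m0 (int d) \<in> S" using d(1) by (auto simp: P_def)
  define R where "R = (\<lambda>e::nat. e > 0 \<and> u (int e) 0 \<in> S)"
  have "R N" using uN N by (auto simp: R_def)
  define e where "e = (LEAST e. R e)"
  have e: "R e" "\<And>k. R k \<Longrightarrow> e \<le> k" unfolding e_def using \<open>R N\<close> by (auto intro: LeastI Least_le)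
  then have e0: "e > 0" "u (int e) 0 \<in> S" by (auto simp: R_def)
  define v1 v2 where v: "v1 = u (int e) 0" "v2 = u m0 (int d)"
  have "S = lattice v1 v2"
  proof
    show "lattice v1 v2 \<subseteq> S"
      unfolding lattice_def using imul add e0 m0 by (auto simp: v)
    show "S \<subseteq> lattice v1 v2"
    proof
      fix x assume x: "x \<in> S"
      then obtain m n where mn: "x = u m n" using Sx by blast
      define k where "k = n div int d"
      have y: "u (m - k * m0) (n mod int d) \<in> S"
      proof -
        have "x - of_int k * v2 \<in> S" using S(2) x imul m0 v by auto
        moreover have "n - k * int d = n mod int d" by (simp add: k_def minus_div_mult_eq_mod)
        ultimately show ?thesis unfolding mn v u_diff by simp
      qed
      have n0: "n mod int d = 0"
      proof (rule ccontr)
        assume ne: "n mod int d \<noteq> 0"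
        have b: "0 \<le> n mod int d" "n mod int d < int d" using m0 by auto
        then have "P (nat (n mod int d))" using y ne by (auto simp: P_def)
        then have "d \<le> nat (n mod int d)" by (rule d(2))
        then show False using b by linarith
      qed
      define k' where "k' = (m - k * m0) div int e"
      have y': "u ((m - k * m0) mod int e) 0 \<in> S"
      proof -
        have "u (m - k * m0) 0 - of_int k' * v1 \<in> S" using S(2) y n0 imul e0 v by auto
        moreover have "(m - k * m0) - k' * int e = (m - k * m0) mod int e" by (simp add: k'_def minus_div_mult_eq_mod)
        ultimately show ?thesis unfolding v u_diff by simp
      qed
      have m0': "(m - k * m0) mod int e = 0"
      proof (rule ccontr)
        assume ne: "(m - k * m0) mod int e \<noteq> 0"
        have b: "0 \<le> (m - k * m0) mod int e" "(m - k * m0) mod int e < int e" using e0 by auto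
        then have "R (nat ((m - k * m0) mod int e))" using y' ne by (auto simp: R_def)
        then have "e \<le> nat ((m - k * m0) mod int e)" by (rule e(2))
        then show False using b by linarith
      qed
      have eqs: "n = k * int d" "m - k * m0 = k' * int e"
        using n0 m0' by (auto simp: k_def k'_def)
      have "x - of_int k * v2 - of_int k' * v1 = u (m - k * m0 - k' * int e) (n - k * int d - k' * 0)"
        unfolding mn v u_diff ..
      also have "\<dots> = 0" using eqs by (simp add: u_def)
      finally have "x = of_int k' * v1 + of_int k * v2" by (simp add: algebra_simps)
      then show "x \<in> lattice v1 v2" unfolding lattice_def by blast
    qed
  qed
  moreover have "lattice_gens v1 v2"
  proof -
    have w10: "w1 \<noteq> 0" and im: "Im (w2 / w1) \<noteq> 0" using w by (auto simp: lattice_gens_def)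
    have "v1 \<noteq> 0" using w10 e0 N by (simp add: v u_def)
    moreover have aux: "Im (of_real a + of_real b * x) = b * Im x" for a b :: real and x :: complex
      by simp
    have "v2 / v1 = of_real (of_int m0 / of_nat e) + of_real (of_nat d / of_nat e) * (w2 / w1)"
      using w10 e0 N0 by (simp add: v u_def field_simps)
    then have "Im (v2 / v1) = of_nat d / of_nat e * Im (w2 / w1)"
      by (simp only: aux)
    then have "Im (v2 / v1) \<noteq> 0" using im m0 e0 by simp
    ultimately show ?thesis by (simp add: lattice_gens_def)
  qed
  ultimately show ?thesis using that by blast
qed

text \<open>Modulo L the translations are the multiples of the image \<open>s\<close> of a
  generator, and injectivity makes its order exactly N. The last form of the singular set displays
  it as a group, which is what \<open>superlattice_gens\<close> requires.\<close>

lemma inj_hom_transl_generator: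
  assumes \<sigma>: "inj_hom_transl N L \<sigma>" and N: "N \<ge> 1" and L: "L = lattice w1 w2"
  defines "s \<equiv> \<sigma> (1 mod N)"
  shows "\<And>i. i < N \<Longrightarrow> \<sigma> i - of_nat i * s \<in> L" "of_nat N * s \<in> L"
    "\<And>k. of_int k * s \<in> L \<Longrightarrow> int N dvd k"
    "sing_set N L \<sigma> = {of_int k * s + w | k w. w \<in> L}"
proof -
  have hom: "\<sigma> ((i + j) mod N) - (\<sigma> i + \<sigma> j) \<in> L" if "i < N" "j < N" for i j
    using \<sigma> that unfolding inj_hom_transl_def by blast
  have inj: "\<sigma> i - \<sigma> j \<notin> L" if "i < N" "j < N" "i \<noteq> j" for i j
    using \<sigma> that unfolding inj_hom_transl_def by blast
  note add = lattice_add[of _ w1 w2, folded L] and diff = lattice_diff[of _ w1 w2, folded L]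
    and neg = lattice_uminus[of _ w1 w2, folded L]
  have \<sigma>0: "\<sigma> 0 \<in> L" using neg[OF hom[of 0 0]] N by simp
  show mult: "\<sigma> i - of_nat i * s \<in> L" if "i < N" for i
    using that
  proof (induction i)
    case 0
    then show ?case using \<sigma>0 by simp
  next
    case (Suc i)
    then have "\<sigma> (Suc i) - (\<sigma> i + s) \<in> L"
      using hom[of i "1 mod N"] by (simp add: s_def)
    then have "(\<sigma> (Suc i) - (\<sigma> i + s)) + (\<sigma> i - of_nat i * s) \<in> L"
      using Suc by (intro add) auto
    then show ?case by (simp add: algebra_simps)
  qed
  show Ns: "of_nat N * s \<in> L"
  proof -
    have "(N - 1 + 1 mod N) mod N = 0" using N by (simp add: mod_add_right_eq)
    then have *: "\<sigma> 0 - (\<sigma> (N - 1) + s) \<in> L"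
      using hom[of "N - 1" "1 mod N"] N by (simp add: s_def)
    have "\<sigma> 0 - (\<sigma> 0 - (\<sigma> (N - 1) + s)) - (\<sigma> (N - 1) - of_nat (N - 1) * s) \<in> L"
      by (rule diff[OF diff[OF \<sigma>0 *] mult]) (use N in auto)
    also have "\<sigma> 0 - (\<sigma> 0 - (\<sigma> (N - 1) + s)) - (\<sigma> (N - 1) - of_nat (N - 1) * s) = of_nat N * s"
      using N by (simp add: of_nat_diff algebra_simps)
    finally show ?thesis .
  qed
  note imul = lattice_int_mult[of _ w1 w2, folded L]
  have red: "of_int k * s - of_nat (nat (k mod int N)) * s \<in> L" for k
  proof -
    have "of_int k = of_int (k div int N) * of_nat N + of_nat (nat (k mod int N)) * (1::complex)"
    proof -
      have "k = (k div int N) * int N + int (nat (k mod int N))" using N by simp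
      then have "of_int k = (of_int ((k div int N) * int N + int (nat (k mod int N))) :: complex)" by simp
      then show ?thesis by simp
    qed
    then have "of_int k * s - of_nat (nat (k mod int N)) * s = of_int (k div int N) * (of_nat N * s)"
      by (simp add: algebra_simps)
    then show ?thesis using imul[OF Ns] by simp
  qed
  have lt: "nat (k mod int N) < N" for k using N by (simp add: nat_less_iff)
  show "int N dvd k" if "of_int k * s \<in> L" for k
  proof (rule ccontr)
    assume nd: "\<not> int N dvd k"
    \<comment> \<open>If k s lies in L, then so does \<open>\<sigma> i\<close> for the residue i of
      k. Since \<open>\<sigma> 0\<close> is in L too, injectivity leaves only i = 0.\<close>
    define i where "i = nat (k mod int N)"
    have "i \<noteq> 0" using nd N unfolding i_def by (metis dvd_eq_mod_eq_0 nat_eq_iff2 lt nat_mod_distrib of_nat_0_less_iff pos_mod_sign le_zero_eq not_gr0 of_nat_0 nat_0_le less_le_trans zero_less_one)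
    moreover have "\<sigma> i \<in> L"
      using add[OF diff[OF that red[of k]] mult[OF lt[of k]]] by (simp add: i_def)
    ultimately show False using inj[of i 0] diff[OF _ \<sigma>0] lt[of k] N by (auto simp: i_def)
  qed
  show "sing_set N L \<sigma> = {of_int k * s + w | k w. w \<in> L}"
  proof safe
    fix x assume "x \<in> sing_set N L \<sigma>"
    then obtain i w where iw: "x = \<sigma> i + w" "i < N" "w \<in> L" unfolding sing_set_def by auto
    have "x = of_int (int i) * s + ((\<sigma> i - of_nat i * s) + w)" using iw by simp
    then show "\<exists>k w. x = of_int k * s + w \<and> w \<in> L"
      using add[OF mult[OF iw(2)] iw(3)] by blast
  next
    fix k w assume w: "w \<in> L"
    define i where "i = nat (k mod int N)"
    have "of_int k * s + w = \<sigma> i + ((of_int k * s - of_nat i * s) - (\<sigma> i - of_nat i * s) + w)" by simp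
    moreover have "(of_int k * s - of_nat i * s) - (\<sigma> i - of_nat i * s) + w \<in> L"
      using add[OF diff[OF red[of k] mult[OF lt[of k]]] w] by (simp add: i_def)
    ultimately show "of_int k * s + w \<in> sing_set N L \<sigma>"
      unfolding sing_set_def using lt[of k] unfolding i_def[symmetric] by blast
  qed
qed

section \<open>Trivialising the action\<close>

lemma exp_int_multiple:
  assumes "exp (of_nat N * t) = (1::complex)" "int N dvd k"
  shows "exp (of_int k * t) = 1"
proof -
  obtain j where j: "k = int N * j" using assms(2) by (rule dvdE)
  have pos: "exp (of_nat n * (of_nat N * t)) = 1" for n
    using assms(1) by (simp only: exp_of_nat_mult power_one)
  show ?thesis
  proof (cases j)
    case (nonneg n)
    then have "of_int k * t = of_nat n * (of_nat N * t)" by (simp add: j)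
    then show ?thesis by (simp only: pos)
  next
    case (neg n)
    have "of_int k * t = of_int j * (of_nat N * t)" by (simp add: j)
    also have "of_int j = (- of_nat (Suc n) :: complex)" using neg by simp
    finally have "of_int k * t = - (of_nat (Suc n) * (of_nat N * t))" by (simp only: mult_minus_left)
    then show ?thesis using pos[of "Suc n"] by (simp only: exp_minus inverse_1)
  qed
qed

context complex_lattice
begin

definition regular :: "(complex \<Rightarrow> complex) \<Rightarrow> bool" where
  "regular f \<longleftrightarrow> f holomorphic_on - \<Lambda> \<and> f meromorphic_on UNIV"

definition regular_mat :: "(complex \<Rightarrow> complex^2^2) \<Rightarrow> bool" where
  "regular_mat X \<longleftrightarrow> (\<forall>i j. regular (\<lambda>z. X z $ i $ j))"

lemma regular_const: "regular (\<lambda>_. c)"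
  and regular_add: "regular f \<Longrightarrow> regular g \<Longrightarrow> regular (\<lambda>z. f z + g z)"
  and regular_mult: "regular f \<Longrightarrow> regular g \<Longrightarrow> regular (\<lambda>z. f z * g z)"
  and regular_uminus: "regular f \<Longrightarrow> regular (\<lambda>z. - f z)"
  unfolding regular_def by (auto intro!: holomorphic_intros meromorphic_intros)

text \<open>Supplies the normalisation of \<open>O_TT\<close> to the value 0 at the poles: altering
  a function on a discrete closed set affects neither property.\<close>

lemma regular_restrict:
  assumes "regular f"
  shows "regular (\<lambda>z. if z \<in> - \<Lambda> then f z else 0)"
  unfolding regular_def
proof
  have "f holomorphic_on - \<Lambda>" using assms by (simp add: regular_def)
  then show "(\<lambda>z. if z \<in> - \<Lambda> then f z else 0) holomorphic_on - \<Lambda>"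
    by (rule holomorphic_transform) auto
  have "eventually (\<lambda>w. f w = (if w \<in> - \<Lambda> then f w else 0)) (at z)" for z
    using eventually_not_in_\<Lambda>[of z] by eventually_elim auto
  then have "f meromorphic_on UNIV \<longleftrightarrow> (\<lambda>z. if z \<in> - \<Lambda> then f z else 0) meromorphic_on UNIV"
    by (intro meromorphic_on_cong) auto
  then show "(\<lambda>z. if z \<in> - \<Lambda> then f z else 0) meromorphic_on UNIV"
    using assms by (simp add: regular_def)
qed

lemma regular_mat_m2:
  "regular_mat (\<lambda>z. m2 (a z) (b z) (c z) (d z)) \<longleftrightarrow> regular a \<and> regular b \<and> regular c \<and> regular d"
  by (simp add: regular_mat_def forall_2)

lemma regular_mat_const: "regular_mat (\<lambda>_. A)"
  by (simp add: regular_mat_def regular_const)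

lemma regular_mat_mult:
  assumes "regular_mat X" "regular_mat Y"
  shows "regular_mat (\<lambda>z. X z ** Y z)"
  using assms unfolding regular_mat_def matrix_matrix_mult_def
  by (auto simp: sum_2 intro!: regular_add regular_mult)

lemma regular_mat_restr:
  assumes "regular_mat X"
  shows "regular_mat (restr (- \<Lambda>) X)"
proof -
  have "(\<lambda>z. restr (- \<Lambda>) X z $ i $ j) = (\<lambda>z. if z \<in> - \<Lambda> then X z $ i $ j else 0)" for i j
    by (auto simp: restr_def)
  then show ?thesis using assms regular_restrict unfolding regular_mat_def by simp
qed

text \<open>After diagonalising the action, the element \<open>i\<close> of the group conjugates by \<open>diag(1, e\<^sup>i\<^sup>t)\<close>. The rows of the quasi-periodic
  matrix have multipliers \<open>1 / m\<close> and \<open>m\<close> with \<open>m\<^sup>2 = e\<^sup>i\<^sup>t\<close>, so translation changes it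
  by this diagonal matrix up to a scalar, which conjugation does not see.\<close>

lemma trivialisation:
  fixes \<rho> :: "nat \<Rightarrow> complex^2^2 \<Rightarrow> complex^2^2"
  assumes N: "N \<ge> 1" and \<rho>: "inj_hom_aut N \<rho>" and \<sigma>: "inj_hom_transl N L \<sigma>"
    and L: "L = lattice w1 w2" and S: "sing_set N L \<sigma> = \<Lambda>"
  obtains G Gi where "regular_mat G" "regular_mat Gi"
    "\<And>z. z \<notin> \<Lambda> \<Longrightarrow> G z ** Gi z = mat 1" "\<And>z. z \<notin> \<Lambda> \<Longrightarrow> Gi z ** G z = mat 1"
    "\<And>z i w A. z \<notin> \<Lambda> \<Longrightarrow> i < N \<Longrightarrow> w \<in> L \<Longrightarrow> A \<in> sl2 \<Longrightarrow>
       \<rho> i (G (z - (\<sigma> i + w)) ** A ** Gi (z - (\<sigma> i + w))) = G z ** A ** Gi z"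
proof -
  obtain Q Qi t where Q: "Q ** Qi = mat 1" "Qi ** Q = mat 1" "exp (of_nat N * t) = (1::complex)"
    "\<And>i a b c. i < N \<Longrightarrow> \<rho> i (Q ** m2 a b c (-a) ** Qi) =
       Q ** m2 a (b / exp (of_nat i * t)) (exp (of_nat i * t) * c) (-a) ** Qi"
    using cyclic_action_diagonal[OF \<rho> N] by metis
  define s where "s = \<sigma> (1 mod N)"
  note sgen = inj_hom_transl_generator[OF \<sigma> N L, folded s_def]
  \<comment> \<open>Modulo L the period \<open>v1\<close> is c1 times the generator, so its
    multiplier has to be a square root of exp(c1 t).\<close>
  obtain c1 u1 where c1: "v1 = of_int c1 * s + u1" "u1 \<in> L"
    using \<Lambda>_v1 unfolding S[symmetric] sgen(4) by auto
  obtain c2 u2 where c2: "v2 = of_int c2 * s + u2" "u2 \<in> L"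
    using \<Lambda>_v2 unfolding S[symmetric] sgen(4) by auto
  obtain m p q r d where m: "\<And>i j. m (of_int i * v1 + of_int j * v2) =
      exp (of_int i * (of_int c1 * t / 2) + of_int j * (of_int c2 * t / 2))"
    and qp: "quasi_per (\<lambda>l. inverse (m l)) p" "quasi_per (\<lambda>l. inverse (m l)) q"
    "quasi_per m r" "quasi_per m d" and det: "\<And>z. z \<notin> \<Lambda> \<Longrightarrow> p z * d z - q z * r z = 1"
    using unimodular_quasi_periodic[of "of_int c1 * t / 2" "of_int c2 * t / 2"] by metis
  note add = lattice_add[of _ w1 w2, folded L] and diff = lattice_diff[of _ w1 w2, folded L]
  note imul = lattice_int_mult[of _ w1 w2, folded L]
  have msq: "m l ^ 2 = exp (of_nat i * t)" "m l \<noteq> 0" if "i < N" "w \<in> L" "l = \<sigma> i + w" for i w l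
  proof -
    have "l \<in> \<Lambda>" using that unfolding S[symmetric] sing_set_def by blast
    then obtain a b where ab: "l = of_int a * v1 + of_int b * v2" by (rule in_\<Lambda>E)
    \<comment> \<open>Writing l once in the generators and once as \<open>\<sigma> i + w\<close>
      gives two multiples of \<open>s\<close> that agree modulo L. Their difference k is divisible
      by N, so it does not change the exponential.\<close>
    define k where "k = a * c1 + b * c2 - int i"
    have "of_int k * s = w + (\<sigma> i - of_nat i * s) - (of_int a * u1 + of_int b * u2)"
    proof -
      have "\<sigma> i + w = of_int a * (of_int c1 * s + u1) + of_int b * (of_int c2 * s + u2)"
        using ab that(3) c1(1) c2(1) by simp
      then show ?thesis by (simp add: k_def algebra_simps)
    qed
    also have "\<dots> \<in> L"
      by (intro diff add imul sgen(1) that c1 c2)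
    finally have "int N dvd k" by (rule sgen(3))
    then have "exp (of_int k * t) = 1" using exp_int_multiple[OF Q(3)] by blast
    then have "exp (of_nat i * t) = exp (of_int k * t) * exp (of_nat i * t)" by simp
    also have "\<dots> = exp (2 * (of_int a * (of_int c1 * t / 2) + of_int b * (of_int c2 * t / 2)))"
      by (simp add: k_def algebra_simps flip: exp_add)
    also have "\<dots> = m l ^ 2" unfolding ab m by (rule exp_double)
    finally show "m l ^ 2 = exp (of_nat i * t)" ..
    show "m l \<noteq> 0" unfolding ab m by simp
  qed
  define M where "M = (\<lambda>z. m2 (p z) (q z) (r z) (d z))"
  \<comment> \<open>The adjugate, which is the inverse because the determinant is 1.\<close>
  define Mi where "Mi = (\<lambda>z. m2 (d z) (- q z) (- r z) (p z))"
  have MM: "M z ** Mi z = mat 1" "Mi z ** M z = mat 1" if "z \<notin> \<Lambda>" for z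
    using det[OF that] by (simp_all add: M_def Mi_def m2_1 algebra_simps)
  have reg: "regular p" "regular q" "regular r" "regular d"
    using qp by (auto simp: quasi_per_def regular_def)
  show ?thesis
  proof (rule that[of "\<lambda>z. Q ** M z" "\<lambda>z. Mi z ** Qi"])
    show "regular_mat (\<lambda>z. Q ** M z)" "regular_mat (\<lambda>z. Mi z ** Qi)"
      unfolding M_def Mi_def
      by (auto intro!: regular_mat_mult regular_mat_const simp: regular_mat_m2 reg regular_uminus)
    show "Q ** M z ** (Mi z ** Qi) = mat 1" if "z \<notin> \<Lambda>" for z
      using MM(1)[OF that] Q(1) by (metis matrix_mul_assoc matrix_mul_rid)
    show "Mi z ** Qi ** (Q ** M z) = mat 1" if "z \<notin> \<Lambda>" for z
      using MM(2)[OF that] Q(2) by (metis matrix_mul_assoc matrix_mul_rid)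
    fix z i w and A :: "complex^2^2" assume z: "z \<notin> \<Lambda>" and i: "i < N" and w: "w \<in> L" and A: "A \<in> sl2"
    define l where "l = \<sigma> i + w"
    have l: "l \<in> \<Lambda>" using i w unfolding S[symmetric] sing_set_def l_def by blast
    note ml = msq[OF i w l_def]
    have zl: "z - l \<notin> \<Lambda>" using z l by (simp add: \<Lambda>_diff_iff)
    have shift: "f z = n l * f (z - l)" if "quasi_per n f" for f n
      using that zl l unfolding quasi_per_def by (metis diff_add_cancel)
    have val: "p (z - l) = m l * p z" "q (z - l) = m l * q z" "r (z - l) = r z / m l" "d (z - l) = d z / m l"
      using shift[OF qp(1)] shift[OF qp(2)] shift[OF qp(3)] shift[OF qp(4)] ml(2) by (simp_all add: field_simps)
    \<comment> \<open>The shift multiplies \<open>M\<close> from the left by diag(m, 1/m).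
      Conjugation by this diagonal matrix multiplies the upper right entry by m^2 and divides the
      lower left one by m^2, and \<open>\<rho> i\<close> undoes exactly that.\<close>
    have Ml: "M (z - l) = m2 (m l) 0 0 (1 / m l) ** M z" "Mi (z - l) = Mi z ** m2 (1 / m l) 0 0 (m l)"
      unfolding M_def Mi_def val by (simp_all add: field_simps)
    have "M z ** A ** Mi z \<in> sl2" by (rule sl2_conj[OF MM(2)[OF z] A])
    then obtain \<alpha> \<beta> \<gamma> where B: "M z ** A ** Mi z = m2 \<alpha> \<beta> \<gamma> (-\<alpha>)" by (rule sl2_cases)
    have "Q ** M (z - l) ** A ** (Mi (z - l) ** Qi) =
        Q ** (m2 (m l) 0 0 (1 / m l) ** (M z ** A ** Mi z) ** m2 (1 / m l) 0 0 (m l)) ** Qi"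
      unfolding Ml by (simp only: matrix_mul_assoc)
    also have "m2 (m l) 0 0 (1 / m l) ** (M z ** A ** Mi z) ** m2 (1 / m l) 0 0 (m l)
        = m2 \<alpha> (m l ^ 2 * \<beta>) (\<gamma> / m l ^ 2) (-\<alpha>)"
      unfolding B using ml(2) by (simp add: power2_eq_square)
    finally have "\<rho> i (Q ** M (z - l) ** A ** (Mi (z - l) ** Qi)) = Q ** m2 \<alpha> \<beta> \<gamma> (-\<alpha>) ** Qi"
      using Q(4)[OF i] ml by simp
    also have "\<dots> = Q ** M z ** A ** (Mi z ** Qi)"
      unfolding B[symmetric] by (simp only: matrix_mul_assoc)
    finally show "\<rho> i (Q ** M (z - (\<sigma> i + w)) ** A ** (Mi (z - (\<sigma> i + w)) ** Qi)) = Q ** M z ** A ** (Mi z ** Qi)"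
      unfolding l_def .
  qed
qed

end

section \<open>Invariant functions as polynomials in \<open>wp\<close> and
  \<open>wp'\<close>\<close>

lemma wp_poly_alg_uminus:
  assumes "p \<in> wp_poly_alg L" shows "(\<lambda>z. - p z) \<in> wp_poly_alg L"
proof -
  obtain n c where "p = (\<lambda>z. \<Sum>i\<le>(n::nat). \<Sum>j\<le>n. c i j * wp L z ^ i * wp' L z ^ j)"
    using assms unfolding wp_poly_alg_def by auto
  then have "(\<lambda>z. - p z) = (\<lambda>z. \<Sum>i\<le>n. \<Sum>j\<le>n. (- c i j) * wp L z ^ i * wp' L z ^ j)"
    by (simp add: sum_negf)
  then show ?thesis unfolding wp_poly_alg_def
    by (intro CollectI exI[of _ n] exI[of _ "\<lambda>i j. - c i j"])
qed

context complex_lattice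
begin

lemma regular_wp_poly_alg:
  assumes "p \<in> wp_poly_alg \<Lambda>" shows "regular p"
proof -
  obtain n c where p: "p = (\<lambda>z. \<Sum>i\<le>(n::nat). \<Sum>j\<le>n. c i j * wp \<Lambda> z ^ i * wp' \<Lambda> z ^ j)"
    using assms unfolding wp_poly_alg_def by auto
  have "wp' \<Lambda> meromorphic_on UNIV"
    unfolding wp'_def[abs_def] by (intro meromorphic_intros wp_meromorphic)
  then have "p meromorphic_on UNIV"
    unfolding p by (intro meromorphic_intros wp_meromorphic)
  then show ?thesis
    using elliptic_wp_poly_alg[OF assms] by (simp add: regular_def elliptic_def)
qed

text \<open>Periodicity under L and invariance under the translations together are periodicity under
  the whole singular set. A meromorphic function with these periods is elliptic with a pole of
  finite order at 0, and the normalisation on the lattice turns agreement off it into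
  equality.\<close>

lemma O_TT_inv_iff:
  assumes S: "sing_set N L \<sigma> = \<Lambda>" and L: "L \<subseteq> \<Lambda>" and \<sigma>: "\<And>i. i < N \<Longrightarrow> \<sigma> i \<in> \<Lambda>"
  shows "f \<in> O_TT_inv N L \<sigma> \<longleftrightarrow> (\<exists>p\<in>wp_poly_alg \<Lambda>. f = (\<lambda>z. if z \<in> - \<Lambda> then p z else 0))"
proof
  assume f: "f \<in> O_TT_inv N L \<sigma>"
  then have f': "f meromorphic_on UNIV" "f holomorphic_on - \<Lambda>" "\<And>z w. w \<in> L \<Longrightarrow> f (z + w) = f z"
    "\<And>z. z \<in> \<Lambda> \<Longrightarrow> f z = 0" "\<And>i z. i < N \<Longrightarrow> f (z - \<sigma> i) = f z"
    unfolding O_TT_inv_def O_TT_def S by auto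
  have "elliptic f"
    unfolding elliptic_def
  proof (intro conjI allI impI f'(2))
    fix z l assume "l \<in> \<Lambda>"
    then obtain i w where iw: "l = \<sigma> i + w" "i < N" "w \<in> L"
      unfolding S[symmetric] sing_set_def by auto
    have "f (z + l) = f (z + \<sigma> i + w)" by (simp add: iw add.assoc)
    also have "\<dots> = f (z + \<sigma> i)" by (rule f'(3)[OF iw(3)])
    also have "\<dots> = f z" using f'(5)[OF iw(2), of "z + \<sigma> i"] by simp
    finally show "f (z + l) = f z" .
  qed
  moreover obtain n F where "pole_form n F f"
    using meromorphic_pole_form meromorphic_on_subset[OF f'(1)] by blast
  ultimately obtain p where p: "p \<in> wp_poly_alg \<Lambda>" "\<And>z. z \<notin> \<Lambda> \<Longrightarrow> f z = p z"
    using elliptic_in_wp_poly_alg by blast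
  have "f = (\<lambda>z. if z \<in> - \<Lambda> then p z else 0)" using p(2) f'(4) by auto
  then show "\<exists>p\<in>wp_poly_alg \<Lambda>. f = (\<lambda>z. if z \<in> - \<Lambda> then p z else 0)" using p(1) by blast
next
  assume "\<exists>p\<in>wp_poly_alg \<Lambda>. f = (\<lambda>z. if z \<in> - \<Lambda> then p z else 0)"
  then obtain p where p: "p \<in> wp_poly_alg \<Lambda>" "f = (\<lambda>z. if z \<in> - \<Lambda> then p z else 0)" by blast
  have reg: "regular f" unfolding p(2) by (intro regular_restrict regular_wp_poly_alg p(1))
  have per: "f (z + l) = f z" if "l \<in> \<Lambda>" for z l
    using elliptic_wp_poly_alg[OF p(1)] that by (auto simp: p(2) elliptic_def \<Lambda>_add_iff)
  have "f (z - \<sigma> i) = f z" if "i < N" for i z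
    using per[of "- \<sigma> i" z] \<sigma>[OF that] by simp
  moreover have "f z = 0" if "z \<in> \<Lambda>" for z using that by (simp add: p(2))
  ultimately show "f \<in> O_TT_inv N L \<sigma>"
    using reg per L unfolding O_TT_inv_def O_TT_def S regular_def by blast
qed

lemma sl2_tensor_O_TT_iff:
  "X \<in> sl2_tensor (O_TT L \<Lambda>) \<longleftrightarrow> (\<forall>z. X z \<in> sl2) \<and> regular_mat X \<and>
     (\<forall>z. \<forall>w\<in>L. X (z + w) = X z) \<and> (\<forall>z\<in>\<Lambda>. X z = 0)"
  unfolding sl2_tensor_def O_TT_def regular_mat_def regular_def
  by (auto simp: vec_eq_iff)

lemma sl2_tensor_O_TT_inv_iff:
  assumes "sing_set N L \<sigma> = \<Lambda>"
  shows "X \<in> sl2_tensor (O_TT_inv N L \<sigma>) \<longleftrightarrow>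
     X \<in> sl2_tensor (O_TT L \<Lambda>) \<and> (\<forall>i<N. \<forall>z. X (z - \<sigma> i) = X z)"
  unfolding sl2_tensor_def O_TT_inv_def assms by (auto simp: vec_eq_iff)

end

lemma br_conj:
  assumes "Q ** Qi = mat 1"
  shows "br (Qi ** A ** Q) (Qi ** B ** Q) = Qi ** br A B ** Q"
proof -
  have "Qi ** X ** Q ** (Qi ** Y ** Q) = Qi ** (X ** Y) ** Q" for X Y
    using assms by (metis matrix_mul_assoc matrix_mul_rid)
  moreover have "Qi ** (X - Y) ** Q = Qi ** X ** Q - Qi ** Y ** Q" for X Y :: "complex^2^2"
    by (cases X rule: m2_cases; cases Y rule: m2_cases; cases Q rule: m2_cases; cases Qi rule: m2_cases)
       (simp add: algebra_simps)
  ultimately show ?thesis unfolding br_def by simp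
qed

lemma conj_linear: "Q ** (msc c A + B) ** R = msc c (Q ** A ** R) + Q ** B ** R"
  by (simp add: matrix_add_distribs msc_matrix_mult)

lemma br_0 [simp]: "br 0 0 = 0"
  by (simp add: m2_0)

theorem theorem6p8:
  fixes w1 w2 :: complex and N :: nat
    and \<rho> :: "nat \<Rightarrow> complex^2^2 \<Rightarrow> complex^2^2" and \<sigma> :: "nat \<Rightarrow> complex"
  assumes "lattice_gens w1 w2" and "N \<ge> 1"
    and "inj_hom_aut N \<rho>" and "inj_hom_transl N (lattice w1 w2) \<sigma>"
  defines "S \<equiv> sing_set N (lattice w1 w2) \<sigma>"
    and "Inv \<equiv> sl2_tensor_inv N (lattice w1 w2) \<rho> \<sigma>"
  shows "(\<exists>\<Phi>. lie_iso_C \<Phi> Inv (sl2_tensor (O_TT_inv N (lattice w1 w2) \<sigma>)))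
     \<and> (\<exists>v1 v2 E F H. lattice_gens v1 v2 \<and> E \<in> Inv \<and> F \<in> Inv \<and> H \<in> Inv
        \<and> Inv = {X. \<exists>p1\<in>wp_poly_alg (lattice v1 v2). \<exists>p2\<in>wp_poly_alg (lattice v1 v2).
                    \<exists>p3\<in>wp_poly_alg (lattice v1 v2).
                    X = restr (- S) (\<lambda>z. msc (p1 z) (E z) + msc (p2 z) (F z) + msc (p3 z) (H z))}
        \<and> (\<forall>p1\<in>wp_poly_alg (lattice v1 v2). \<forall>p2\<in>wp_poly_alg (lattice v1 v2).
             \<forall>p3\<in>wp_poly_alg (lattice v1 v2).
             (\<forall>z\<in>- S. msc (p1 z) (E z) + msc (p2 z) (F z) + msc (p3 z) (H z) = 0)
             \<longrightarrow> (\<forall>z\<in>- S. p1 z = 0 \<and> p2 z = 0 \<and> p3 z = 0))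
        \<and> fbr H E = (\<lambda>z. msc 2 (E z)) \<and> fbr H F = (\<lambda>z. msc (-2) (F z))
        \<and> fbr E F = H)"
proof -
  define L where "L = lattice w1 w2"
  have \<sigma>: "inj_hom_transl N L \<sigma>" using assms(4) by (simp add: L_def)
  define s where "s = \<sigma> (1 mod N)"
  note sgen = inj_hom_transl_generator[OF \<sigma> assms(2) L_def, folded s_def]
  have S_def': "S = sing_set N L \<sigma>" by (simp add: S_def L_def)
  have S_eq: "S = {of_int k * s + w | k w. w \<in> L}" unfolding S_def' by (rule sgen(4))
  obtain v1 v2 where v: "lattice_gens v1 v2" "S = lattice v1 v2"
  proof (rule superlattice_gens[OF assms(1,2), of S])
    show "lattice w1 w2 \<subseteq> S"
      unfolding S_eq L_def[symmetric] by (force intro: exI[of _ 0])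
    fix x assume "x \<in> S"
    then obtain k w where x: "x = of_int k * s + w" "w \<in> L" unfolding S_eq by auto
    show "x - y \<in> S" if "y \<in> S" for y
    proof -
      obtain k' w' where y: "y = of_int k' * s + w'" "w' \<in> L" using \<open>y \<in> S\<close> unfolding S_eq by auto
      have "x - y = of_int (k - k') * s + (w - w')" by (simp add: x y algebra_simps)
      moreover have "w - w' \<in> L" using x y lattice_diff unfolding L_def by blast
      ultimately show ?thesis unfolding S_eq by blast
    qed
    show "of_nat N * x \<in> lattice w1 w2"
    proof -
      have "of_nat N * x = of_int k * (of_nat N * s) + of_int (int N) * w" by (simp add: x algebra_simps)
      also have "\<dots> \<in> L" using sgen(2) x(2) unfolding L_def by (intro lattice_add lattice_int_mult)
      finally show ?thesis by (simp add: L_def)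
    qed
  qed
  \<comment> \<open>From here on \<open>\<Lambda>\<close> is the singular set S, not the period
    lattice L of the torus.\<close>
  interpret complex_lattice v1 v2 by unfold_locales (rule v(1))
  have S\<Lambda>: "S = \<Lambda>" using v(2) by (simp add: \<Lambda>_def)
  have sing: "sing_set N L \<sigma> = \<Lambda>" using S\<Lambda> S_def' by simp
  have \<sigma>\<Lambda>: "\<sigma> i + w \<in> \<Lambda>" if "i < N" "w \<in> L" for i w
    unfolding sing[symmetric] sing_set_def using that by blast
  have L0: "0 \<in> L" by (simp add: L_def)
  have Lneg: "- w \<in> L" if "w \<in> L" for w using that by (simp add: L_def)
  have Ldiff: "w - w' \<in> L" if "w \<in> L" "w' \<in> L" for w w' using that lattice_diff by (simp add: L_def)
  \<comment> \<open>The representative of the trivial translation is only known to lie in L, which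
    is why shifts by - w - \<open>\<sigma> 0\<close> occur below.\<close>
  have \<sigma>0: "\<sigma> 0 \<in> L" using sgen(1)[of 0] assms(2) by simp
  have \<sigma>in: "\<sigma> i \<in> \<Lambda>" if "i < N" for i using \<sigma>\<Lambda>[OF that L0] by simp
  have L\<Lambda>: "L \<subseteq> \<Lambda>"
  proof
    fix w assume "w \<in> L"
    then have "w - \<sigma> 0 \<in> L" by (rule Ldiff[OF _ \<sigma>0])
    then show "w \<in> \<Lambda>" using \<sigma>\<Lambda>[of 0 "w - \<sigma> 0"] assms(2) by simp
  qed
  obtain G Gi where reg: "regular_mat G" "regular_mat Gi"
    and GGi: "\<And>z. z \<notin> \<Lambda> \<Longrightarrow> G z ** Gi z = mat 1" "\<And>z. z \<notin> \<Lambda> \<Longrightarrow> Gi z ** G z = mat 1"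
    and tr: "\<And>z i w A. z \<notin> \<Lambda> \<Longrightarrow> i < N \<Longrightarrow> w \<in> L \<Longrightarrow> A \<in> sl2 \<Longrightarrow>
       \<rho> i (G (z - (\<sigma> i + w)) ** A ** Gi (z - (\<sigma> i + w))) = G z ** A ** Gi z"
    using trivialisation[OF assms(2,3) \<sigma> L_def sing] by metis
  define R where "R = sl2_tensor (O_TT_inv N L \<sigma>)"
  \<comment> \<open>Pointwise conjugation in both directions. \<open>restr\<close> restores the
    value 0 on the lattice, where \<open>G\<close> and \<open>Gi\<close> need not be inverse to each
    other.\<close>
  define \<Phi> where "\<Phi> = (\<lambda>X. restr (- \<Lambda>) (\<lambda>z. Gi z ** X z ** G z))"
  define \<Psi> where "\<Psi> = (\<lambda>Y. restr (- \<Lambda>) (\<lambda>z. G z ** Y z ** Gi z))"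
  have inv1: "Gi z ** (G z ** A ** Gi z) ** G z = A" if "z \<notin> \<Lambda>" for z A
    using GGi(2)[OF that] by (metis matrix_mul_assoc matrix_mul_lid matrix_mul_rid)
  have inv2: "G z ** (Gi z ** A ** G z) ** Gi z = A" if "z \<notin> \<Lambda>" for z A
    using GGi(1)[OF that] by (metis matrix_mul_assoc matrix_mul_lid matrix_mul_rid)
  note \<rho>id = inj_hom_aut_0[OF assms(3,2)]
  have \<rho>0: "\<rho> i 0 = 0" if "i < N" for i
  proof -
    have z: "(0::complex^2^2) \<in> sl2" by (simp add: m2_0)
    have "\<rho> i (msc 1 0 + 0) = msc 1 (\<rho> i 0) + \<rho> i 0"
      using assms(3) that z unfolding inj_hom_aut_def sl2_aut_def by blast
    then show ?thesis by simp
  qed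
  have Inv_iff: "X \<in> Inv \<longleftrightarrow> X \<in> sl2_tensor (O_TT L \<Lambda>) \<and> (\<forall>i<N. \<forall>z. \<rho> i (X (z - \<sigma> i)) = X z)" for X
    unfolding Inv_def sl2_tensor_inv_def L_def[symmetric] sing by blast
  have R_iff: "Y \<in> R \<longleftrightarrow> Y \<in> sl2_tensor (O_TT L \<Lambda>) \<and> (\<forall>i<N. \<forall>z. Y (z - \<sigma> i) = Y z)" for Y
    unfolding R_def by (rule sl2_tensor_O_TT_inv_iff[OF sing])
  have zero_sl2: "(0::complex^2^2) \<in> sl2" by (simp add: m2_0)
  have \<Phi>R: "\<Phi> X \<in> R" if X: "X \<in> Inv" for X
  proof -
    have X': "\<And>z. X z \<in> sl2" "regular_mat X" "\<And>z w. w \<in> L \<Longrightarrow> X (z + w) = X z" "\<And>z. z \<in> \<Lambda> \<Longrightarrow> X z = 0"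
      "\<And>i z. i < N \<Longrightarrow> \<rho> i (X (z - \<sigma> i)) = X z"
      using X unfolding Inv_iff sl2_tensor_O_TT_iff by auto
    have sl: "\<Phi> X z \<in> sl2" for z
      using sl2_conj[OF GGi(1) X'(1), of z z] zero_sl2 by (auto simp: \<Phi>_def restr_def)
    \<comment> \<open>Conjugation by \<open>G\<close> carries the twisted action to plain
      translation. Treating all shifts \<open>\<sigma> i + w\<close> at once yields both the periods
      (i = 0) and the invariance (w = 0).\<close>
    have key: "\<Phi> X (z - (\<sigma> i + w)) = \<Phi> X z" if i: "i < N" and w: "w \<in> L" for z i w
    proof (cases "z \<in> \<Lambda>")
      case True
      then show ?thesis using \<sigma>\<Lambda>[OF i w] by (simp add: \<Phi>_def restr_def \<Lambda>_diff_iff)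
    next
      case False
      define y where "y = z - (\<sigma> i + w)"
      have y: "y \<notin> \<Lambda>" using False \<sigma>\<Lambda>[OF i w] by (simp add: y_def \<Lambda>_diff_iff)
      have "G y ** \<Phi> X y ** Gi y = X y" using inv2[OF y] y by (simp add: \<Phi>_def restr_def)
      then have "\<rho> i (X y) = G z ** \<Phi> X y ** Gi z"
        using tr[OF False i w sl, of y] unfolding y_def[symmetric] by simp
      moreover have "X y = X (z - \<sigma> i)"
        using X'(3)[OF Lneg[OF w], of "z - \<sigma> i"] by (simp add: y_def algebra_simps)
      ultimately have "X z = G z ** \<Phi> X y ** Gi z" using X'(5)[OF i, of z] by simp
      then have "\<Phi> X z = \<Phi> X y" using inv1[OF False] False by (simp add: \<Phi>_def restr_def)
      then show ?thesis by (simp add: y_def)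
    qed
    have "\<Phi> X (z + w) = \<Phi> X z" if "w \<in> L" for z w
      using key[of 0 "- w - \<sigma> 0" z] assms(2) Ldiff[OF Lneg[OF that] \<sigma>0] by simp
    moreover have "\<Phi> X (z - \<sigma> i) = \<Phi> X z" if "i < N" for z i
      using key[OF that L0, of z] by simp
    moreover have "regular_mat (\<Phi> X)"
      unfolding \<Phi>_def by (intro regular_mat_restr regular_mat_mult reg X'(2))
    moreover have "\<Phi> X z = 0" if "z \<in> \<Lambda>" for z using that by (simp add: \<Phi>_def restr_def)
    ultimately show ?thesis unfolding R_iff sl2_tensor_O_TT_iff using sl by blast
  qed
  have \<Psi>Inv: "\<Psi> Y \<in> Inv" if Y: "Y \<in> R" for Y
  proof -
    have Y': "\<And>z. Y z \<in> sl2" "regular_mat Y" "\<And>z w. w \<in> L \<Longrightarrow> Y (z + w) = Y z" "\<And>z. z \<in> \<Lambda> \<Longrightarrow> Y z = 0"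
      "\<And>i z. i < N \<Longrightarrow> Y (z - \<sigma> i) = Y z"
      using Y unfolding R_iff sl2_tensor_O_TT_iff by auto
    have sl: "\<Psi> Y z \<in> sl2" for z
      using sl2_conj[OF GGi(2) Y'(1), of z z] zero_sl2 by (auto simp: \<Psi>_def restr_def)
    have key: "\<rho> i (\<Psi> Y (z - (\<sigma> i + w))) = \<Psi> Y z" if i: "i < N" and w: "w \<in> L" for z i w
    proof (cases "z \<in> \<Lambda>")
      case True
      then show ?thesis using \<sigma>\<Lambda>[OF i w] \<rho>0[OF i] by (simp add: \<Psi>_def restr_def \<Lambda>_diff_iff)
    next
      case False
      define y where "y = z - (\<sigma> i + w)"
      have y: "y \<notin> \<Lambda>" using False \<sigma>\<Lambda>[OF i w] by (simp add: y_def \<Lambda>_diff_iff)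
      have "Y y = Y (z - \<sigma> i)"
        using Y'(3)[OF Lneg[OF w], of "z - \<sigma> i"] by (simp add: y_def algebra_simps)
      then have "Y y = Y z" using Y'(5)[OF i] by simp
      then show ?thesis
        using tr[OF False i w Y'(1), of z] y False unfolding y_def[symmetric] by (simp add: \<Psi>_def restr_def)
    qed
    have "\<Psi> Y (z + w) = \<Psi> Y z" if "w \<in> L" for z w
      using key[of 0 "- w - \<sigma> 0" z] assms(2) Ldiff[OF Lneg[OF that] \<sigma>0] \<rho>id[OF sl] by simp
    moreover have "\<rho> i (\<Psi> Y (z - \<sigma> i)) = \<Psi> Y z" if "i < N" for z i
      using key[OF that L0, of z] by simp
    moreover have "regular_mat (\<Psi> Y)"
      unfolding \<Psi>_def by (intro regular_mat_restr regular_mat_mult reg Y'(2))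
    moreover have "\<Psi> Y z = 0" if "z \<in> \<Lambda>" for z using that by (simp add: \<Psi>_def restr_def)
    ultimately show ?thesis unfolding Inv_iff sl2_tensor_O_TT_iff using sl by blast
  qed
  have \<Psi>\<Phi>: "\<Psi> (\<Phi> X) = X" if "X \<in> Inv" for X
  proof
    fix z show "\<Psi> (\<Phi> X) z = X z"
      using that inv2[of z "X z"] unfolding Inv_iff sl2_tensor_O_TT_iff by (auto simp: \<Phi>_def \<Psi>_def restr_def)
  qed
  have \<Phi>\<Psi>: "\<Phi> (\<Psi> Y) = Y" if "Y \<in> R" for Y
  proof
    fix z show "\<Phi> (\<Psi> Y) z = Y z"
      using that inv1[of z "Y z"] unfolding R_iff sl2_tensor_O_TT_iff by (auto simp: \<Phi>_def \<Psi>_def restr_def)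
  qed
  have "lie_iso_C \<Phi> Inv R"
    unfolding lie_iso_C_def
  proof (intro conjI ballI allI)
    show "bij_betw \<Phi> Inv R"
      by (rule bij_betw_byWitness[of _ \<Psi>]) (use \<Psi>\<Phi> \<Phi>\<Psi> \<Phi>R \<Psi>Inv in auto)
    show "\<Phi> (\<lambda>z. msc c (X z) + Y z) = (\<lambda>z. msc c (\<Phi> X z) + \<Phi> Y z)" for X Y c
      by (auto simp: \<Phi>_def restr_def conj_linear)
    show "\<Phi> (fbr X Y) = fbr (\<Phi> X) (\<Phi> Y)" for X Y
      using br_conj[OF GGi(1)] by (auto simp: \<Phi>_def restr_def fbr_def)
  qed
  then have iso: "\<exists>\<Phi>. lie_iso_C \<Phi> Inv (sl2_tensor (O_TT_inv N (lattice w1 w2) \<sigma>))"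
    unfolding R_def L_def by blast
  \<comment> \<open>The images under \<open>\<Psi>\<close> of the constant standard basis of
    sl2.\<close>
  define E where "E = restr (- \<Lambda>) (\<lambda>z. G z ** m2 0 1 0 0 ** Gi z)"
  define F where "F = restr (- \<Lambda>) (\<lambda>z. G z ** m2 0 0 1 0 ** Gi z)"
  define H where "H = restr (- \<Lambda>) (\<lambda>z. G z ** m2 1 0 0 (-1) ** Gi z)"
  define K where "K = (\<lambda>p1 p2 p3. restr (- \<Lambda>) (\<lambda>z. m2 (p3 z) (p1 z) (p2 z) (- p3 z)))"
  have comb: "msc (p1 z) (E z) + msc (p2 z) (F z) + msc (p3 z) (H z) = G z ** m2 (p3 z) (p1 z) (p2 z) (- p3 z) ** Gi z"
    if "z \<notin> \<Lambda>" for p1 p2 p3 :: "complex \<Rightarrow> complex" and z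
  proof -
    have "m2 (p3 z) (p1 z) (p2 z) (- p3 z) = msc (p1 z) (m2 0 1 0 0) + (msc (p2 z) (m2 0 0 1 0) + msc (p3 z) (m2 1 0 0 (-1)))"
      by simp
    then show ?thesis
      using that by (simp add: E_def F_def H_def restr_def matrix_add_distribs msc_matrix_mult del: msc_m2 m2_add)
  qed
  have comb': "restr (- S) (\<lambda>z. msc (p1 z) (E z) + msc (p2 z) (F z) + msc (p3 z) (H z)) = \<Psi> (K p1 p2 p3)" for p1 p2 p3
    using comb by (auto simp: restr_def \<Psi>_def K_def S\<Lambda>)
  have K_R: "K p1 p2 p3 \<in> R" if "p1 \<in> wp_poly_alg \<Lambda>" "p2 \<in> wp_poly_alg \<Lambda>" "p3 \<in> wp_poly_alg \<Lambda>" for p1 p2 p3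
  proof -
    have r: "(\<lambda>z. if z \<in> - \<Lambda> then p z else 0) \<in> O_TT_inv N L \<sigma>" if "p \<in> wp_poly_alg \<Lambda>" for p
      using that O_TT_inv_iff[OF sing L\<Lambda> \<sigma>in] by blast
    have mp3: "(\<lambda>z. - p3 z) \<in> wp_poly_alg \<Lambda>" using that(3) by (rule wp_poly_alg_uminus)
    have nth: "(\<lambda>z. K p1 p2 p3 z $ i $ j) = (\<lambda>z. if z \<in> - \<Lambda> then m2 (p3 z) (p1 z) (p2 z) (- p3 z) $ i $ j else 0)" for i j
      by (auto simp: K_def restr_def)
    have "\<forall>i j. (\<lambda>z. K p1 p2 p3 z $ i $ j) \<in> O_TT_inv N L \<sigma>"
      unfolding nth forall_2 m2_nth by (intro conjI r that mp3)
    moreover have "K p1 p2 p3 z \<in> sl2" for z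
      using zero_sl2 by (auto simp: K_def restr_def)
    ultimately show ?thesis unfolding R_def sl2_tensor_def by blast
  qed
  have R_K: "\<exists>p1\<in>wp_poly_alg \<Lambda>. \<exists>p2\<in>wp_poly_alg \<Lambda>. \<exists>p3\<in>wp_poly_alg \<Lambda>. Y = K p1 p2 p3" if Y: "Y \<in> R" for Y
  proof -
    have ex: "\<exists>p\<in>wp_poly_alg \<Lambda>. (\<lambda>z. Y z $ i $ j) = (\<lambda>z. if z \<in> - \<Lambda> then p z else 0)" for i j
      using Y O_TT_inv_iff[OF sing L\<Lambda> \<sigma>in] unfolding R_def sl2_tensor_def by blast
    obtain p1 p2 p3 where p: "p1 \<in> wp_poly_alg \<Lambda>" "p2 \<in> wp_poly_alg \<Lambda>" "p3 \<in> wp_poly_alg \<Lambda>"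
      and eq: "(\<lambda>z. Y z $ 1 $ 2) = (\<lambda>z. if z \<in> - \<Lambda> then p1 z else 0)"
        "(\<lambda>z. Y z $ 2 $ 1) = (\<lambda>z. if z \<in> - \<Lambda> then p2 z else 0)"
        "(\<lambda>z. Y z $ 1 $ 1) = (\<lambda>z. if z \<in> - \<Lambda> then p3 z else 0)"
      using ex[of 1 2] ex[of 2 1] ex[of 1 1] by blast
    have "Y z = K p1 p2 p3 z" for z
    proof -
      have "Y z \<in> sl2" using Y unfolding R_def sl2_tensor_def by blast
      then obtain a b c where abc: "Y z = m2 a b c (- a)" by (rule sl2_cases)
      show ?thesis
        using fun_cong[OF eq(1), of z] fun_cong[OF eq(2), of z] fun_cong[OF eq(3), of z]
        unfolding abc by (auto simp: K_def restr_def m2_0)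
    qed
    then show ?thesis using p by blast
  qed
  \<comment> \<open>The description of the invariants reduces to that of the untwisted algebra,
    whose matrix entries are arbitrary polynomials up to trace zero.\<close>
  have "Inv = \<Psi> ` R"
    using \<Psi>Inv \<Psi>\<Phi> \<Phi>R by (metis (no_types, lifting) image_eqI image_subset_iff subsetI subset_antisym)
  then have Inv_eq: "Inv = {X. \<exists>p1\<in>wp_poly_alg \<Lambda>. \<exists>p2\<in>wp_poly_alg \<Lambda>. \<exists>p3\<in>wp_poly_alg \<Lambda>.
      X = restr (- S) (\<lambda>z. msc (p1 z) (E z) + msc (p2 z) (F z) + msc (p3 z) (H z))}"
    unfolding comb' using R_K K_R by blast
  have const: "\<Psi> (K (\<lambda>_. a) (\<lambda>_. b) (\<lambda>_. c)) \<in> Inv" for a b c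
    by (intro \<Psi>Inv K_R wp_poly_alg_const)
  have EFH: "E \<in> Inv" "F \<in> Inv" "H \<in> Inv"
  proof -
    have "E = \<Psi> (K (\<lambda>_. 1) (\<lambda>_. 0) (\<lambda>_. 0))" "F = \<Psi> (K (\<lambda>_. 0) (\<lambda>_. 1) (\<lambda>_. 0))"
      "H = \<Psi> (K (\<lambda>_. 0) (\<lambda>_. 0) (\<lambda>_. 1))"
      by (auto simp: E_def F_def H_def \<Psi>_def K_def restr_def)
    then show "E \<in> Inv" "F \<in> Inv" "H \<in> Inv" using const by simp_all
  qed
  have indep: "p1 z = 0 \<and> p2 z = 0 \<and> p3 z = 0"
    if "msc (p1 z) (E z) + msc (p2 z) (F z) + msc (p3 z) (H z) = 0" "z \<notin> \<Lambda>" for p1 p2 p3 :: "complex \<Rightarrow> complex" and z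
  proof -
    have "G z ** m2 (p3 z) (p1 z) (p2 z) (- p3 z) ** Gi z = 0" using comb[OF that(2)] that(1) by metis
    \<comment> \<open>Conjugating back exposes the three coefficients as matrix entries, so
      independence holds at each point separately.\<close>
    then have "m2 (p3 z) (p1 z) (p2 z) (- p3 z) = Gi z ** 0 ** G z" using inv1[OF that(2)] by metis
    then show ?thesis by (simp add: m2_0[symmetric]) (simp add: m2_0)
  qed
  have bracket: "fbr (restr (- \<Lambda>) (\<lambda>z. G z ** A ** Gi z)) (restr (- \<Lambda>) (\<lambda>z. G z ** B ** Gi z))
      = restr (- \<Lambda>) (\<lambda>z. G z ** br A B ** Gi z)" for A B
    using br_conj[OF GGi(2)] by (auto simp: fbr_def restr_def)
  have scale: "(\<lambda>z. msc c (restr (- \<Lambda>) (\<lambda>z. G z ** A ** Gi z) z)) = restr (- \<Lambda>) (\<lambda>z. G z ** msc c A ** Gi z)" for c A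
    by (auto simp: restr_def msc_matrix_mult)
  have brackets: "fbr H E = (\<lambda>z. msc 2 (E z))" "fbr H F = (\<lambda>z. msc (-2) (F z))" "fbr E F = H"
    unfolding E_def F_def H_def bracket scale by simp_all
  show ?thesis
  proof (rule conjI[OF iso], rule exI[of _ v1], rule exI[of _ v2], rule exI[of _ E], rule exI[of _ F], rule exI[of _ H],
      unfold \<Lambda>_def[symmetric], intro conjI v(1) EFH Inv_eq brackets ballI impI)
    fix p1 p2 p3 z
    assume "\<forall>z\<in>- S. msc (p1 z) (E z) + msc (p2 z) (F z) + msc (p3 z) (H z) = 0" "z \<in> - S"
    then have "p1 z = 0 \<and> p2 z = 0 \<and> p3 z = 0"
      by (intro indep) (auto simp: S\<Lambda>)
    then show "p1 z = 0" "p2 z = 0" "p3 z = 0" by auto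
  qed
qed

end
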